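(* Let $s>0$ and $1\le p<\infty$. For each $f\in\dot W^{s,p}(\mathbb{R}^N)$, there exists $T_f\in \mathrm{SL}_N$ such that $$|f\circ T_f|_{W^{s,p}}=\min\{|f\circ T|_{W^{s,p}}:\ T\in\mathrm{SL}_N\}.$$
   Context: $N\ge 2$ is an integer; $\mathrm{SL}_N$ is the group of real $N\times N$ matrices of determinant $1$, identified with linear maps of $\mathbb{R}^N$. For $f:\mathbb{R}^N\to\mathbb{R}$ measurable and $h\in\mathbb{R}^N$, $\Delta_h f(x)=f(x+h)-f(x)$ and $\Delta_h^{m+1}=\Delta_h\circ\Delta_h^m$. $\lfloor s\rfloor$ is the integer part of $s$. Homogeneous Sobolev spaces. If $s$ is not an integer, $\dot W^{s,p}(\mathbb{R}^N)$ is the space of $f\in L^1_{\mathrm{loc}}(\mathbb{R}^N)$ with $|f|_{W^{s,p}}<\infty$, where $|f|_{W^{s,p}}^p=\int_{\mathbb{R}^N}\frac{\|\Delta_h^{\lfloor s\rfloor+1}f\|_{L^p}^p}{|h|^{sp+N}}\,dh$. If $s\ge1$ is an integer, $\dot W^{s,p}(\mathbb{R}^N)$ is the space of $f\in W^{s,1}_{\mathrm{loc}}(\mathbb{R}^N)$ with $|f|_{W^{s,p}}<\infty$, where $|f|_{W^{s,p}}^p=\int_{\mathbb{R}^N}\|D^s_xf\|^p\,dx$; here $D_x^sf$ is the $s$-linear form given by the $s$-th derivative of $f$ at $x$ and $\|\eta\|=\sup_{|x_1|\le1,\dots,|x_s|\le1}|\eta(x_1,\dots,x_s)|$. *)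

theory Defs
  imports "HOL-Analysis.Analysis"
begin

text \<open>Elements of function spaces are represented by functions rather than by classes modulo
  equality almost everywhere; all notions below are invariant under changes on null sets.\<close>

definition SL :: "(real^'n^'n) set" where
  "SL = {A. det A = 1}"

definition locally_integrable :: "(real^'n \<Rightarrow> real) \<Rightarrow> bool" where
  "locally_integrable f \<longleftrightarrow> (\<forall>K. compact K \<longrightarrow> f absolutely_integrable_on K)"

definition difference :: "real^'n \<Rightarrow> (real^'n \<Rightarrow> real) \<Rightarrow> real^'n \<Rightarrow> real" where
  "difference h f = (\<lambda>x. f (x + h) - f x)"

definition partial_deriv :: "'n \<Rightarrow> (real^'n \<Rightarrow> real) \<Rightarrow> real^'n \<Rightarrow> real" where
  "partial_deriv i f = (\<lambda>x. frechet_derivative f (at x) (axis i 1))"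

text \<open>For a list \<open>\<alpha> = [i\<^sub>1, \<dots>, i\<^sub>k]\<close> of coordinate indices, the iterated derivative
  \<open>\<partial>\<^bsub>i\<^sub>1\<^esub> \<dots> \<partial>\<^bsub>i\<^sub>k\<^esub> f\<close>.\<close>

definition iterated_partial :: "'n list \<Rightarrow> (real^'n \<Rightarrow> real) \<Rightarrow> real^'n \<Rightarrow> real" where
  "iterated_partial \<alpha> f = foldr partial_deriv \<alpha> f"

definition test_function :: "(real^'n \<Rightarrow> real) \<Rightarrow> bool" where
  "test_function \<phi> \<longleftrightarrow>
     (\<forall>\<alpha> x. iterated_partial \<alpha> \<phi> differentiable (at x)) \<and> compact (closure {x. \<phi> x \<noteq> 0})"

definition has_weak_deriv ::
    "(real^'n \<Rightarrow> real) \<Rightarrow> 'n list \<Rightarrow> (real^'n \<Rightarrow> real) \<Rightarrow> bool" where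
  "has_weak_deriv f \<alpha> g \<longleftrightarrow> locally_integrable g \<and>
     (\<forall>\<phi>. test_function \<phi> \<longrightarrow>
        (LINT x|lebesgue. f x * iterated_partial \<alpha> \<phi> x)
          = (-1) ^ length \<alpha> * (LINT x|lebesgue. g x * \<phi> x))"

text \<open>The weak derivative is determined only up to a null set, so a representative is chosen.\<close>

definition weak_deriv :: "'n list \<Rightarrow> (real^'n \<Rightarrow> real) \<Rightarrow> real^'n \<Rightarrow> real" where
  "weak_deriv \<alpha> f = (SOME g. has_weak_deriv f \<alpha> g)"

text \<open>The space \<open>W\<^sup>k\<^sup>,\<^sup>1\<close> with index \<open>loc\<close>.\<close>

definition sobolev_loc :: "nat \<Rightarrow> (real^'n \<Rightarrow> real) set" where
  "sobolev_loc k = {f. locally_integrable f \<and>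
     (\<forall>\<alpha>. length \<alpha> \<le> k \<longrightarrow> (\<exists>g. has_weak_deriv f \<alpha> g))}"

text \<open>The \<open>k\<close>-th weak derivative at \<open>x\<close> as a \<open>k\<close>-linear form; its \<open>k\<close> arguments are
  passed as a list.\<close>

definition weak_derivative_form ::
    "nat \<Rightarrow> (real^'n \<Rightarrow> real) \<Rightarrow> real^'n \<Rightarrow> (real^'n) list \<Rightarrow> real" where
  "weak_derivative_form k f x vs =
     (\<Sum>\<alpha> | length \<alpha> = k. weak_deriv \<alpha> f x * (\<Prod>j<k. (vs ! j) $ (\<alpha> ! j)))"

definition form_norm :: "nat \<Rightarrow> ((real^'n) list \<Rightarrow> real) \<Rightarrow> real" where
  "form_norm k \<eta> = (SUP vs \<in> {vs. length vs = k \<and> (\<forall>v \<in> set vs. norm v \<le> 1)}. \<bar>\<eta> vs\<bar>)"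

text \<open>The \<open>p\<close>-th power of the seminorm. For integer \<open>s\<close> it is set to \<open>\<infinity>\<close> off the space
  \<^const>\<open>sobolev_loc\<close>, where the derivative is not defined.\<close>

definition sobolev_energy :: "real \<Rightarrow> real \<Rightarrow> (real^'n \<Rightarrow> real) \<Rightarrow> ennreal" where
  "sobolev_energy s p f =
     (if s \<in> \<int>
      then if f \<in> sobolev_loc (nat \<lfloor>s\<rfloor>)
           then \<integral>\<^sup>+ x. ennreal (form_norm (nat \<lfloor>s\<rfloor>) (weak_derivative_form (nat \<lfloor>s\<rfloor>) f x) powr p)
                  \<partial>lebesgue
           else \<infinity>
      else \<integral>\<^sup>+ h. (\<integral>\<^sup>+ x. ennreal (\<bar>(difference h ^^ (nat \<lfloor>s\<rfloor> + 1)) f x\<bar> powr p) \<partial>lebesgue)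
                    / ennreal (norm h powr (s * p + real CARD('n))) \<partial>lebesgue)"

definition sobolev_seminorm :: "real \<Rightarrow> real \<Rightarrow> (real^'n \<Rightarrow> real) \<Rightarrow> ennreal" where
  "sobolev_seminorm s p f =
     (if sobolev_energy s p f = \<infinity> then \<infinity>
      else ennreal (enn2real (sobolev_energy s p f) powr (1 / p)))"

definition homogeneous_sobolev :: "real \<Rightarrow> real \<Rightarrow> (real^'n \<Rightarrow> real) set" where
  "homogeneous_sobolev s p =
     {f. (if s \<in> \<int> then f \<in> sobolev_loc (nat \<lfloor>s\<rfloor>) else locally_integrable f) \<and>
         sobolev_seminorm s p f < \<infinity>}"

end

theory Submission
  imports Defs
begin

text \<open>
  Write \<open>E T\<close> for the energy of \<open>f \<circ> T\<close>, the \<open>p\<close>-th power of the seminorm. On \<open>SL\<close> the function \<open>E\<close> is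
  lower semicontinuous: after a suitable substitution the integrand depends lower semicontinuously
  on \<open>T\<close>, and Fatou's lemma applies. As \<open>SL\<close> is closed but unbounded, a minimizer exists as soon
  as \<open>E\<close> cannot stay bounded along a sequence \<open>T\<^sub>n\<close> in \<open>SL\<close> with \<open>norm T\<^sub>n\<close> tending to infinity. This can fail
  only if \<open>E\<close> vanishes at the identity, which is then a minimizer itself. The argument is
  \<open>SL_has_minimizer\<close>; it may be assumed there that \<open>T\<^sub>n / norm T\<^sub>n\<close> converges to some \<open>L \<noteq> 0\<close>.

  For fractional \<open>s\<close> put \<open>m = \<lfloor>s\<rfloor> + 1\<close> and let \<open>G h\<close> be the \<open>p\<close>-th power of the \<open>L\<^sup>p\<close> norm of the \<open>m\<close>-th
  difference of \<open>f\<close> with step \<open>h\<close>, so that \<open>E T\<close> is the integral of \<open>G (T h)\<close> against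
  \<open>norm h powr - (s p + N)\<close>. If \<open>G\<close> does not vanish almost everywhere, some \<open>k\<close> satisfies
  \<open>0 < G k < \<infinity>\<close>, and the \<open>m\<close>-th difference \<open>g\<close> of \<open>f\<close> with step \<open>k\<close> is a nonzero element of \<open>L\<^sup>p\<close>. For
  large \<open>h\<close> the translates of \<open>g\<close> by multiples of \<open>h\<close> hardly overlap, so the \<open>m\<close>-th difference of \<open>g\<close>
  with step \<open>h\<close> does not become small; it is dominated by that of \<open>f\<close>, since differences commute. Hence \<open>G\<close>
  is bounded below near infinity (\<open>difference_energy_bounded_below_at_infinity\<close>). Now \<open>T\<^sub>n h\<close> tends to
  infinity for almost every \<open>h\<close>, and \<open>E T\<^sub>n\<close> tends to infinity because the kernel is not integrable at
  the origin (\<open>fractional_energy_coercive\<close>).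

  For an integer \<open>s = k\<close> the energy \<open>E T\<close> is the integral of the \<open>p\<close>-th power of the norm of the \<open>k\<close>-th
  derivative, pulled back by \<open>T\<close>. This makes sense for every matrix, and is homogeneous of degree
  \<open>k p\<close>. If \<open>E T\<^sub>n\<close> stays bounded, then \<open>E L = 0\<close>, and the \<open>k\<close>-th derivative of \<open>f\<close> in the direction of a
  nonzero vector \<open>v\<close> in the range of \<open>L\<close> vanishes. Paired with translates of a test function along \<open>v\<close>,
  each derivative of order \<open>k\<close> then yields a polynomial in the translation parameter, and this
  polynomial tends to \<open>0\<close> since the derivative is in \<open>L\<^sup>p\<close>. So all derivatives of order \<open>k\<close> vanish
  (\<open>top_order_weak_deriv_vanishes\<close>) and \<open>E\<close> is \<open>0\<close> at the identity.

  The remaining parts supply the invariance of Lebesgue measure under \<open>SL\<close>, enough test functions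
  to make weak derivatives unique almost everywhere, and the transformation of weak derivatives
  under linear maps.
\<close>

section \<open>Minimization over the special linear group\<close>

lemma tendsto_det:
  fixes X :: "'b \<Rightarrow> real^'n^'n"
  assumes "(X \<longlongrightarrow> T) F"
  shows "((\<lambda>k. det (X k)) \<longlongrightarrow> det T) F"
  unfolding det_def by (intro tendsto_intros assms)

lemma tendsto_matrix_vector_mult:
  fixes X :: "'b \<Rightarrow> real^'n^'m"
  assumes "(X \<longlongrightarrow> T) F"
  shows "((\<lambda>k. X k *v h) \<longlongrightarrow> T *v h) F"
  unfolding matrix_vector_mult_def
  by (rule vec_tendstoI, unfold vec_lambda_beta) (intro tendsto_intros assms)

lemma closed_SL: "closed (SL :: (real^'n^'n) set)"
  unfolding closed_sequential_limits SL_def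
  using LIMSEQ_unique[OF tendsto_det] by (auto intro: tendsto_const simp: tendsto_const_iff dest!: tendsto_det)

lemma SL_matrix_inv:
  assumes "T \<in> SL"
  shows "matrix_inv T \<in> SL"
    "matrix_inv T *v (T *v x) = x" "T *v (matrix_inv T *v x) = x"
proof -
  have "det T \<noteq> 0" using assms by (simp add: SL_def)
  then have "\<exists>A'. T ** A' = mat 1 \<and> A' ** T = mat 1"
    unfolding invertible_det_nz[symmetric] invertible_def .
  from someI_ex[OF this] have i: "T ** matrix_inv T = mat 1" "matrix_inv T ** T = mat 1"
    unfolding matrix_inv_def by auto
  show "matrix_inv T *v (T *v x) = x" "T *v (matrix_inv T *v x) = x"
    by (simp_all add: matrix_vector_mul_assoc i)
  have "det T * det (matrix_inv T) = 1" using i(1) by (metis det_I det_mul)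
  then show "matrix_inv T \<in> SL" using assms by (simp add: SL_def)
qed

text \<open>By Cramer's rule the entries of \<open>matrix_inv A *v h\<close> are quotients of polynomials in the entries of
  \<open>A\<close> with denominator \<open>det A\<close>.\<close>

lemma tendsto_matrix_inv_SL:
  fixes X :: "nat \<Rightarrow> real^'n^'n"
  assumes X: "\<And>k. X k \<in> SL" and T: "T \<in> SL" and lim: "X \<longlonglongrightarrow> T"
  shows "(\<lambda>k. matrix_inv (X k) *v h) \<longlonglongrightarrow> matrix_inv T *v h"
proof -
  define c where "c A = (\<chi> k. det (\<chi> i j. if j = k then h $ i else A $ i $ j) / det A)" for A :: "real^'n^'n"
  have eq: "matrix_inv A *v h = c A" if "A \<in> SL" for A
    using cramer[of A "matrix_inv A *v h" h] SL_matrix_inv(3)[OF that, of h] that by (simp add: c_def SL_def)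
  have "(\<lambda>k. c (X k)) \<longlonglongrightarrow> c T"
    unfolding c_def
  proof (intro vec_tendstoI, simp only: vec_lambda_beta, intro tendsto_divide tendsto_det lim vec_tendstoI, simp only: vec_lambda_beta)
    show "det T \<noteq> 0" using T by (simp add: SL_def)
    show "(\<lambda>x. if j = k then h $ i else X x $ i $ j) \<longlonglongrightarrow> (if j = k then h $ i else T $ i $ j)" for i j k
      by (cases "j = k") (auto intro!: tendsto_intros lim)
  qed
  then show ?thesis using X T by (simp add: eq)
qed

text \<open>The direct method on a closed but unbounded group. A bounded minimizing sequence has a limit in
  \<open>SL\<close>, which is a minimizer by lower semicontinuity. An unbounded one has a subsequence whose norms
  tend to infinity and whose directions converge on the unit sphere, to a singular matrix;
  the hypothesis \<open>coercive\<close> covers exactly this case, and turns it into the trivial situation in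
  which the identity has energy \<open>0\<close>.\<close>

lemma SL_has_minimizer:
  fixes E :: "real^'n^'n \<Rightarrow> ennreal"
  assumes lsc: "\<And>X T. (\<And>k. X k \<in> SL) \<Longrightarrow> T \<in> SL \<Longrightarrow> X \<longlonglongrightarrow> T \<Longrightarrow> E T \<le> liminf (\<lambda>k. E (X k))"
    and coercive: "\<And>X L C. (\<And>k. X k \<in> SL) \<Longrightarrow> filterlim (\<lambda>k. norm (X k)) at_top sequentially
      \<Longrightarrow> (\<lambda>k. X k /\<^sub>R norm (X k)) \<longlonglongrightarrow> L \<Longrightarrow> norm L = 1 \<Longrightarrow> (\<And>k. E (X k) \<le> C) \<Longrightarrow> C < \<infinity> \<Longrightarrow> E (mat 1) = 0"
    and fin: "E (mat 1) < \<infinity>"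
  shows "\<exists>T\<in>SL. \<forall>S\<in>SL. E T \<le> E S"
proof -
  have one: "mat 1 \<in> (SL :: (real^'n^'n) set)" by (simp add: SL_def)
  define m where "m = Inf (E ` SL)"
  have m_le: "m \<le> E S" if "S \<in> SL" for S unfolding m_def using that by (rule INF_lower)
  have "\<exists>T\<in>SL. E T \<le> m"
  proof (cases "E (mat 1) \<le> m")
    case True with one show ?thesis by blast
  next
    case False
    have "E ` SL \<noteq> {}" using one by auto
    then obtain u where u: "\<And>n. u n \<in> E ` SL" "u \<longlonglongrightarrow> m"
      unfolding m_def using Inf_as_limit[of "E ` SL"] by blast
    then have "\<forall>n. \<exists>x. x \<in> SL \<and> u n = E x" by auto
    then obtain X0 where X0: "\<And>n. X0 n \<in> SL" "\<And>n. u n = E (X0 n)" by metis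
    \<comment> \<open>discarding finitely many terms bounds the energies by that of the identity, as \<open>coercive\<close> requires\<close>
    have "eventually (\<lambda>n. u n < E (mat 1)) sequentially"
      using u(2) False by (intro order_tendstoD(2)) auto
    then obtain n0 where n0: "\<And>n. n \<ge> n0 \<Longrightarrow> u n < E (mat 1)"
      by (auto simp: eventually_sequentially)
    define X where "X n = X0 (n + n0)" for n
    have XSL: "X n \<in> SL" for n by (simp add: X_def X0)
    have XE: "E (X n) \<le> E (mat 1)" for n using n0[of "n + n0"] by (simp add: X_def X0(2)[symmetric] less_imp_le)
    have Xlim: "(\<lambda>n. E (X n)) \<longlonglongrightarrow> m"
      using LIMSEQ_ignore_initial_segment[OF u(2), of n0] by (simp add: X_def X0(2))
    show ?thesis
    proof (cases "bounded (range X)")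
      case True
      then obtain T r where r: "strict_mono (r :: nat \<Rightarrow> nat)" and T: "(X \<circ> r) \<longlonglongrightarrow> T"
        using bounded_imp_convergent_subsequence by blast
      have "T \<in> SL" using closed_SL T XSL unfolding closed_sequential_limits by (metis comp_apply)
      have "E T \<le> liminf (\<lambda>k. E ((X \<circ> r) k))"
        using XSL T \<open>T \<in> SL\<close> by (intro lsc) (auto simp: o_def)
      also have "\<dots> = m"
        using LIMSEQ_subseq_LIMSEQ[OF Xlim r] by (intro lim_imp_Liminf) (auto simp: o_def)
      finally show ?thesis using \<open>T \<in> SL\<close> by blast
    next
      case False
      then have "\<forall>n. \<exists>k. real n < norm (X k)"
        unfolding bounded_iff by (auto simp: not_le)
      then obtain \<kappa> where \<kappa>: "\<And>n. real n < norm (X (\<kappa> n))" by metis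
      define Y where "Y n = X (\<kappa> n)" for n
      have Ytop: "filterlim (\<lambda>n. norm (Y n)) at_top sequentially"
        using \<kappa> by (intro filterlim_at_top_mono[OF filterlim_real_sequentially]) (auto simp: Y_def intro!: always_eventually less_imp_le)
      have Ypos: "norm (Y n) > 0" for n unfolding Y_def using \<kappa>[of n] by (rule le_less_trans[rotated]) simp
      have "\<forall>n. Y n /\<^sub>R norm (Y n) \<in> sphere 0 1" using Ypos by simp
      moreover have "compact (sphere 0 1 :: (real^'n^'n) set)" by simp
      ultimately obtain L r where L: "L \<in> sphere 0 1" and r: "strict_mono (r :: nat \<Rightarrow> nat)"
        and lim: "((\<lambda>n. Y n /\<^sub>R norm (Y n)) \<circ> r) \<longlonglongrightarrow> L"
        unfolding compact_def by meson
      have "E (mat 1) = 0"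
      proof (rule coercive[of "Y \<circ> r" L "E (mat 1)"])
        show "filterlim (\<lambda>k. norm ((Y \<circ> r) k)) at_top sequentially"
          using filterlim_compose[OF Ytop filterlim_subseq[OF r]] by simp
      qed (use lim L fin XSL XE in \<open>auto simp: o_def Y_def\<close>)
      with one show ?thesis by (metis zero_le)
    qed
  qed
  then show ?thesis using m_le order_trans by blast
qed

section \<open>Invariance of Lebesgue measure and local integrability\<close>

lemma matrix_vector_mult_borel_measurable [measurable]:
  fixes A :: "real^'n^'m"
  shows "(*v) A \<in> borel_measurable borel"
  by (intro borel_measurable_continuous_onI linear_continuous_on matrix_vector_mul_bounded_linear)

text \<open>For a closed box whose lower corner is the origin, \<open>measure_shear_interval\<close> gives the volume of the
  sheared box. Translation reduces the general case to this one, and the boundary of a box is a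
  null set, also after shearing.\<close>

lemma emeasure_shear_box:
  fixes l u :: "real^'n"
  assumes mn: "m \<noteq> n" and le: "\<And>b. b \<in> Basis \<Longrightarrow> l \<bullet> b \<le> u \<bullet> b"
  shows "emeasure lebesgue ((\<lambda>x. \<chi> i. if i = m then x$m + x$n else x$i) ` box l u)
    = (\<Prod>b\<in>Basis. (u - l) \<bullet> b)"
proof -
  let ?S = "\<lambda>x::real^'n. \<chi> i. if i = m then x$m + x$n else x$i"
  have lin: "linear ?S"
    by (rule linearI) (auto simp: vec_eq_iff algebra_simps)
  define w where "w = (- l)"
  have ne: "cbox (w + l) (w + u) \<noteq> {}"
    using le by (auto simp: box_ne_empty inner_simps)
  have img: "cbox (w + l) (w + u) = (+) w ` cbox l u"
    by (simp add: cbox_translation)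
  have m1: "?S ` cbox (w + l) (w + u) \<in> lmeasurable"
    "measure lebesgue (?S ` cbox (w + l) (w + u)) = measure lebesgue (cbox (w + l) (w + u))"
    using measurable_shear_interval[OF mn ne] measure_shear_interval[OF mn ne]
    by (auto simp: w_def)
  have eq: "?S ` cbox l u = (+) (- ?S w) ` ?S ` cbox (w + l) (w + u)"
    unfolding img image_image using linear_add[OF lin] by (intro image_cong) auto
  have c1: "?S ` cbox l u \<in> lmeasurable"
    unfolding eq by (rule measurable_translation[OF m1(1)])
  have c2: "measure lebesgue (?S ` cbox l u) = measure lebesgue (cbox l u)"
    unfolding eq measure_translation m1(2) unfolding img measure_translation ..
  have neg: "negligible (?S ` (cbox l u - box l u))"
    by (rule negligible_differentiable_image_negligible)
      (auto simp: negligible_frontier_interval intro!: linear_imp_differentiable_on lin)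
  have "emeasure lebesgue (?S ` box l u) = emeasure lebesgue (?S ` cbox l u)"
  proof (rule emeasure_eq_AE)
    show "AE x in lebesgue. (x \<in> ?S ` box l u) = (x \<in> ?S ` cbox l u)"
      using neg[unfolded negligible_iff_null_sets, THEN AE_not_in] 
    proof eventually_elim
      case (elim x)
      then show ?case using box_subset_cbox by fastforce
    qed
    show "?S ` cbox l u \<in> sets lebesgue" using c1 by auto
    have "?S ` box l u = ?S ` cbox l u - ?S ` (cbox l u - box l u)"
    proof -
      have "inj ?S"
      proof (rule inj_on_inverseI)
        show "(\<chi> i. if i = m then (?S x)$m - (?S x)$n else (?S x)$i) = x" for x
          using mn by (simp add: vec_eq_iff)
      qed
      then have "?S ` (cbox l u - (cbox l u - box l u)) = ?S ` cbox l u - ?S ` (cbox l u - box l u)"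
        by (rule image_set_diff)
      moreover have "cbox l u - (cbox l u - box l u) = box l u"
        using box_subset_cbox[of l u] by auto
      ultimately show ?thesis
        by (simp only:)
    qed
    then show "?S ` box l u \<in> sets lebesgue"
      using sets.Diff[OF fmeasurableD[OF c1] null_setsD2[OF neg[unfolded negligible_iff_null_sets]]]
      by (simp only:)
  qed
  also have "\<dots> = emeasure lborel (cbox l u)"
    unfolding emeasure_eq_measure2[OF c1] c2 by (simp add: emeasure_eq_measure2[symmetric] lmeasurable_cbox)
  finally show ?thesis using le by (simp add: emeasure_lborel_cbox_eq)
qed

lemma distr_lborel_shear:
  assumes mn: "m \<noteq> n"
  shows "distr lborel borel (\<lambda>x::real^'n. \<chi> i. if i = m then x$m + x$n else x$i) = lborel"
proof -
  let ?S = "\<lambda>x::real^'n. \<chi> i. if i = m then x$m + x$n else x$i"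
  let ?S' = "\<lambda>x::real^'n. \<chi> i. if i = m then x$m - x$n else x$i"
  have "linear ?S" "linear ?S'"
    by (rule linearI; auto simp: vec_eq_iff algebra_simps)+
  then have [measurable]: "?S \<in> borel_measurable borel" "?S' \<in> borel_measurable borel"
    by (auto intro!: borel_measurable_continuous_onI linear_continuous_on simp: linear_conv_bounded_linear)
  have inv: "?S (?S' x) = x" "?S' (?S x) = x" for x
    using mn by (auto simp: vec_eq_iff)
  have "lborel = distr lborel borel ?S'"
  proof (rule lborel_eqI)
    fix l u :: "real^'n" assume le: "\<And>b. b \<in> Basis \<Longrightarrow> l \<bullet> b \<le> u \<bullet> b"
    have "?S' -` box l u = ?S ` box l u"
    proof (intro set_eqI iffI)
      show "x \<in> ?S ` box l u" if "x \<in> ?S' -` box l u" for x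
        using that inv(1)[of x] by (intro image_eqI[of x ?S "?S' x"]) (simp_all only: vimage_eq)
      show "x \<in> ?S' -` box l u" if "x \<in> ?S ` box l u" for x
        using that inv(2) by (auto simp only: vimage_eq elim!: imageE)
    qed
    moreover have "?S' -` box l u \<in> sets borel"
      using measurable_sets_borel[of ?S' borel "box l u"] by simp
    ultimately show "emeasure (distr lborel borel ?S') (box l u) = (\<Prod>b\<in>Basis. (u - l) \<bullet> b)"
      using emeasure_shear_box[OF mn le] by (simp add: emeasure_distr)
  qed simp
  then have "distr lborel borel ?S = distr (distr lborel borel ?S') borel ?S"
    by simp
  also have "\<dots> = distr lborel borel (?S \<circ> ?S')"
    by (intro distr_distr) auto
  also have "?S \<circ> ?S' = (\<lambda>x. x)"
    using inv by auto
  finally show ?thesis by (simp add: distr_id2)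
qed

text \<open>Both sides behave multiplicatively in \<open>A\<close>, so Gaussian elimination leaves only diagonal matrices,
  coordinate transpositions and shears.\<close>

lemma nn_integral_lborel_linear:
  fixes A :: "real^'n^'n"
  shows "det A \<noteq> 0 \<Longrightarrow> F \<in> borel_measurable borel \<Longrightarrow>
    (\<integral>\<^sup>+x. F x \<partial>lborel) = ennreal \<bar>det A\<bar> * (\<integral>\<^sup>+x. F (A *v x) \<partial>lborel)"
proof (induction A arbitrary: F rule: induct_matrix_elementary_alt)
  case (1 A B F)
  have d: "det A \<noteq> 0" "det B \<noteq> 0" using 1(3) by (auto simp: det_mul)
  note [measurable] = \<open>F \<in> borel_measurable borel\<close>
  have "(\<integral>\<^sup>+x. F x \<partial>lborel) = ennreal \<bar>det A\<bar> * (\<integral>\<^sup>+x. F (A *v x) \<partial>lborel)"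
    by (rule 1(1)[OF d(1)]) simp
  also have "(\<integral>\<^sup>+x. F (A *v x) \<partial>lborel) = ennreal \<bar>det B\<bar> * (\<integral>\<^sup>+x. F (A *v (B *v x)) \<partial>lborel)"
    by (rule 1(2)[OF d(2)]) simp
  finally show ?case
    by (simp add: det_mul abs_mult ennreal_mult mult.assoc matrix_vector_mul_assoc)
next
  case (2 A i F)
  then have "det A = 0"
    by (intro det_zero_row(1)[of i])
  then show ?case using 2(2) by simp
next
  case (3 A F)
  have dA: "det A = (\<Prod>i\<in>UNIV. A$i$i)"
    using 3(1) by (intro det_diagonal) auto
  then have nz: "A$i$i \<noteq> 0" for i using 3(2) by auto
  define c where "c b = (\<Sum>i\<in>UNIV. A$i$i * b$i)" for b :: "real^'n"
  have c_axis: "c (axis i 1) = A$i$i" for i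
    by (simp add: c_def axis_def if_distrib[where f="\<lambda>x. _ * x"] cong: if_cong)
  have Ax: "A *v x = 0 + (\<Sum>j\<in>Basis. (c j * (x \<bullet> j)) *\<^sub>R j)" for x
  proof -
    have "(\<Sum>j\<in>Basis. (c j * (x \<bullet> j)) *\<^sub>R j) = (\<Sum>i\<in>UNIV. (A$i$i * x$i) *\<^sub>R axis i 1)"
      by (subst Basis_vec_def) (simp add: UNION_singleton_eq_range sum.reindex inj_on_def axis_eq_axis c_axis inner_axis)
    moreover have "A *v x = (\<Sum>i\<in>UNIV. (A$i$i * x$i) *\<^sub>R axis i 1)"
      unfolding vec_eq_iff
    proof 
      fix k
      have "(\<Sum>j\<in>UNIV. A$k$j * x$j) = (\<Sum>j\<in>UNIV. if j = k then A$k$j * x$j else 0)"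
        by (rule sum.cong) (auto simp: 3(1))
      then have "(A *v x) $ k = A$k$k * x$k"
        by (simp add: matrix_vector_mult_def)
      then show "(A *v x) $ k = (\<Sum>i\<in>UNIV. (A$i$i * x$i) *\<^sub>R axis i 1) $ k"
        by (simp add: axis_def if_distrib[where f="\<lambda>x. _ * x"] cong: if_cong)
    qed
    ultimately show ?thesis by simp
  qed
  have prod: "(\<Prod>j\<in>Basis. \<bar>c j\<bar>) = \<bar>det A\<bar>"
    by (subst Basis_vec_def) (simp add: UNION_singleton_eq_range prod.reindex inj_on_def axis_eq_axis c_axis dA abs_prod)
  have cnz: "c j \<noteq> 0" if "j \<in> Basis" for j
    using that nz by (auto simp: Basis_vec_def c_axis)
  have "lborel = density (distr lborel borel ((*v) A)) (\<lambda>_. ennreal \<bar>det A\<bar>)"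
    using lborel_affine_euclidean[of c 0] cnz unfolding Ax[symmetric] prod by simp
  then have "(\<integral>\<^sup>+x. F x \<partial>lborel) = (\<integral>\<^sup>+x. F x \<partial>density (distr lborel borel ((*v) A)) (\<lambda>_. ennreal \<bar>det A\<bar>))"
    by simp
  also have "\<dots> = ennreal \<bar>det A\<bar> * (\<integral>\<^sup>+x. F (A *v x) \<partial>lborel)"
    using 3(3) by (simp add: nn_integral_density nn_integral_distr nn_integral_cmult)
  finally show ?case .
next
  case (4 m n F)
  let ?p = "Transposition.transpose m n"
  let ?A = "(\<chi> i j. mat 1 $ i $ ?p j) :: real^'n^'n"
  note [measurable] = \<open>F \<in> borel_measurable borel\<close>
  have d: "det ?A = - 1"
    using det_permute_columns[of ?p "mat 1 :: real^'n^'n"] 4(1) by (simp add: permutes_swap_id sign_swap_id)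
  have Ax: "?A *v x = (\<chi> i. x $ ?p i)" for x :: "real^'n"
  proof -
    have "(\<Sum>j\<in>UNIV. (if i = ?p j then 1 else 0) * x $ j) = (\<Sum>j\<in>UNIV. if j = ?p i then x $ j else 0)" for i
      by (rule sum.cong) auto
    then show ?thesis
      by (simp add: vec_eq_iff matrix_vector_mult_def mat_def)
  qed
  have "lborel = distr lborel borel ((*v) ?A)"
  proof (rule lborel_eqI)
    fix l u :: "real^'n" assume le: "\<And>b. b \<in> Basis \<Longrightarrow> l \<bullet> b \<le> u \<bullet> b"
    let ?P = "\<lambda>x::real^'n. (\<chi> i. x $ ?p i)"
    have le': "l $ i \<le> u $ i" for i
      using le[of "axis i 1"] by (simp add: inner_axis axis_in_Basis_iff)
    have bi: "bij ?p" by simp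
    have vi: "(*v) ?A -` box l u = box (?P l) (?P u)"
      unfolding vimage_def Ax mem_box_cart
      by (auto simp: mem_box_cart) (metis transpose_involutory)+
    have pr: "(\<Prod>b\<in>Basis. h b) = (\<Prod>i\<in>UNIV. h (axis i 1))" for h :: "real^'n \<Rightarrow> real"
      by (subst Basis_vec_def) (simp add: UNION_singleton_eq_range prod.reindex inj_on_def axis_eq_axis)
    have "emeasure lborel (box (?P l) (?P u)) = (\<Prod>b\<in>Basis. (?P u - ?P l) \<bullet> b)"
      using le' by (intro emeasure_lborel_box) (auto simp: Basis_vec_def inner_axis)
    also have "(\<Prod>b\<in>Basis. (?P u - ?P l) \<bullet> b) = (\<Prod>i\<in>UNIV. (u - l) $ ?p i)"
      by (simp add: pr inner_axis)
    also have "\<dots> = (\<Prod>i\<in>UNIV. (u - l) $ i)"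
      by (rule prod.reindex_bij_betw[OF bi])
    also have "\<dots> = (\<Prod>b\<in>Basis. (u - l) \<bullet> b)"
      by (simp add: pr inner_axis)
    finally show "emeasure (distr lborel borel ((*v) ?A)) (box l u) = (\<Prod>b\<in>Basis. (u - l) \<bullet> b)"
      by (simp add: emeasure_distr vi)
  qed simp
  then have "(\<integral>\<^sup>+x. F x \<partial>lborel) = (\<integral>\<^sup>+x. F x \<partial>distr lborel borel ((*v) ?A))"
    by simp
  also have "\<dots> = (\<integral>\<^sup>+x. F (?A *v x) \<partial>lborel)"
    by (intro nn_integral_distr) auto
  finally show ?case by (simp add: d)
next
  case (5 m n F)
  let ?A = "(\<chi> i j. of_bool (i = m \<and> j = n \<or> i = j)) :: real^'n^'n"
  note [measurable] = \<open>F \<in> borel_measurable borel\<close>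
  have "det ?A = det (\<chi> k. if k = m then row m (mat 1 :: real^'n^'n) + 1 *s row n (mat 1) else row k (mat 1))"
    using 5(1) by (intro arg_cong[where f=det]) (auto simp: vec_eq_iff row_def mat_def)
  also have "\<dots> = 1"
    using det_row_operation[OF 5(1), of "mat 1 :: real^'n^'n" 1] by simp
  finally have d: "det ?A = 1" .
  have Ax: "?A *v x = (\<chi> i. if i = m then x$m + x$n else x$i)" for x :: "real^'n"
  proof -
    have 1: "(\<Sum>j\<in>UNIV. of_bool (m = m \<and> j = n \<or> m = j) * x $ j) = (\<Sum>j\<in>UNIV. (if j = m then x $ j else 0) + (if j = n then x $ j else 0))"
      using 5(1) by (intro sum.cong) auto
    have 2: "i \<noteq> m \<Longrightarrow> (\<Sum>j\<in>UNIV. of_bool (i = m \<and> j = n \<or> i = j) * x $ j) = (\<Sum>j\<in>UNIV. (if j = i then x $ j else 0))" for i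
      by (intro sum.cong) auto
    show ?thesis
      unfolding vec_eq_iff matrix_vector_mult_def using 1 2 by (simp add: sum.distrib)
  qed
  have "(\<integral>\<^sup>+x. F x \<partial>lborel) = (\<integral>\<^sup>+x. F x \<partial>distr lborel borel ((*v) ?A))"
    unfolding Ax distr_lborel_shear[OF 5(1)] ..
  also have "\<dots> = (\<integral>\<^sup>+x. F (?A *v x) \<partial>lborel)"
    by (intro nn_integral_distr) auto
  finally show ?case unfolding d by simp
qed

lemma distr_lborel_linear:
  assumes "T \<in> SL"
  shows "distr lborel borel ((*v) T) = lborel"
proof (rule measure_eqI)
  fix A assume "A \<in> sets (distr lborel borel ((*v) T))"
  then have A: "A \<in> sets borel" by simp
  have "emeasure lborel A = (\<integral>\<^sup>+x. indicator A x \<partial>lborel)" using A by simp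
  also have "\<dots> = (\<integral>\<^sup>+x. indicator A (T *v x) \<partial>lborel)"
    using nn_integral_lborel_linear[of T "indicator A"] assms A by (simp add: SL_def)
  also have "\<dots> = (\<integral>\<^sup>+x. indicator A x \<partial>distr lborel borel ((*v) T))"
    using A by (subst nn_integral_distr) auto
  finally show "emeasure (distr lborel borel ((*v) T)) A = emeasure lborel A"
    using A by simp
qed simp_all

text \<open>A map that preserves the measure on Borel sets pulls Borel null sets back to null sets, so it is
  compatible with the completion.\<close>

lemma
  assumes [measurable]: "T \<in> borel_measurable borel" and T: "distr lborel borel T = lborel"
  shows lebesgue_measurable_of_distr_lborel: "T \<in> lebesgue \<rightarrow>\<^sub>M lebesgue"
    and distr_lebesgue_of_distr_lborel: "distr lebesgue lebesgue T = lebesgue"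
proof -
  have d: "distr lebesgue lborel T = lborel"
  proof -
    have "distr lebesgue lborel T = distr lborel lborel T"
      by (rule distr_completion) simp
    also have "\<dots> = distr lborel borel T"
      by (rule distr_cong) simp_all
    finally show ?thesis using T by (simp only:)
  qed
  show "T \<in> lebesgue \<rightarrow>\<^sub>M lebesgue"
    by (rule completion.measurable_completion2) (simp_all add: d measurable_completion)
  have "distr lebesgue lebesgue T = completion (distr lebesgue lborel T)"
    by (rule completion.completion_distr_eq[symmetric]) (simp_all add: d measurable_completion)
  then show "distr lebesgue lebesgue T = lebesgue" by (simp add: d)
qed

lemmas lebesgue_measurable_linear =
  lebesgue_measurable_of_distr_lborel[OF matrix_vector_mult_borel_measurable distr_lborel_linear]
lemmas distr_lebesgue_linear =
  distr_lebesgue_of_distr_lborel[OF matrix_vector_mult_borel_measurable distr_lborel_linear]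

lemma distr_lborel_translation: "distr lborel borel (\<lambda>x. x + h) = (lborel :: 'a::euclidean_space measure)"
  using lborel_distr_plus[of h] by (simp add: add.commute[of h] cong: distr_cong)

lemmas lebesgue_measurable_translation =
  lebesgue_measurable_of_distr_lborel[OF _ distr_lborel_translation]
lemmas distr_lebesgue_translation =
  distr_lebesgue_of_distr_lborel[OF _ distr_lborel_translation]

lemma AE_lebesgue_translation:
  assumes "AE x in lebesgue. P x"
  shows "AE x in lebesgue. P (x + h :: 'a::euclidean_space)"
proof -
  have "almost_everywhere (distr lebesgue lebesgue (\<lambda>x. x + h)) P"
    by (subst distr_lebesgue_translation) (simp_all add: assms)
  from AE_distrD[OF lebesgue_measurable_translation this] show ?thesis by simp
qed

lemma AE_lebesgue_linear:
  assumes "AE x in lebesgue. P x" and "T \<in> SL"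
  shows "AE x in lebesgue. P (T *v x)"
proof -
  have "almost_everywhere (distr lebesgue lebesgue ((*v) T)) P"
    by (subst distr_lebesgue_linear[OF assms(2)]) (rule assms(1))
  from AE_distrD[OF lebesgue_measurable_linear[OF assms(2)] this] show ?thesis .
qed

lemma nn_integral_lborel_translation:
  assumes [measurable]: "F \<in> borel_measurable borel"
  shows "(\<integral>\<^sup>+x. F (x + h :: 'a::euclidean_space) \<partial>lborel) = (\<integral>\<^sup>+x. F x \<partial>lborel)"
proof -
  have "(\<integral>\<^sup>+x. F x \<partial>lborel) = (\<integral>\<^sup>+x. F x \<partial>distr lborel borel (\<lambda>x. x + h))"
    unfolding distr_lborel_translation ..
  also have "\<dots> = (\<integral>\<^sup>+x. F (x + h) \<partial>lborel)" by (intro nn_integral_distr) auto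
  finally show ?thesis ..
qed

lemma nn_integral_lborel_SL:
  assumes [measurable]: "F \<in> borel_measurable borel" and "T \<in> SL"
  shows "(\<integral>\<^sup>+x. F (T *v x) \<partial>lborel) = (\<integral>\<^sup>+x. F x \<partial>lborel)"
proof -
  have "(\<integral>\<^sup>+x. F x \<partial>lborel) = (\<integral>\<^sup>+x. F x \<partial>distr lborel borel ((*v) T))"
    unfolding distr_lborel_linear[OF assms(2)] ..
  also have "\<dots> = (\<integral>\<^sup>+x. F (T *v x) \<partial>lborel)" by (intro nn_integral_distr) auto
  finally show ?thesis ..
qed

lemma nn_integral_outside_cball_tendsto_0:
  fixes F :: "'a::euclidean_space \<Rightarrow> ennreal"
  assumes [measurable]: "F \<in> borel_measurable lebesgue" and fin: "(\<integral>\<^sup>+x. F x \<partial>lebesgue) < \<infinity>"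
  shows "(\<lambda>n. \<integral>\<^sup>+x. F x * indicator (- cball 0 (real n)) x \<partial>lebesgue) \<longlonglongrightarrow> 0"
proof -
  have "(\<lambda>n. \<integral>\<^sup>+x. F x * indicator (- cball 0 (real n)) x \<partial>lebesgue) \<longlonglongrightarrow> (\<integral>\<^sup>+x. (0::ennreal) \<partial>(lebesgue::'a measure))"
  proof (rule nn_integral_dominated_convergence[where w=F])
    have "eventually (\<lambda>n. F x * indicator (- cball 0 (real n)) x = 0) sequentially" for x
      using eventually_ge_at_top[of "nat \<lceil>norm x\<rceil>"]
      by eventually_elim (auto simp: indicator_def nat_ceiling_le_eq)
    then show "AE x in lebesgue. (\<lambda>n. F x * indicator (- cball 0 (real n)) x) \<longlonglongrightarrow> 0"
      by (intro AE_I2 tendsto_eventually)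
    show "(\<lambda>x. F x * indicator (- cball 0 (real n)) x) \<in> borel_measurable lebesgue" for n
      by (intro borel_measurable_times_ennreal borel_measurable_indicator) auto
  qed (use fin in \<open>auto simp: indicator_def\<close>)
  then show ?thesis by simp
qed

lemma locally_integrable_cball:
  assumes "locally_integrable g"
  shows "integrable lebesgue (\<lambda>x. indicator (cball 0 R) x * g x)"
  using assms compact_cball[of 0 R] unfolding locally_integrable_def set_integrable_def by simp

lemma locally_integrable_imp_measurable:
  fixes f :: "real^'n \<Rightarrow> real"
  assumes "locally_integrable f"
  shows "f \<in> borel_measurable lebesgue"
proof -
  have "(\<lambda>x. indicator (cball 0 (real k)) x * f x) \<in> borel_measurable lebesgue" for k :: nat
    using locally_integrable_cball[OF assms] by (rule borel_measurable_integrable)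
  moreover have "(\<lambda>k. indicator (cball 0 (real k)) x * f x) \<longlonglongrightarrow> f x" for x
  proof (rule tendsto_eventually)
    show "eventually (\<lambda>k. indicator (cball 0 (real k)) x * f x = f x) sequentially"
      using eventually_ge_at_top[of "nat \<lceil>norm x\<rceil>"]
      by eventually_elim (auto simp: indicator_def nat_ceiling_le_eq)
  qed
  ultimately show ?thesis by (rule borel_measurable_LIMSEQ_metric)
qed

section \<open>Iterated differences and the fractional energy\<close>

text \<open>The coefficients are signed binomial coefficients. What is used later is that they depend on \<open>m\<close>
  alone and that the first one has modulus \<open>1\<close>: then \<open>u x\<close> can be recovered from the difference
  wherever the remaining translates of \<open>u\<close> are negligible.\<close>

lemma difference_funpow_expansion:
  "\<exists>c::nat \<Rightarrow> real. \<bar>c 0\<bar> = 1 \<and>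
    (\<forall>(h::real^'n) u x. (difference h ^^ m) u x = (\<Sum>j\<le>m. c j * u (x + real j *\<^sub>R h)))"
proof (induction m)
  case 0
  show ?case by (intro exI[of _ "\<lambda>_. 1"]) auto
next
  case (Suc m)
  then obtain c :: "nat \<Rightarrow> real" where c0: "\<bar>c 0\<bar> = 1"
    and c: "\<And>(h::real^'n) u x. (difference h ^^ m) u x = (\<Sum>j\<le>m. c j * u (x + real j *\<^sub>R h))"
    by blast
  define d where "d j = (case j of 0 \<Rightarrow> 0 | Suc i \<Rightarrow> c i) - (if j \<le> m then c j else 0)" for j
  show ?case
  proof (intro exI[of _ d] conjI allI)
    show "\<bar>d 0\<bar> = 1" using c0 by (simp add: d_def)
    fix h :: "real^'n" and u x
    have "(\<Sum>j\<le>Suc m. (case j of 0 \<Rightarrow> 0 | Suc i \<Rightarrow> c i) * u (x + real j *\<^sub>R h))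
        = (\<Sum>j\<le>m. c j * u (x + h + real j *\<^sub>R h))"
      by (subst sum.atMost_Suc_shift) (simp add: algebra_simps)
    moreover have "(\<Sum>j\<le>Suc m. (if j \<le> m then c j else 0) * u (x + real j *\<^sub>R h))
        = (\<Sum>j\<le>m. c j * u (x + real j *\<^sub>R h))"
      by simp
    ultimately show "(difference h ^^ Suc m) u x = (\<Sum>j\<le>Suc m. d j * u (x + real j *\<^sub>R h))"
      unfolding d_def left_diff_distrib sum_subtractf by (simp add: difference_def c)
  qed
qed

lemma difference_funpow_linear:
  "(difference h ^^ m) (f \<circ> (*v) T) x = (difference (T *v h) ^^ m) f (T *v x)"
  by (induction m arbitrary: x) (simp_all add: difference_def matrix_vector_right_distrib)

lemma difference_commute: "difference h (difference k u) = difference k (difference h u)"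
  by (auto simp: difference_def fun_eq_iff algebra_simps)

lemma difference_funpow_commute:
  "(difference h ^^ m) ((difference k ^^ n) u) = (difference k ^^ n) ((difference h ^^ m) u)"
proof -
  have 1: "(difference h ^^ m) (difference k u) = difference k ((difference h ^^ m) u)" for u
    by (induction m) (simp_all add: difference_commute)
  show ?thesis
    by (induction n) (simp_all add: 1)
qed

text \<open>Each summand is at most the largest one, whose power is one of the summands on the right.\<close>

lemma powr_abs_sum_le:
  fixes y :: "'a \<Rightarrow> real"
  assumes "finite I" "p > 0"
  shows "\<bar>\<Sum>i\<in>I. y i\<bar> powr p \<le> real (card I) powr p * (\<Sum>i\<in>I. \<bar>y i\<bar> powr p)"
proof (cases "I = {}")
  case False
  define M where "M = Max ((\<lambda>i. \<bar>y i\<bar>) ` I)"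
  have "M \<in> (\<lambda>i. \<bar>y i\<bar>) ` I" unfolding M_def using assms False by (intro Max_in) auto
  then obtain i where i: "i \<in> I" "M = \<bar>y i\<bar>" by auto
  have "\<bar>\<Sum>i\<in>I. y i\<bar> \<le> (\<Sum>i\<in>I. \<bar>y i\<bar>)" by (rule sum_abs)
  also have "\<dots> \<le> real (card I) * M"
    using assms by (intro sum_bounded_above) (auto simp: M_def)
  finally have "\<bar>\<Sum>i\<in>I. y i\<bar> powr p \<le> (real (card I) * M) powr p"
    using assms by (intro powr_mono2) auto
  also have "\<dots> = real (card I) powr p * \<bar>y i\<bar> powr p"
    by (simp add: powr_mult i)
  also have "\<dots> \<le> real (card I) powr p * (\<Sum>i\<in>I. \<bar>y i\<bar> powr p)"
    using assms i by (intro mult_left_mono member_le_sum) auto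
  finally show ?thesis .
qed (use assms in simp)

lemma borel_measurable_difference_funpow [measurable]:
  assumes [measurable]: "u \<in> borel_measurable borel"
  shows "(difference h ^^ m) u \<in> borel_measurable borel"
proof (induction m)
  case (Suc m)
  note [measurable] = this
  have "difference h ((difference h ^^ m) u) = (\<lambda>x. (difference h ^^ m) u (x + h) - (difference h ^^ m) u x)"
    by (simp add: difference_def)
  then show ?case by simp
qed (use assms in simp)

definition difference_energy :: "nat \<Rightarrow> real \<Rightarrow> (real^'n \<Rightarrow> real) \<Rightarrow> real^'n \<Rightarrow> ennreal" where
  "difference_energy m p u h = (\<integral>\<^sup>+x. ennreal (\<bar>(difference h ^^ m) u x\<bar> powr p) \<partial>lborel)"

lemma borel_measurable_difference_energy [measurable]:
  assumes [measurable]: "u \<in> borel_measurable borel"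
  shows "difference_energy m p u \<in> borel_measurable (borel :: (real^'n) measure)"
proof -
  obtain c :: "nat \<Rightarrow> real" where
    c: "\<And>(h::real^'n) u x. (difference h ^^ m) u x = (\<Sum>j\<le>m. c j * u (x + real j *\<^sub>R h))"
    using difference_funpow_expansion[of m] by blast
  show ?thesis
    unfolding difference_energy_def[abs_def] c by measurable
qed

text \<open>Lebesgue measure is invariant under translations, so every translate in the expansion of the
  difference has the same norm and the constant depends neither on \<open>h\<close> nor on \<open>u\<close>.\<close>

lemma difference_energy_le:
  assumes p: "p > 0"
  shows "\<exists>K>0. \<forall>u\<in>borel_measurable borel. \<forall>h::real^'n.
    difference_energy m p u h \<le> ennreal K * (\<integral>\<^sup>+x. ennreal (\<bar>u x\<bar> powr p) \<partial>lborel)"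
proof -
  obtain c :: "nat \<Rightarrow> real" where
    c: "\<And>(h::real^'n) u x. (difference h ^^ m) u x = (\<Sum>j\<le>m. c j * u (x + real j *\<^sub>R h))"
    using difference_funpow_expansion[of m] by blast
  define K where "K = 1 + real (Suc m) powr p * (\<Sum>j\<le>m. \<bar>c j\<bar> powr p)"
  have K0: "K > 0" unfolding K_def by (intro add_pos_nonneg mult_nonneg_nonneg sum_nonneg) auto
  show ?thesis
  proof (intro exI[of _ K] conjI ballI allI K0)
    fix u :: "real^'n \<Rightarrow> real" and h :: "real^'n"
    assume [measurable]: "u \<in> borel_measurable borel"
    have "difference_energy m p u h
      \<le> (\<integral>\<^sup>+x. (\<Sum>j\<le>m. ennreal (real (Suc m) powr p * \<bar>c j\<bar> powr p) * ennreal (\<bar>u (x + real j *\<^sub>R h)\<bar> powr p)) \<partial>lborel)"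
      unfolding difference_energy_def
    proof (rule nn_integral_mono)
      fix x
      have "\<bar>(difference h ^^ m) u x\<bar> powr p \<le> real (Suc m) powr p * (\<Sum>j\<le>m. \<bar>c j * u (x + real j *\<^sub>R h)\<bar> powr p)"
        using powr_abs_sum_le[of "{..m}" p "\<lambda>j. c j * u (x + real j *\<^sub>R h)"] p by (simp add: c)
      also have "\<dots> = (\<Sum>j\<le>m. (real (Suc m) powr p * \<bar>c j\<bar> powr p) * \<bar>u (x + real j *\<^sub>R h)\<bar> powr p)"
        by (simp add: sum_distrib_left abs_mult powr_mult mult.assoc)
      finally have "ennreal (\<bar>(difference h ^^ m) u x\<bar> powr p) \<le> ennreal (\<Sum>j\<le>m. (real (Suc m) powr p * \<bar>c j\<bar> powr p) * \<bar>u (x + real j *\<^sub>R h)\<bar> powr p)"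
        by (rule ennreal_leI)
      also have "\<dots> = (\<Sum>j\<le>m. ennreal (real (Suc m) powr p * \<bar>c j\<bar> powr p) * ennreal (\<bar>u (x + real j *\<^sub>R h)\<bar> powr p))"
        by (subst sum_ennreal[symmetric]) (simp_all add: ennreal_mult)
      finally show "ennreal (\<bar>(difference h ^^ m) u x\<bar> powr p) \<le> \<dots>" .
    qed
    also have "\<dots> = (\<Sum>j\<le>m. ennreal (real (Suc m) powr p * \<bar>c j\<bar> powr p) * (\<integral>\<^sup>+x. ennreal (\<bar>u (x + real j *\<^sub>R h)\<bar> powr p) \<partial>lborel))"
      by (subst nn_integral_sum) (auto simp: nn_integral_cmult)
    also have "\<dots> = (\<Sum>j\<le>m. ennreal (real (Suc m) powr p * \<bar>c j\<bar> powr p) * (\<integral>\<^sup>+x. ennreal (\<bar>u x\<bar> powr p) \<partial>lborel))"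
      using nn_integral_lborel_translation[of "\<lambda>x. ennreal (\<bar>u x\<bar> powr p)"] by simp
    also have "\<dots> = ennreal (real (Suc m) powr p * (\<Sum>j\<le>m. \<bar>c j\<bar> powr p)) * (\<integral>\<^sup>+x. ennreal (\<bar>u x\<bar> powr p) \<partial>lborel)"
      by (simp add: sum_distrib_right[symmetric] sum_distrib_left)
    also have "\<dots> \<le> ennreal K * (\<integral>\<^sup>+x. ennreal (\<bar>u x\<bar> powr p) \<partial>lborel)"
      by (intro mult_right_mono ennreal_leI) (auto simp: K_def)
    finally show "difference_energy m p u h \<le> ennreal K * (\<integral>\<^sup>+x. ennreal (\<bar>u x\<bar> powr p) \<partial>lborel)" .
  qed
qed

text \<open>A nonzero \<open>u\<close> in \<open>L\<^sup>p\<close> has almost all its mass in some ball. If \<open>h\<close> is longer than the diameter of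
  this ball, the points \<open>x + h, \<dots>, x + m h\<close> lie outside it whenever \<open>x\<close> is inside, so on the ball the
  difference is \<open>\<plusminus> u\<close> up to a small error.\<close>

lemma difference_energy_ge_far:
  fixes u :: "real^'n \<Rightarrow> real"
  assumes [measurable]: "u \<in> borel_measurable borel" and p: "p > 0"
    and pos: "(\<integral>\<^sup>+x. ennreal (\<bar>u x\<bar> powr p) \<partial>lborel) > 0"
    and fin: "(\<integral>\<^sup>+x. ennreal (\<bar>u x\<bar> powr p) \<partial>lborel) < \<infinity>"
  shows "\<exists>R c. c > 0 \<and> (\<forall>h. norm h \<ge> R \<longrightarrow> ennreal c \<le> difference_energy m p u h)"
proof -
  let ?A = "\<integral>\<^sup>+x. ennreal (\<bar>u x\<bar> powr p) \<partial>lborel"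
  obtain c :: "nat \<Rightarrow> real" where c0: "\<bar>c 0\<bar> = 1" and
    c: "\<And>(h::real^'n) u x. (difference h ^^ m) u x = (\<Sum>j\<le>m. c j * u (x + real j *\<^sub>R h))"
    using difference_funpow_expansion[of m] by blast
  obtain a where a: "?A = ennreal a" "a > 0"
    using pos fin by (cases ?A) (auto simp: top_unique)
  define K where "K = real (Suc m) powr p"
  have K0: "K > 0" by (simp add: K_def)
  define S where "S = (\<Sum>j=1..m. \<bar>c j\<bar> powr p)"
  have S0: "S \<ge> 0" by (auto simp: S_def intro: sum_nonneg)
  \<comment> \<open>chosen so that the mass outside the ball costs at most \<open>a / 2\<close> in the estimate \<open>main\<close>\<close>
  define e where "e = a / (2 * (1 + K * S))"
  have e0: "e > 0" unfolding e_def using a K0 S0 by (intro divide_pos_pos mult_pos_pos add_pos_nonneg) auto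
  define U where "U x = ennreal (\<bar>u x\<bar> powr p)" for x
  have [measurable]: "U \<in> borel_measurable borel" unfolding U_def by measurable
  define out where "out \<rho> = (\<integral>\<^sup>+x. U x * indicator (- cball 0 (real \<rho>)) x \<partial>lborel)" for \<rho> :: nat
  have "out \<longlonglongrightarrow> 0" unfolding out_def
    using nn_integral_outside_cball_tendsto_0[of U] fin
    by (simp add: nn_integral_completion measurable_completion U_def[symmetric])
  then have "eventually (\<lambda>\<rho>. out \<rho> < ennreal e) sequentially"
    using e0 by (intro order_tendstoD(2)) auto
  then obtain \<rho> where \<rho>: "out \<rho> < ennreal e" by (auto simp: eventually_sequentially)
  show ?thesis
  proof (rule exI[of _ "2 * real \<rho> + 1"], rule exI[of _ "a / (2 * K)"], intro conjI allI impI)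
    show "a / (2 * K) > 0" using a K0 by simp
    fix h :: "real^'n" assume h: "2 * real \<rho> + 1 \<le> norm h"
    let ?B = "cball 0 (real \<rho>) :: (real^'n) set"
    let ?D = "\<lambda>x. (difference h ^^ m) u x"
    have point: "U x * indicator ?B x \<le> ennreal K * (ennreal (\<bar>?D x\<bar> powr p)
        + (\<Sum>j=1..m. ennreal (\<bar>c j\<bar> powr p) * (U (x + real j *\<^sub>R h) * indicator (- ?B) (x + real j *\<^sub>R h))))" for x
    proof (cases "x \<in> ?B")
      case True
      have far: "x + real j *\<^sub>R h \<notin> ?B" if "j \<in> {1..m}" for j
      proof
        assume "x + real j *\<^sub>R h \<in> ?B"
        have "1 * norm h \<le> real j * norm h" using that by (intro mult_right_mono) auto
        also have "\<dots> = norm ((x + real j *\<^sub>R h) - x)" by simp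
        also have "\<dots> \<le> norm (x + real j *\<^sub>R h) + norm x" by (rule norm_triangle_ineq4)
        also have "\<dots> \<le> 2 * real \<rho>" using True \<open>x + real j *\<^sub>R h \<in> ?B\<close> unfolding mem_cball_0 by linarith
        finally show False using h by simp
      qed
      \<comment> \<open>the expansion of the difference, solved for the term with index \<open>0\<close>\<close>
      define y where "y j = (if j = 0 then ?D x else - c j * u (x + real j *\<^sub>R h))" for j
      have "{..m} = insert 0 {1..m}" by auto
      then have split: "(\<Sum>j\<le>m. F j) = F 0 + (\<Sum>j=1..m. F j)" for F :: "nat \<Rightarrow> real"
        by simp
      have "c 0 * u x = (\<Sum>j\<le>m. y j)"
        unfolding split[of y] by (simp add: y_def c split sum_negf)
      then have "\<bar>u x\<bar> powr p = \<bar>\<Sum>j\<le>m. y j\<bar> powr p"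
        using c0 by (metis abs_mult mult_1)
      also have "\<dots> \<le> K * (\<Sum>j\<le>m. \<bar>y j\<bar> powr p)"
        using powr_abs_sum_le[of "{..m}" p y] p by (simp add: K_def)
      also have "(\<Sum>j\<le>m. \<bar>y j\<bar> powr p) = \<bar>?D x\<bar> powr p + (\<Sum>j=1..m. \<bar>c j\<bar> powr p * \<bar>u (x + real j *\<^sub>R h)\<bar> powr p)"
        unfolding split by (simp add: y_def abs_mult powr_mult)
      finally have "ennreal (\<bar>u x\<bar> powr p) \<le> ennreal (K * (\<bar>?D x\<bar> powr p + (\<Sum>j=1..m. \<bar>c j\<bar> powr p * \<bar>u (x + real j *\<^sub>R h)\<bar> powr p)))"
        by (rule ennreal_leI)
      also have "\<dots> = ennreal K * (ennreal (\<bar>?D x\<bar> powr p)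
        + (\<Sum>j=1..m. ennreal (\<bar>c j\<bar> powr p) * ennreal (\<bar>u (x + real j *\<^sub>R h)\<bar> powr p)))"
        using K0 by (simp add: ennreal_mult sum_nonneg sum_ennreal[symmetric] del: sum_ennreal)
      also have "(\<Sum>j=1..m. ennreal (\<bar>c j\<bar> powr p) * ennreal (\<bar>u (x + real j *\<^sub>R h)\<bar> powr p))
        = (\<Sum>j=1..m. ennreal (\<bar>c j\<bar> powr p) * (U (x + real j *\<^sub>R h) * indicator (- ?B) (x + real j *\<^sub>R h)))"
        using far by (intro sum.cong) (auto simp: U_def)
      finally show ?thesis using True by (simp add: U_def)
    qed simp
    have "(\<integral>\<^sup>+x. U x * indicator ?B x \<partial>lborel) \<le> (\<integral>\<^sup>+x. ennreal K * (ennreal (\<bar>?D x\<bar> powr p)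
        + (\<Sum>j=1..m. ennreal (\<bar>c j\<bar> powr p) * (U (x + real j *\<^sub>R h) * indicator (- ?B) (x + real j *\<^sub>R h)))) \<partial>lborel)"
      by (intro nn_integral_mono point)
    also have "\<dots> = ennreal K * (difference_energy m p u h
        + (\<Sum>j=1..m. ennreal (\<bar>c j\<bar> powr p) * (\<integral>\<^sup>+x. U (x + real j *\<^sub>R h) * indicator (- ?B) (x + real j *\<^sub>R h) \<partial>lborel)))"
      by (simp add: nn_integral_cmult nn_integral_add nn_integral_sum difference_energy_def)
    also have "(\<Sum>j=1..m. ennreal (\<bar>c j\<bar> powr p) * (\<integral>\<^sup>+x. U (x + real j *\<^sub>R h) * indicator (- ?B) (x + real j *\<^sub>R h) \<partial>lborel))
       = (\<Sum>j=1..m. ennreal (\<bar>c j\<bar> powr p) * out \<rho>)"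
      using nn_integral_lborel_translation[of "\<lambda>x. U x * indicator (- ?B) x"] by (simp add: out_def)
    also have "\<dots> = ennreal S * out \<rho>"
      by (simp add: sum_distrib_right[symmetric] S_def)
    finally have inside: "(\<integral>\<^sup>+x. U x * indicator ?B x \<partial>lborel) \<le> ennreal K * (difference_energy m p u h + ennreal S * out \<rho>)" .
    have [measurable]: "?B \<in> sets borel" by simp
    have "?A = (\<integral>\<^sup>+x. U x * indicator ?B x + U x * indicator (- ?B) x \<partial>lborel)"
      by (intro nn_integral_cong) (auto simp: U_def indicator_def)
    also have "\<dots> = (\<integral>\<^sup>+x. U x * indicator ?B x \<partial>lborel) + out \<rho>"
      unfolding out_def by (rule nn_integral_add) measurable
    also have "\<dots> \<le> ennreal K * (difference_energy m p u h + ennreal S * ennreal e) + ennreal e"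
      using \<rho> by (intro add_mono order_trans[OF inside] mult_left_mono) auto
    finally have main: "ennreal a \<le> ennreal K * (difference_energy m p u h + ennreal S * ennreal e) + ennreal e"
      using a by simp
    show "ennreal (a / (2 * K)) \<le> difference_energy m p u h"
    proof (cases "difference_energy m p u h")
      case (real d)
      with main have "a \<le> K * (d + S * e) + e"
        using K0 S0 e0 by (simp add: ennreal_mult[symmetric] ennreal_plus[symmetric] del: ennreal_plus)
      also have "\<dots> = K * d + (1 + K * S) * e" by (simp add: algebra_simps)
      also have "(1 + K * S) * e = a / 2"
      proof -
        have "q * (a / (2 * q)) = a / 2" if "q > 0" for q :: real using that by simp
        moreover have "1 + K * S > 0" using K0 S0 by (intro add_pos_nonneg) auto
        ultimately show ?thesis unfolding e_def by blast
      qed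
      finally have "a / (2 * K) \<le> d" using K0 by (simp add: field_simps)
      then show ?thesis using real by (simp add: ennreal_leI)
    qed simp
  qed
qed

text \<open>The function \<open>u\<close> itself need not lie in \<open>L\<^sup>p\<close>, but its difference \<open>g\<close> with step \<open>k\<close> does.
  Differences with steps \<open>h\<close> and \<open>k\<close> commute, so the \<open>h\<close>-difference of \<open>g\<close>, which is bounded below
  for large \<open>h\<close>, is controlled by the \<open>h\<close>-difference of \<open>u\<close>.\<close>

lemma difference_energy_bounded_below_at_infinity:
  fixes u :: "real^'n \<Rightarrow> real"
  assumes [measurable]: "u \<in> borel_measurable borel" and p: "p > 0"
    and pos: "difference_energy m p u k > 0" and fin: "difference_energy m p u k < \<infinity>"
  shows "\<exists>R c. c > 0 \<and> (\<forall>h. norm h \<ge> R \<longrightarrow> ennreal c \<le> difference_energy m p u h)"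
proof -
  define g where "g = (difference k ^^ m) u"
  have [measurable]: "g \<in> borel_measurable borel" unfolding g_def by measurable
  obtain R c where c: "c > 0" and R: "\<And>h. norm h \<ge> R \<Longrightarrow> ennreal c \<le> difference_energy m p g h"
    using difference_energy_ge_far[of g p m] pos fin p by (auto simp: difference_energy_def g_def)
  obtain K where K: "K > 0" "\<And>u h. u \<in> borel_measurable borel \<Longrightarrow>
      difference_energy m p u (h::real^'n) \<le> ennreal K * (\<integral>\<^sup>+x. ennreal (\<bar>u x\<bar> powr p) \<partial>lborel)"
    using difference_energy_le[OF p, of m] by blast
  show ?thesis
  proof (rule exI[of _ R], rule exI[of _ "c / K"], intro conjI allI impI)
    show "c / K > 0" using c K by simp
    fix h :: "real^'n" assume h: "R \<le> norm h"
    have "ennreal c \<le> difference_energy m p g h" by (rule R[OF h])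
    also have "\<dots> = difference_energy m p ((difference h ^^ m) u) k"
      by (simp add: difference_energy_def g_def difference_funpow_commute)
    also have "\<dots> \<le> ennreal K * difference_energy m p u h"
      using K(2)[of "(difference h ^^ m) u" k] by (simp add: difference_energy_def)
    finally have le: "ennreal c \<le> ennreal K * difference_energy m p u h" .
    then show "ennreal (c / K) \<le> difference_energy m p u h"
    proof (cases "difference_energy m p u h")
      case (real d)
      with le have "c \<le> K * d" using K by (simp add: ennreal_mult[symmetric])
      then show ?thesis using real K by (simp add: field_simps)
    qed simp
  qed
qed

text \<open>The ball of radius \<open>r\<close> alone contributes a multiple of \<open>r\<close> to the power \<open>CARD('n) - a\<close>, which is
  unbounded as \<open>r\<close> tends to \<open>0\<close>.\<close>

lemma nn_integral_inverse_norm_powr_eq_top: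
  assumes "c > 0" and a: "a > real CARD('n)"
  shows "(\<integral>\<^sup>+(h::real^'n). ennreal c / ennreal (norm h powr a) \<partial>lborel) = \<infinity>"
proof -
  let ?I = "\<integral>\<^sup>+(h::real^'n). ennreal c / ennreal (norm h powr a) \<partial>lborel"
  define V where "V = unit_ball_vol (real CARD('n))"
  have V: "V > 0" by (simp add: V_def)
  have "ennreal (c * V * B) \<le> ?I" if B: "B > 0" for B
  proof -
    \<comment> \<open>the radius whose power with exponent \<open>CARD('n) - a < 0\<close> is \<open>B\<close>\<close>
    define r where "r = B powr (1 / (real CARD('n) - a))"
    have r: "r > 0" using B by (simp add: r_def)
    have rp: "r powr (real CARD('n) - a) = B"
      unfolding r_def using B a by (simp add: powr_powr)
    have "ennreal (c * V * B) = ennreal (c / r powr a) * ennreal (V * r ^ CARD('n))"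
      unfolding rp[symmetric] using r assms V
      by (simp add: ennreal_mult[symmetric] powr_diff powr_realpow)
    also have "\<dots> = (\<integral>\<^sup>+(h::real^'n). ennreal (c / r powr a) * indicator (cball 0 r) h \<partial>lborel)"
      using r by (simp add: nn_integral_cmult_indicator emeasure_cball V_def)
    also have "\<dots> \<le> ?I"
    proof (rule nn_integral_mono)
      fix h :: "real^'n"
      show "ennreal (c / r powr a) * indicator (cball 0 r) h \<le> ennreal c / ennreal (norm h powr a)"
      proof (cases "h = 0 \<or> norm h > r")
        case True
        then show ?thesis using assms(1) by (auto simp: indicator_def)
      next
        case False
        then have "c / r powr a \<le> c / norm h powr a"
          using assms r by (intro divide_left_mono powr_mono2) auto
        then show ?thesis using False assms(1) by (simp add: divide_ennreal ennreal_leI)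
      qed
    qed
    finally show ?thesis .
  qed
  then have all: "ennreal B \<le> ?I" if "B > 0" for B
    using that[unfolded zero_less_divide_iff] assms(1) V
    by (metis (no_types) nonzero_mult_div_cancel_left divide_pos_pos mult_pos_pos times_divide_eq_right less_irrefl)
  show ?thesis
  proof (cases ?I)
    case (real i)
    have "ennreal (i + 1) \<le> ennreal i" using all[of "i + 1"] real by simp
    then show ?thesis using real by simp
  qed simp
qed

lemma AE_linear_nonzero:
  fixes L :: "real^'n^'m"
  assumes "L \<noteq> 0"
  shows "AE h in lborel. L *v h \<noteq> 0"
proof -
  obtain i where i: "row i L \<noteq> 0" using assms by (auto simp: vec_eq_iff row_def)
  have "negligible {x. row i L \<bullet> x = 0}" using i by (intro negligible_hyperplane) simp
  then have "AE h in lebesgue. h \<notin> {x. row i L \<bullet> x = 0}"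
    by (intro AE_not_in) (simp add: negligible_iff_null_sets)
  then have "AE h in lebesgue. L *v h \<noteq> 0"
    by eventually_elim (auto simp: matrix_vector_mult_def row_def inner_vec_def vec_eq_iff)
  then show ?thesis by (simp add: AE_completion_iff)
qed

text \<open>The energy of \<open>u \<circ> T\<close> after the substitution \<open>x \<mapsto> T *v x\<close> in the inner integral, when
  \<open>m = nat \<lfloor>s\<rfloor> + 1\<close> and \<open>a = s * p + CARD('n)\<close>.\<close>

definition fractional_energy :: "nat \<Rightarrow> real \<Rightarrow> real \<Rightarrow> (real^'n \<Rightarrow> real) \<Rightarrow> real^'n^'n \<Rightarrow> ennreal" where
  "fractional_energy m p a u T = (\<integral>\<^sup>+h. difference_energy m p u (T *v h) / ennreal (norm h powr a) \<partial>lborel)"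

text \<open>The difference energy is merely a measurable function of \<open>h\<close>. Moving \<open>T\<close> from it into the kernel
  makes the integrand depend continuously on \<open>T\<close>, which is the form that Fatou's lemma needs for
  semicontinuity.\<close>

lemma fractional_energy_substitution:
  assumes [measurable]: "u \<in> borel_measurable borel" and T: "T \<in> SL"
  shows "fractional_energy m p a u T
    = (\<integral>\<^sup>+h. difference_energy m p u h / ennreal (norm (matrix_inv T *v h) powr a) \<partial>lborel)"
proof -
  let ?F = "\<lambda>h. difference_energy m p u h / ennreal (norm (matrix_inv T *v h) powr a)"
  have "(\<integral>\<^sup>+h. ?F (T *v h) \<partial>lborel) = (\<integral>\<^sup>+h. ?F h \<partial>lborel)"
    by (rule nn_integral_lborel_SL[OF _ T]) measurable
  then show ?thesis by (simp add: fractional_energy_def SL_matrix_inv(2)[OF T])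
qed

lemma fractional_energy_lsc:
  fixes X :: "nat \<Rightarrow> real^'n^'n"
  assumes [measurable]: "u \<in> borel_measurable borel" and a: "a > 0"
    and X: "\<And>k. X k \<in> SL" and T: "T \<in> SL" and lim: "X \<longlonglongrightarrow> T"
  shows "fractional_energy m p a u T \<le> liminf (\<lambda>k. fractional_energy m p a u (X k))"
proof -
  let ?F = "\<lambda>T h. difference_energy m p u h / ennreal (norm (matrix_inv T *v h) powr a)"
  have "AE h in lborel. ?F T h \<le> liminf (\<lambda>k. ?F (X k) h)"
  proof -
    have "AE h in lborel. h \<noteq> (0::real^'n)" by (rule AE_lborel_singleton)
    then show ?thesis
    proof eventually_elim
      case (elim h)
      have nz: "matrix_inv T *v h \<noteq> 0" using SL_matrix_inv(3)[OF T, of h] elim by auto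
      have nzX: "matrix_inv (X k) *v h \<noteq> 0" for k using SL_matrix_inv(3)[OF X, of k h] elim by auto
      have F: "?F S h = difference_energy m p u h * ennreal (inverse (norm (matrix_inv S *v h) powr a))"
        if "matrix_inv S *v h \<noteq> 0" for S
        using that by (simp add: divide_ennreal_def inverse_ennreal)
      have lim': "(\<lambda>k. inverse (norm (matrix_inv (X k) *v h) powr a)) \<longlonglongrightarrow> inverse (norm (matrix_inv T *v h) powr a)"
        using nz by (intro tendsto_inverse tendsto_powr tendsto_norm tendsto_matrix_inv_SL X T lim tendsto_const) auto
      have "(\<lambda>k. ?F (X k) h) \<longlonglongrightarrow> ?F T h"
      proof (cases "difference_energy m p u h = \<infinity>")
        case True
        then show ?thesis using nz nzX by (simp add: ennreal_top_divide)
      next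
        case False
        then show ?thesis unfolding F[OF nz] F[OF nzX]
          by (intro ennreal_tendsto_cmult tendsto_ennrealI lim') (simp add: less_top)
      qed
      then show ?case by (simp add: lim_imp_Liminf)
    qed
  qed
  then have "(\<integral>\<^sup>+h. ?F T h \<partial>lborel) \<le> (\<integral>\<^sup>+h. liminf (\<lambda>k. ?F (X k) h) \<partial>lborel)"
    by (rule nn_integral_mono_AE)
  also have "\<dots> \<le> liminf (\<lambda>k. \<integral>\<^sup>+h. ?F (X k) h \<partial>lborel)"
    by (intro nn_integral_liminf) measurable
  finally show ?thesis using X T by (simp add: fractional_energy_substitution)
qed

text \<open>Suppose that the difference energy does not vanish almost everywhere; then it exceeds some \<open>c > 0\<close>
  far from the origin. Since \<open>X k *v h\<close> tends to infinity for every \<open>h\<close> outside the null space of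
  \<open>L\<close>, the limit inferior of the integrands is at least \<open>c\<close> divided by the kernel, almost everywhere,
  and this has infinite integral because of the singularity at \<open>0\<close>.\<close>

lemma fractional_energy_coercive:
  fixes X :: "nat \<Rightarrow> real^'n^'n"
  assumes [measurable]: "u \<in> borel_measurable borel" and p: "p > 0" and a: "a > real CARD('n)"
    and top: "filterlim (\<lambda>k. norm (X k)) at_top sequentially"
    and L: "(\<lambda>k. X k /\<^sub>R norm (X k)) \<longlonglongrightarrow> L" "norm L = 1"
    and bdd: "\<And>k. fractional_energy m p a u (X k) \<le> C" "C < \<infinity>"
    and fin: "fractional_energy m p a u (mat 1) < \<infinity>"
  shows "fractional_energy m p a u (mat 1) = 0"
proof (cases "AE h in lborel. difference_energy m p u h = 0")
  case True
  then have "AE h in lborel. difference_energy m p u (mat 1 *v h) / ennreal (norm h powr a) = 0"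
    by eventually_elim simp
  then show ?thesis unfolding fractional_energy_def
    by (subst nn_integral_0_iff_AE) (auto simp: measurable_compose)
next
  case False
  have "AE h in lborel. difference_energy m p u (mat 1 *v h) / ennreal (norm h powr a) \<noteq> \<infinity>"
    using fin unfolding fractional_energy_def by (intro nn_integral_noteq_infinite) auto
  then have fin': "AE h in lborel. difference_energy m p u h < \<infinity>"
    by eventually_elim (auto simp: ennreal_divide_eq_top_iff less_top)
  have "\<exists>k. 0 < difference_energy m p u k \<and> difference_energy m p u k < \<infinity>"
  proof (rule ccontr)
    assume no: "\<not> ?thesis"
    from fin' have "AE h in lborel. difference_energy m p u h = 0"
      by eventually_elim (use no in \<open>auto simp: zero_less_iff_neq_zero\<close>)
    with False show False ..
  qed
  then obtain k where "0 < difference_energy m p u k" "difference_energy m p u k < \<infinity>" by blast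
  from difference_energy_bounded_below_at_infinity[OF assms(1) p this]
  obtain R c where c: "c > 0" and R: "\<And>h. norm h \<ge> R \<Longrightarrow> ennreal c \<le> difference_energy m p u h"
    by blast
  have "L \<noteq> 0" using L(2) by auto
  have "AE h in lborel. ennreal c / ennreal (norm h powr a) \<le>
      liminf (\<lambda>k. difference_energy m p u (X k *v h) / ennreal (norm h powr a))"
    using AE_linear_nonzero[OF \<open>L \<noteq> 0\<close>]
  proof eventually_elim
    case (elim h)
    have "(\<lambda>k. norm ((X k /\<^sub>R norm (X k)) *v h)) \<longlonglongrightarrow> norm (L *v h)"
      by (intro tendsto_norm tendsto_matrix_vector_mult L(1))
    then have "filterlim (\<lambda>k. norm ((X k /\<^sub>R norm (X k)) *v h) * norm (X k)) at_top sequentially"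
      using elim by (intro filterlim_tendsto_pos_mult_at_top[OF _ _ top]) auto
    moreover have "norm ((X k /\<^sub>R norm (X k)) *v h) * norm (X k) = norm (X k *v h)" for k
      by (cases "X k = 0") (auto simp: scaleR_matrix_vector_assoc[symmetric])
    ultimately have "eventually (\<lambda>k. norm (X k *v h) \<ge> R) sequentially"
      by (auto simp: filterlim_at_top)
    then have "eventually (\<lambda>k. ennreal c / ennreal (norm h powr a) \<le> difference_energy m p u (X k *v h) / ennreal (norm h powr a)) sequentially"
      by eventually_elim (intro divide_right_mono_ennreal R)
    then show ?case by (rule Liminf_bounded)
  qed
  then have "(\<integral>\<^sup>+(h::real^'n). ennreal c / ennreal (norm h powr a) \<partial>lborel) \<le>
      (\<integral>\<^sup>+h. liminf (\<lambda>k. difference_energy m p u (X k *v h) / ennreal (norm h powr a)) \<partial>lborel)"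
    by (rule nn_integral_mono_AE)
  also have "\<dots> \<le> liminf (\<lambda>k. fractional_energy m p a u (X k))"
    unfolding fractional_energy_def by (intro nn_integral_liminf) measurable
  also have "\<dots> \<le> liminf (\<lambda>k::nat. C)"
    by (intro Liminf_mono always_eventually allI bdd)
  finally have "\<infinity> \<le> C"
    using nn_integral_inverse_norm_powr_eq_top[OF c a] by (simp add: Liminf_const)
  with bdd(2) show ?thesis by simp
qed

lemma difference_funpow_AE_cong:
  fixes f g :: "real^'n \<Rightarrow> real"
  assumes "AE x in lebesgue. f x = g x"
  shows "AE x in lebesgue. (difference h ^^ m) f x = (difference h ^^ m) g x"
proof (induction m)
  case (Suc m)
  from Suc AE_lebesgue_translation[OF Suc, of h] show ?case
    by eventually_elim (simp add: difference_def)
qed (use assms in simp)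

text \<open>Replacing \<open>f\<close> by a Borel representative \<open>u\<close> makes the inner integral a Borel function of \<open>h\<close>.\<close>

lemma sobolev_energy_fractional:
  fixes f u :: "real^'n \<Rightarrow> real"
  assumes s: "s \<notin> \<int>" and [measurable]: "u \<in> borel_measurable borel" and ae: "AE x in lebesgue. f x = u x" and T: "T \<in> SL"
  shows "sobolev_energy s p (f \<circ> (*v) T) = fractional_energy (nat \<lfloor>s\<rfloor> + 1) p (s * p + real CARD('n)) u T"
proof -
  define m where "m = nat \<lfloor>s\<rfloor> + 1"
  have inner: "(\<integral>\<^sup>+x. ennreal (\<bar>(difference h ^^ m) (f \<circ> (*v) T) x\<bar> powr p) \<partial>lebesgue)
      = difference_energy m p u (T *v h)" for h
  proof -
    have "AE x in lebesgue. (difference (T *v h) ^^ m) f (T *v x) = (difference (T *v h) ^^ m) u (T *v x)"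
      by (rule AE_lebesgue_linear[OF difference_funpow_AE_cong[OF ae] T])
    then have "(\<integral>\<^sup>+x. ennreal (\<bar>(difference h ^^ m) (f \<circ> (*v) T) x\<bar> powr p) \<partial>lebesgue)
        = (\<integral>\<^sup>+x. ennreal (\<bar>(difference (T *v h) ^^ m) u (T *v x)\<bar> powr p) \<partial>lebesgue)"
      unfolding difference_funpow_linear by (intro nn_integral_cong_AE) (auto elim: eventually_mono)
    also have "\<dots> = (\<integral>\<^sup>+x. ennreal (\<bar>(difference (T *v h) ^^ m) u (T *v x)\<bar> powr p) \<partial>lborel)"
      by (rule nn_integral_completion)
    also have "\<dots> = difference_energy m p u (T *v h)"
      unfolding difference_energy_def
      by (rule nn_integral_lborel_SL[OF _ T, of "\<lambda>x. ennreal (\<bar>(difference (T *v h) ^^ m) u x\<bar> powr p)"]) measurable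
    finally show ?thesis .
  qed
  show ?thesis
    unfolding sobolev_energy_def fractional_energy_def m_def[symmetric] inner
    unfolding nn_integral_completion
    using s by (simp only: if_False)
qed

lemma sobolev_energy_minimizer_fractional:
  fixes f :: "real^'n \<Rightarrow> real"
  assumes s: "s > 0" "s \<notin> \<int>" and p: "p \<ge> 1" and f: "locally_integrable f" and fin: "sobolev_energy s p f < \<infinity>"
  shows "\<exists>T\<in>SL. \<forall>S\<in>SL. sobolev_energy s p (f \<circ> (*v) T) \<le> sobolev_energy s p (f \<circ> (*v) S)"
proof -
  obtain u where u: "u \<in> borel_measurable lborel" "AE x in lborel. f x = u x"
    using completion_ex_borel_measurable_real[of f lborel] locally_integrable_imp_measurable[OF f] by auto
  then have [measurable]: "u \<in> borel_measurable borel" and ae: "AE x in lebesgue. f x = u x"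
    by (auto intro: AE_completion)
  let ?E = "fractional_energy (nat \<lfloor>s\<rfloor> + 1) p (s * p + real CARD('n)) u"
  have E: "sobolev_energy s p (f \<circ> (*v) T) = ?E T" if "T \<in> SL" for T
    by (rule sobolev_energy_fractional[OF s(2) _ ae that]) simp
  have one: "mat 1 \<in> (SL :: (real^'n^'n) set)" by (simp add: SL_def)
  have "f \<circ> (*v) (mat 1) = f" by auto
  then have fin1: "?E (mat 1) < \<infinity>" using E[OF one] fin by simp
  have sp: "s * p > 0" using s p by simp
  have "\<exists>T\<in>SL. \<forall>S\<in>SL. ?E T \<le> ?E S"
  proof (rule SL_has_minimizer)
    show "?E T \<le> liminf (\<lambda>k. ?E (X k))" if "\<And>k. X k \<in> SL" "T \<in> SL" "X \<longlonglongrightarrow> T" for X T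
      using that sp by (intro fractional_energy_lsc) (auto simp: add_pos_nonneg)
    show "?E (mat 1) = 0"
      if "filterlim (\<lambda>k. norm (X k)) at_top sequentially" "(\<lambda>k. X k /\<^sub>R norm (X k)) \<longlonglongrightarrow> L"
        "norm L = 1" "\<And>k. ?E (X k) \<le> C" "C < \<infinity>" for X L C
      using that fin1 p sp by (intro fractional_energy_coercive[where X=X and L=L and C=C]) auto
  qed (rule fin1)
  then show ?thesis using E by auto
qed

section \<open>Smooth functions and test functions\<close>

definition smooth :: "(real^'n \<Rightarrow> real) \<Rightarrow> bool" where
  "smooth \<phi> \<longleftrightarrow> (\<forall>\<alpha> x. iterated_partial \<alpha> \<phi> differentiable (at x))"

lemma iterated_partial_simps [simp]:
  "iterated_partial [] \<phi> = \<phi>"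
  "iterated_partial (i # \<alpha>) \<phi> = partial_deriv i (iterated_partial \<alpha> \<phi>)"
  by (simp_all add: iterated_partial_def)

lemma iterated_partial_append:
  "iterated_partial (\<alpha> @ \<beta>) \<phi> = iterated_partial \<alpha> (iterated_partial \<beta> \<phi>)"
  by (simp add: iterated_partial_def)

lemma smooth_imp_differentiable: "smooth \<phi> \<Longrightarrow> \<phi> differentiable (at x)"
  unfolding smooth_def by (metis iterated_partial_simps(1))

lemma smooth_iterated_partial: "smooth \<phi> \<Longrightarrow> smooth (iterated_partial \<alpha> \<phi>)"
  unfolding smooth_def by (simp add: iterated_partial_append[symmetric])

lemma smooth_partial_deriv: "smooth \<phi> \<Longrightarrow> smooth (partial_deriv i \<phi>)"
  using smooth_iterated_partial[of \<phi> "[i]"] by simp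

text \<open>A coinduction principle: smoothness of all members of a class follows from its closure under
  partial derivatives.\<close>

lemma smooth_invariant:
  assumes "u \<in> S" "\<And>u x. u \<in> S \<Longrightarrow> u differentiable (at x)" "\<And>u i. u \<in> S \<Longrightarrow> partial_deriv i u \<in> S"
  shows "smooth u"
proof -
  have "iterated_partial \<alpha> u \<in> S" for \<alpha>
    by (induction \<alpha>) (auto intro: assms)
  then show ?thesis unfolding smooth_def using assms(2) by blast
qed

lemma partial_derivI:
  "(\<phi> has_derivative D) (at x) \<Longrightarrow> partial_deriv i \<phi> x = D (axis i 1)"
  unfolding partial_deriv_def using frechet_derivative_at by metis

lemma has_derivative_partial:
  fixes \<phi> :: "real^'n \<Rightarrow> real"
  assumes "\<phi> differentiable (at x)"
  shows "(\<phi> has_derivative (\<lambda>v. \<Sum>i\<in>UNIV. v $ i * partial_deriv i \<phi> x)) (at x)"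
proof -
  have d: "(\<phi> has_derivative frechet_derivative \<phi> (at x)) (at x)"
    using assms frechet_derivative_works by blast
  then interpret bounded_linear "frechet_derivative \<phi> (at x)" by (rule has_derivative_bounded_linear)
  have "frechet_derivative \<phi> (at x) v = (\<Sum>i\<in>UNIV. v $ i * partial_deriv i \<phi> x)" for v
  proof -
    have "v = (\<Sum>i\<in>UNIV. (v $ i) *\<^sub>R axis i 1)"
      using basis_expansion[of v] by (simp add: scalar_mult_eq_scaleR)
    then have "frechet_derivative \<phi> (at x) v = frechet_derivative \<phi> (at x) (\<Sum>i\<in>UNIV. (v $ i) *\<^sub>R axis i 1)"
      by simp
    then show ?thesis by (simp only: sum scale partial_deriv_def real_scaleR_def)
  qed
  then show ?thesis using d by presburger
qed

lemma lists_length_Suc_sum: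
  "(\<Sum>\<beta>::'n::finite list | length \<beta> = Suc n. F \<beta>) = (\<Sum>l\<in>UNIV. \<Sum>\<beta> | length \<beta> = n. F (l # \<beta>))"
proof -
  have eq: "{\<beta>::'n list. length \<beta> = Suc n} = (\<lambda>(l, \<beta>). l # \<beta>) ` (UNIV \<times> {\<beta>. length \<beta> = n})"
    by (auto simp: length_Suc_conv)
  show ?thesis
    unfolding eq sum.cartesian_product
    by (subst sum.reindex) (auto simp: inj_on_def intro!: sum.cong)
qed

lemma finite_lists_length [simp]: "finite {\<beta>::'n::finite list. length \<beta> = n}"
  using finite_lists_length_eq[of "UNIV::'n set" n] by simp

lemma differentiable_affine_comp:
  fixes \<psi> :: "real^'n \<Rightarrow> real" and T :: "real^'n^'n"
  assumes "smooth \<psi>"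
  shows "(\<lambda>x. \<psi> (T *v x + b)) differentiable (at x)"
proof -
  have "(\<lambda>x. T *v x + b) differentiable (at x)"
    by (intro differentiable_add differentiable_const linear_imp_differentiable matrix_vector_mul_linear)
  from differentiable_chain_at[OF this smooth_imp_differentiable[OF assms]] show ?thesis
    by (simp add: o_def)
qed

lemma partial_deriv_affine_comp:
  fixes \<psi> :: "real^'n \<Rightarrow> real" and T :: "real^'n^'n"
  assumes "smooth \<psi>"
  shows "partial_deriv i (\<lambda>x. \<psi> (T *v x + b)) x = (\<Sum>l\<in>UNIV. T $ l $ i * partial_deriv l \<psi> (T *v x + b))"
proof -
  have "((\<lambda>x. T *v x + b) has_derivative (\<lambda>v. T *v v)) (at x)"
    by (auto intro!: derivative_eq_intros bounded_linear_imp_has_derivative)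
  then have "((\<lambda>x. \<psi> (T *v x + b)) has_derivative (\<lambda>v. \<Sum>l\<in>UNIV. (T *v v) $ l * partial_deriv l \<psi> (T *v x + b))) (at x)"
    by (rule has_derivative_compose[OF _ has_derivative_partial[OF smooth_imp_differentiable[OF assms]]])
  from partial_derivI[OF this] show ?thesis
    by (simp add: matrix_vector_mult_basis column_def)
qed

text \<open>The chain rule without symmetry of mixed derivatives: the derivative along the word \<open>\<alpha>\<close> is
  expanded over all words \<open>\<beta>\<close> of the same length, with the order of differentiation retained.\<close>

lemma iterated_partial_affine_comp:
  fixes \<psi> :: "real^'n \<Rightarrow> real" and T :: "real^'n^'n"
  assumes "smooth \<psi>"
  shows "iterated_partial \<alpha> (\<lambda>x. \<psi> (T *v x + b)) = (\<lambda>x. \<Sum>\<beta> | length \<beta> = length \<alpha>.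
    (\<Prod>j<length \<alpha>. T $ (\<beta> ! j) $ (\<alpha> ! j)) * iterated_partial \<beta> \<psi> (T *v x + b))"
proof (induction \<alpha>)
  case (Cons i \<alpha>)
  let ?c = "\<lambda>\<beta>. \<Prod>j<length \<alpha>. T $ (\<beta> ! j) $ (\<alpha> ! j)"
  show ?case
  proof
    fix x
    let ?y = "T *v x + b"
    have "((\<lambda>x. \<Sum>\<beta> | length \<beta> = length \<alpha>. ?c \<beta> * iterated_partial \<beta> \<psi> (T *v x + b)) has_derivative
       (\<lambda>v. \<Sum>\<beta> | length \<beta> = length \<alpha>. ?c \<beta> * (\<Sum>l\<in>UNIV. v $ l * partial_deriv l (\<lambda>x. iterated_partial \<beta> \<psi> (T *v x + b)) x))) (at x)"
      by (intro has_derivative_sum has_derivative_mult_right has_derivative_partial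
          differentiable_affine_comp smooth_iterated_partial assms)
    from partial_derivI[OF this, of i]
    have "iterated_partial (i # \<alpha>) (\<lambda>x. \<psi> (T *v x + b)) x
        = (\<Sum>\<beta> | length \<beta> = length \<alpha>. ?c \<beta> * partial_deriv i (\<lambda>x. iterated_partial \<beta> \<psi> (T *v x + b)) x)"
      by (simp add: Cons axis_def if_distrib[where f="\<lambda>x. x * _"] cong: if_cong)
    also have "\<dots> = (\<Sum>\<beta> | length \<beta> = length \<alpha>. \<Sum>l\<in>UNIV. T $ l $ i * ?c \<beta> * iterated_partial (l # \<beta>) \<psi> ?y)"
      by (simp add: partial_deriv_affine_comp smooth_iterated_partial assms sum_distrib_left mult_ac)
    also have "\<dots> = (\<Sum>l\<in>UNIV. \<Sum>\<beta> | length \<beta> = length \<alpha>. T $ l $ i * ?c \<beta> * iterated_partial (l # \<beta>) \<psi> ?y)"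
      by (rule sum.swap)
    also have "\<dots> = (\<Sum>\<beta> | length \<beta> = length (i # \<alpha>).
        (\<Prod>j<length (i # \<alpha>). T $ (\<beta> ! j) $ ((i # \<alpha>) ! j)) * iterated_partial \<beta> \<psi> ?y)"
      by (simp add: lists_length_Suc_sum prod.lessThan_Suc_shift del: prod.lessThan_Suc)
    finally show "iterated_partial (i # \<alpha>) (\<lambda>x. \<psi> (T *v x + b)) x = \<dots>" .
  qed
qed simp

lemma smooth_affine_comp:
  fixes \<psi> :: "real^'n \<Rightarrow> real" and T :: "real^'n^'n"
  assumes "smooth \<psi>"
  shows "smooth (\<lambda>x. \<psi> (T *v x + b))"
  unfolding smooth_def iterated_partial_affine_comp[OF assms]
  by (intro allI differentiable_sum ballI finite_lists_length differentiable_mult differentiable_const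
      differentiable_affine_comp smooth_iterated_partial assms)

lemma iterated_partial_translation:
  assumes "smooth \<psi>"
  shows "iterated_partial \<alpha> (\<lambda>x. \<psi> (x - c)) = (\<lambda>x. iterated_partial \<alpha> \<psi> (x - c))"
proof (induction \<alpha>)
  case (Cons i \<alpha>)
  have "partial_deriv i (\<lambda>x. u (x - c)) x = partial_deriv i u (x - c)" if "smooth u" for u x
  proof -
    have "((\<lambda>x. x - c) has_derivative (\<lambda>v. v)) (at x)" by (auto intro!: derivative_eq_intros)
    then have "((\<lambda>x. u (x - c)) has_derivative (\<lambda>v. \<Sum>i\<in>UNIV. v $ i * partial_deriv i u (x - c))) (at x)"
      by (rule has_derivative_compose[OF _ has_derivative_partial[OF smooth_imp_differentiable[OF that]]])
    from partial_derivI[OF this] show ?thesis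
      by (simp add: axis_def if_distrib[where f="\<lambda>x. x * _"] cong: if_cong)
  qed
  then show ?case
    unfolding iterated_partial_simps(2) Cons using smooth_iterated_partial[OF assms] by blast
qed simp

lemma smooth_translation: "smooth \<psi> \<Longrightarrow> smooth (\<lambda>x. \<psi> (x - c))"
  using smooth_affine_comp[of \<psi> "mat 1" "- c"] by simp

lemma test_function_iff: "test_function \<phi> \<longleftrightarrow> smooth \<phi> \<and> (\<exists>R. \<forall>x. \<phi> x \<noteq> 0 \<longrightarrow> norm x \<le> R)"
proof -
  have "compact (closure {x. \<phi> x \<noteq> 0}) \<longleftrightarrow> (\<exists>R. \<forall>x. \<phi> x \<noteq> 0 \<longrightarrow> norm x \<le> R)"
    unfolding compact_closure bounded_iff by auto
  then show ?thesis by (auto simp: test_function_def smooth_def)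
qed

lemma partial_deriv_eq_0_outside:
  assumes "\<forall>x. \<phi> x \<noteq> 0 \<longrightarrow> norm x \<le> R" "norm x > R"
  shows "partial_deriv i \<phi> x = 0"
proof -
  have "((\<lambda>x. 0) has_derivative (\<lambda>v. 0)) (at x)" by simp
  then have "(\<phi> has_derivative (\<lambda>v. 0)) (at x)"
  proof (rule has_derivative_transform_within_open)
    show "open {x. norm x > R}" by (intro open_Collect_less continuous_intros)
  qed (use assms in \<open>auto simp: not_le[symmetric]\<close>)
  from partial_derivI[OF this] show ?thesis .
qed

lemma test_function_partial_deriv:
  assumes "test_function \<phi>"
  shows "test_function (partial_deriv i \<phi>)"
proof -
  obtain R where R: "\<forall>x. \<phi> x \<noteq> 0 \<longrightarrow> norm x \<le> R" "smooth \<phi>"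
    using assms unfolding test_function_iff by blast
  have "\<forall>x. partial_deriv i \<phi> x \<noteq> 0 \<longrightarrow> norm x \<le> R"
    using partial_deriv_eq_0_outside[OF R(1)] by (meson not_le)
  then show ?thesis using smooth_partial_deriv[OF R(2)] unfolding test_function_iff by blast
qed

lemma test_function_iterated_partial:
  "test_function \<phi> \<Longrightarrow> test_function (iterated_partial \<alpha> \<phi>)"
  by (induction \<alpha>) (auto intro: test_function_partial_deriv)

lemma test_function_linear_comp:
  assumes "test_function \<psi>" and T: "T \<in> SL"
  shows "test_function (\<psi> \<circ> (*v) T)"
proof -
  obtain R where R: "\<forall>x. \<psi> x \<noteq> 0 \<longrightarrow> norm x \<le> R" "smooth \<psi>"
    using assms unfolding test_function_iff by blast
  obtain K where K: "\<And>x. norm (matrix_inv T *v x) \<le> norm x * K" "K \<ge> 0"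
    using bounded_linear.nonneg_bounded[OF matrix_vector_mul_bounded_linear[of "matrix_inv T"]] by blast
  have "norm x \<le> R * K" if "\<psi> (T *v x) \<noteq> 0" for x
  proof -
    have "norm x = norm (matrix_inv T *v (T *v x))" by (simp add: SL_matrix_inv(2)[OF T])
    also have "\<dots> \<le> norm (T *v x) * K" by (rule K)
    also have "\<dots> \<le> R * K" using R(1) that K by (intro mult_right_mono) auto
    finally show ?thesis .
  qed
  moreover have "smooth (\<psi> \<circ> (*v) T)"
    using smooth_affine_comp[OF R(2), of T 0] by (simp add: o_def)
  ultimately show ?thesis unfolding test_function_iff by auto
qed

lemma test_function_translation:
  assumes "test_function \<psi>"
  shows "test_function (\<lambda>x. \<psi> (x - c))"
proof -
  obtain R where R: "\<forall>x. \<psi> x \<noteq> 0 \<longrightarrow> norm x \<le> R" "smooth \<psi>"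
    using assms unfolding test_function_iff by blast
  have "norm x \<le> R + norm c" if "\<psi> (x - c) \<noteq> 0" for x
    using R(1) that norm_triangle_ineq[of "x - c" c] by fastforce
  then show ?thesis unfolding test_function_iff using smooth_translation[OF R(2)] by blast
qed

lemma test_function_continuous: "test_function \<phi> \<Longrightarrow> continuous_on UNIV \<phi>"
  by (simp add: continuous_on_eq_continuous_at test_function_iff smooth_imp_differentiable differentiable_imp_continuous_within)

lemma test_function_bounded:
  assumes "test_function \<phi>"
  obtains B R where "B \<ge> 0" "\<And>x. \<bar>\<phi> x\<bar> \<le> B" "\<And>x. \<phi> x \<noteq> 0 \<Longrightarrow> norm x \<le> R"
proof -
  obtain R where R: "\<And>x. \<phi> x \<noteq> 0 \<Longrightarrow> norm x \<le> R"
    using assms unfolding test_function_iff by blast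
  have "compact (\<phi> ` cball 0 R)"
    by (intro compact_continuous_image continuous_on_subset[OF test_function_continuous[OF assms]]) auto
  then obtain B where B: "\<And>x. x \<in> cball 0 R \<Longrightarrow> \<bar>\<phi> x\<bar> \<le> B"
    by (force dest!: compact_imp_bounded simp: bounded_iff simp del: mem_cball)
  have "\<bar>\<phi> x\<bar> \<le> max B 0" for x
    using B[of x] R[of x] by (cases "\<phi> x = 0") (auto simp: max_def mem_cball_0)
  then show thesis using R by (intro that[of "max B 0" R]) auto
qed

lemma test_function_measurable [measurable]:
  assumes "test_function \<phi>"
  shows "\<phi> \<in> borel_measurable borel"
  using test_function_continuous[OF assms] by (rule borel_measurable_continuous_onI)

lemma integrable_mult_bounded_support:
  assumes g: "locally_integrable g" and [measurable]: "\<psi> \<in> borel_measurable lebesgue"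
    and B: "\<And>x. \<bar>\<psi> x\<bar> \<le> B" "\<And>x. \<psi> x \<noteq> 0 \<Longrightarrow> norm x \<le> R"
  shows "integrable lebesgue (\<lambda>x. g x * \<psi> x)"
proof (rule Bochner_Integration.integrable_bound)
  show "integrable lebesgue (\<lambda>x. B * (indicator (cball 0 R) x * g x))"
    by (intro integrable_mult_right locally_integrable_cball g)
  have [measurable]: "g \<in> borel_measurable lebesgue" by (rule locally_integrable_imp_measurable[OF g])
  show "(\<lambda>x. g x * \<psi> x) \<in> borel_measurable lebesgue" by measurable
  have "\<bar>g x * \<psi> x\<bar> \<le> \<bar>B * (indicator (cball 0 R) x * g x)\<bar>" for x
  proof (cases "\<psi> x = 0")
    case False
    then have "x \<in> cball 0 R" using B(2) by (simp add: mem_cball_0)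
    moreover have "\<bar>g x\<bar> * \<bar>\<psi> x\<bar> \<le> \<bar>g x\<bar> * \<bar>B\<bar>" using B(1)[of x] by (intro mult_left_mono) auto
    ultimately show ?thesis by (simp add: abs_mult mult.commute)
  qed simp
  then show "AE x in lebesgue. norm (g x * \<psi> x) \<le> norm (B * (indicator (cball 0 R) x * g x))" by simp
qed

lemma integrable_mult_test_function:
  assumes "locally_integrable g" "test_function \<phi>"
  shows "integrable lebesgue (\<lambda>x. g x * \<phi> x)"
proof -
  obtain B R where "\<And>x. \<bar>\<phi> x\<bar> \<le> B" "\<And>x. \<phi> x \<noteq> 0 \<Longrightarrow> norm x \<le> R"
    using test_function_bounded[OF assms(2)] by metis
  then show ?thesis
    using assms by (intro integrable_mult_bounded_support[of g \<phi> B R]) (auto intro: measurable_completion)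
qed

section \<open>Bump functions and the fundamental lemma\<close>

text \<open>The polynomial factor makes the family closed under differentiation; since for \<open>c > 0\<close> all members are
  flat at \<open>0\<close>, this yields smoothness there without a formula for the higher derivatives.\<close>

definition flat_exp :: "real poly \<Rightarrow> real \<Rightarrow> real \<Rightarrow> real" where
  "flat_exp q c t = (if t > 0 then poly q (1 / t) * exp (- c / t) else 0)"

lemma poly_mult_exp_tendsto_0:
  assumes "c > 0"
  shows "((\<lambda>y::real. poly q y * exp (- c * y)) \<longlongrightarrow> 0) at_top"
proof -
  have "((\<lambda>y::real. coeff q i * (1 / c ^ i * ((c * y) ^ i / exp (c * y)))) \<longlongrightarrow> coeff q i * (1 / c ^ i * 0)) at_top" for i
  proof (intro tendsto_mult tendsto_const)
    have "filterlim (\<lambda>y. c * y) at_top at_top"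
      using assms by (intro filterlim_tendsto_pos_mult_at_top[OF tendsto_const _ filterlim_ident])
    from filterlim_compose[OF tendsto_power_div_exp_0[of i] this]
    show "((\<lambda>y. (c * y) ^ i / exp (c * y)) \<longlongrightarrow> 0) at_top" .
  qed
  then have "((\<lambda>y::real. \<Sum>i\<le>degree q. coeff q i * (1 / c ^ i * ((c * y) ^ i / exp (c * y)))) \<longlongrightarrow> (\<Sum>i\<le>degree q. coeff q i * (1 / c ^ i * 0))) at_top"
    by (intro tendsto_sum)
  moreover have "(\<Sum>i\<le>degree q. coeff q i * (1 / c ^ i * ((c * y) ^ i / exp (c * y)))) = poly q y * exp (- c * y)" for y
    unfolding poly_altdef sum_distrib_right using assms
    by (intro sum.cong) (auto simp: power_mult_distrib exp_minus field_simps)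
  ultimately show ?thesis by simp
qed

lemma flat_exp_deriv:
  assumes "c > 0"
  shows "(flat_exp q c has_real_derivative flat_exp ([:0, 0, 1:] * (smult c q - pderiv q)) c t) (at t)"
proof -
  consider "t > 0" | "t < 0" | "t = 0" by linarith
  then show ?thesis
  proof cases
    case 1
    have "((\<lambda>t. poly q (1 / t) * exp (- c / t)) has_real_derivative
        flat_exp ([:0, 0, 1:] * (smult c q - pderiv q)) c t) (at t)"
      using 1 by (auto intro!: derivative_eq_intros DERIV_chain2[OF poly_DERIV] simp: flat_exp_def field_simps power2_eq_square)
    then show ?thesis
      by (rule has_field_derivative_transform_within_open[where S="{0<..}"]) (use 1 in \<open>auto simp: flat_exp_def\<close>)
  next
    case 2
    have "((\<lambda>t. 0) has_real_derivative flat_exp ([:0, 0, 1:] * (smult c q - pderiv q)) c t) (at t)"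
      using 2 by (simp add: flat_exp_def)
    then show ?thesis
      by (rule has_field_derivative_transform_within_open[where S="{..<0}"]) (use 2 in \<open>auto simp: flat_exp_def\<close>)
  next
    case 3
    have "((\<lambda>s. flat_exp q c s / s) \<longlongrightarrow> 0) (at_right 0)"
    proof -
      have "((\<lambda>s. poly ([:0, 1:] * q) (inverse s) * exp (- c * inverse s)) \<longlongrightarrow> 0) (at_right 0)"
        by (rule filterlim_compose[OF poly_mult_exp_tendsto_0[OF assms] filterlim_inverse_at_top_right])
      moreover have "eventually (\<lambda>s. poly ([:0, 1:] * q) (inverse s) * exp (- c * inverse s) = flat_exp q c s / s) (at_right (0::real))"
        using eventually_at_right_less[of 0] by (auto elim!: eventually_mono simp: flat_exp_def field_simps)
      ultimately show ?thesis by (rule Lim_transform_eventually)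
    qed
    moreover have "((\<lambda>s. flat_exp q c s / s) \<longlongrightarrow> 0) (at_left 0)"
      by (rule tendsto_eventually) (auto simp: eventually_at_filter flat_exp_def)
    ultimately show ?thesis
      by (simp add: 3 has_field_derivative_iff flat_exp_def[of _ _ 0] filterlim_split_at)
  qed
qed

text \<open>The algebra generated by the functions \<^const>\<open>flat_exp\<close> of affine functions of one coordinate.
  Being closed under partial derivatives, it consists of smooth functions; a direct treatment of
  products of bumps would need iterated Leibniz formulas.\<close>

inductive_set bump_algebra :: "(real^'n \<Rightarrow> real) set" where
  const: "(\<lambda>x. a) \<in> bump_algebra"
| bump: "c > 0 \<Longrightarrow> (\<lambda>x. flat_exp q c (\<sigma> * x $ k + b)) \<in> bump_algebra"
| add: "u \<in> bump_algebra \<Longrightarrow> v \<in> bump_algebra \<Longrightarrow> (\<lambda>x. u x + v x) \<in> bump_algebra"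
| mult: "u \<in> bump_algebra \<Longrightarrow> v \<in> bump_algebra \<Longrightarrow> (\<lambda>x. u x * v x) \<in> bump_algebra"

lemma bump_algebra_deriv:
  fixes u :: "real^'n \<Rightarrow> real"
  shows "u \<in> bump_algebra \<Longrightarrow> (\<forall>x. u differentiable (at x)) \<and> (\<forall>i. partial_deriv i u \<in> bump_algebra)"
proof (induction rule: bump_algebra.induct)
  case (const a)
  have "partial_deriv i (\<lambda>x::real^'n. a) = (\<lambda>x. 0)" for i
    using partial_derivI[OF has_derivative_const] by blast
  then show ?case using bump_algebra.const[of 0] by simp
next
  case (bump c q \<sigma> k b)
  let ?q' = "[:0, 0, 1:] * (smult c q - pderiv q)"
  have d: "((\<lambda>x. flat_exp q c (\<sigma> * x $ k + b)) has_derivative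
    (\<lambda>v. (\<sigma> * v $ k) * flat_exp ?q' c (\<sigma> * x $ k + b))) (at x)" for x
  proof -
    have "((\<lambda>x. \<sigma> * x $ k + b) has_derivative (\<lambda>v. \<sigma> * v $ k)) (at x)"
      by (auto intro!: derivative_eq_intros bounded_linear_imp_has_derivative bounded_linear_vec_nth)
    from has_derivative_compose[OF this flat_exp_deriv[OF bump, of q, unfolded has_field_derivative_def]]
    show ?thesis by (simp add: mult.commute)
  qed
  have "partial_deriv i (\<lambda>x. flat_exp q c (\<sigma> * x $ k + b)) =
      (\<lambda>x. (\<sigma> * axis i 1 $ k) * flat_exp ?q' c (\<sigma> * x $ k + b))" for i
    using partial_derivI[OF d] by blast
  moreover have "(\<lambda>x. (\<sigma> * axis i 1 $ k) * flat_exp ?q' c (\<sigma> * x $ k + b)) \<in> bump_algebra" for i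
    by (rule bump_algebra.mult[OF bump_algebra.const bump_algebra.bump[OF bump]])
  ultimately show ?case
    using d unfolding differentiable_def by metis
next
  case (add u v)
  have "((\<lambda>x. u x + v x) has_derivative (\<lambda>h. (\<Sum>i\<in>UNIV. h $ i * partial_deriv i u x) + (\<Sum>i\<in>UNIV. h $ i * partial_deriv i v x))) (at x)" for x
    by (intro has_derivative_add has_derivative_partial) (use add in auto)
  from partial_derivI[OF this]
  have "partial_deriv i (\<lambda>x. u x + v x) = (\<lambda>x. partial_deriv i u x + partial_deriv i v x)" for i
    by (simp add: fun_eq_iff axis_def if_distrib[where f="\<lambda>x. x * _"] cong: if_cong)
  then show ?case using add by (auto intro: bump_algebra.intros)
next
  case (mult u v)
  have "((\<lambda>x. u x * v x) has_derivative (\<lambda>h. u x * (\<Sum>i\<in>UNIV. h $ i * partial_deriv i v x) + (\<Sum>i\<in>UNIV. h $ i * partial_deriv i u x) * v x)) (at x)" for x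
    by (intro has_derivative_mult has_derivative_partial) (use mult in auto)
  from partial_derivI[OF this]
  have "partial_deriv i (\<lambda>x. u x * v x) = (\<lambda>x. u x * partial_deriv i v x + partial_deriv i u x * v x)" for i
    by (simp add: fun_eq_iff axis_def if_distrib[where f="\<lambda>x. x * _"] cong: if_cong)
  moreover have "(\<lambda>x. u x * partial_deriv i v x + partial_deriv i u x * v x) \<in> bump_algebra" for i
    using mult by (intro bump_algebra.add[OF bump_algebra.mult bump_algebra.mult]) auto
  ultimately show ?case using mult by simp
qed

lemma bump_algebra_smooth: "u \<in> bump_algebra \<Longrightarrow> smooth u"
  by (rule smooth_invariant[where S=bump_algebra]) (auto dest: bump_algebra_deriv)

lemma bump_algebra_prod:
  "finite I \<Longrightarrow> (\<And>i. i \<in> I \<Longrightarrow> u i \<in> bump_algebra) \<Longrightarrow> (\<lambda>x. \<Prod>i\<in>I. u i x) \<in> bump_algebra"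
  by (induction I rule: finite_induct) (auto intro: bump_algebra.intros)

text \<open>Smooth functions with values in \<open>[0, 1]\<close> that vanish off \<open>box a b\<close> and converge pointwise to its
  indicator function, because the exponents \<open>1 / Suc n\<close> tend to \<open>0\<close>.\<close>

definition box_bump :: "real^'n \<Rightarrow> real^'n \<Rightarrow> nat \<Rightarrow> real^'n \<Rightarrow> real" where
  "box_bump a b n x = (\<Prod>i\<in>UNIV. flat_exp 1 (1 / real (Suc n)) (x $ i - a $ i) * flat_exp 1 (1 / real (Suc n)) (b $ i - x $ i))"

lemma flat_exp_one_bounds: "c > 0 \<Longrightarrow> 0 \<le> flat_exp 1 c t \<and> flat_exp 1 c t \<le> 1"
  by (auto simp: flat_exp_def divide_nonpos_pos)

lemma flat_exp_one_tendsto: "(\<lambda>n. flat_exp 1 (1 / real (Suc n)) t) \<longlonglongrightarrow> (if t > 0 then 1 else 0)"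
proof -
  have "(\<lambda>n. exp (- (1 / real (Suc n)) / t)) \<longlonglongrightarrow> exp (- 0 / t)" if "t > 0"
    using that LIMSEQ_inverse_real_of_nat by (intro tendsto_intros) (auto simp only: inverse_eq_divide)
  then show ?thesis by (auto simp: flat_exp_def)
qed

lemma box_bump_bounds: "0 \<le> box_bump a b n x \<and> box_bump a b n x \<le> 1"
  unfolding box_bump_def
  by (intro conjI prod_nonneg prod_le_1 ballI mult_nonneg_nonneg mult_le_one) (auto simp: flat_exp_one_bounds)

lemma box_bump_outside: "x \<notin> box a b \<Longrightarrow> box_bump a b n x = 0"
  by (force simp: box_bump_def mem_box_cart flat_exp_def)

lemma box_bump_tendsto:
  fixes x :: "real^'n"
  shows "(\<lambda>n. box_bump a b n x) \<longlonglongrightarrow> indicator (box a b) x"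
proof (cases "x \<in> box a b")
  case True
  then have "a $ i < x $ i" "x $ i < b $ i" for i by (auto simp: mem_box_cart)
  then have lim: "(\<lambda>n. flat_exp 1 (1 / real (Suc n)) (x $ i - a $ i) * flat_exp 1 (1 / real (Suc n)) (b $ i - x $ i)) \<longlonglongrightarrow> 1 * 1" for i
    using flat_exp_one_tendsto[of "x $ i - a $ i"] flat_exp_one_tendsto[of "b $ i - x $ i"]
    by (intro tendsto_mult) auto
  have "(\<lambda>n. box_bump a b n x) \<longlonglongrightarrow> (\<Prod>i\<in>(UNIV::'n set). 1 * 1)"
    unfolding box_bump_def by (rule tendsto_prod) (rule lim)
  then show ?thesis using True by simp
qed (simp add: box_bump_outside)

lemma test_function_box_bump:
  fixes a b :: "real^'n"
  shows "test_function (box_bump a b n)"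
  unfolding test_function_iff
proof
  have 1: "(\<lambda>x::real^'n. flat_exp 1 (1 / real (Suc n)) (1 * x $ i + (- a $ i))) \<in> bump_algebra" for i
    by (rule bump_algebra.bump) simp
  have 2: "(\<lambda>x::real^'n. flat_exp 1 (1 / real (Suc n)) (- 1 * x $ i + b $ i)) \<in> bump_algebra" for i
    by (rule bump_algebra.bump) simp
  have "box_bump a b n = (\<lambda>x. \<Prod>i\<in>UNIV. flat_exp 1 (1 / real (Suc n)) (1 * x $ i + (- a $ i)) * flat_exp 1 (1 / real (Suc n)) (- 1 * x $ i + b $ i))"
    by (simp add: box_bump_def fun_eq_iff)
  also have "\<dots> \<in> bump_algebra"
    by (intro bump_algebra_prod bump_algebra.mult 1 2) auto
  finally show "smooth (box_bump a b n)" by (rule bump_algebra_smooth)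
  have "bounded (box a b)" by simp
  then obtain R where "\<forall>x\<in>box a b. norm x \<le> R" by (auto simp: bounded_iff)
  then show "\<exists>R. \<forall>x. box_bump a b n x \<noteq> 0 \<longrightarrow> norm x \<le> R"
    using box_bump_outside by blast
qed

text \<open>The sets over which \<open>g\<close> has integral \<open>0\<close> form a Dynkin system, and the boxes are a generator of the
  Borel sets that is stable under intersections.\<close>

lemma AE_zero_of_integral_boxes:
  fixes g :: "'a::euclidean_space \<Rightarrow> real"
  assumes g: "integrable lborel g"
    and zero: "\<And>a b. (LINT x|lborel. indicator (box a b) x * g x) = 0" "(LINT x|lborel. g x) = 0"
  shows "AE x in lborel. g x = 0"
proof (rule density_unique_real)
  fix A :: "'a set" assume "A \<in> sets lborel"
  let ?E = "range (\<lambda>(a, b). box a b::'a set)"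
  have [measurable]: "g \<in> borel_measurable borel" using g by (simp add: borel_measurable_integrable[of lborel, simplified])
  have int: "integrable lborel (\<lambda>x. indicator A x * g x)" if "A \<in> sets borel" for A
    using integrable_mult_indicator[of A lborel g] that g by simp
  have "A \<in> sigma_sets UNIV ?E" using \<open>A \<in> sets lborel\<close> by (simp add: borel_eq_box)
  have stable: "Int_stable ?E" "?E \<subseteq> Pow UNIV" by (auto simp: Int_stable_def box_Int_box)
  have "(LINT x|lborel. indicator A x * g x) = 0"
    using stable \<open>A \<in> sigma_sets UNIV ?E\<close>
  proof (induction rule: sigma_sets_induct_disjoint)
    case (basic A)
    then show ?case using zero by auto
  next
    case empty
    then show ?case by simp
  next
    case (compl A)
    then have "A \<in> sets borel" by (simp add: borel_eq_box)
    have "(LINT x|lborel. indicator (UNIV - A) x * g x) = (LINT x|lborel. g x - indicator A x * g x)"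
      by (intro Bochner_Integration.integral_cong) (auto simp: indicator_def)
    also have "\<dots> = (LINT x|lborel. g x) - (LINT x|lborel. indicator A x * g x)"
      using g int[OF \<open>A \<in> sets borel\<close>] by (rule Bochner_Integration.integral_diff)
    finally show ?case using compl zero(2) by simp
  next
    case (union A)
    then have A: "A i \<in> sets borel" for i by (auto simp: borel_eq_box)
    then have UA: "(\<Union>i. A i) \<in> sets borel" by auto
    have "(LINT x:(\<Union>i. A i)|lborel. g x) = (\<Sum>i. (LINT x:(A i)|lborel. g x))"
    proof (rule lebesgue_integral_countable_add)
      show "A i \<inter> A j = {}" if "i \<noteq> j" for i j using union that by (auto simp: disjoint_family_on_def)
      show "set_integrable lborel (\<Union>i. A i) g" using int[OF UA] by (simp add: set_integrable_def)
    qed (use A in auto)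
    then show ?case using union by (simp add: set_lebesgue_integral_def)
  qed
  then show "(LINT x:A|lborel. g x) = (LINT x:A|lborel. 0)"
    by (simp add: set_lebesgue_integral_def)
qed (use g in auto)

text \<open>The fundamental lemma of the calculus of variations. The bumps approximate the indicators of
  boxes, so \<open>g\<close> has integral \<open>0\<close> over every box, and the previous lemma applies to the restriction
  of \<open>g\<close> to a bounded box.\<close>

lemma AE_zero_of_test_functions:
  fixes g :: "real^'n \<Rightarrow> real"
  assumes g: "locally_integrable g"
    and zero: "\<And>\<phi>. test_function \<phi> \<Longrightarrow> (LINT x|lebesgue. g x * \<phi> x) = 0"
  shows "AE x in lebesgue. g x = 0"
proof -
  have gm [measurable]: "g \<in> borel_measurable lebesgue" by (rule locally_integrable_imp_measurable[OF g])
  have box0: "(LINT x|lebesgue. indicator (box a b) x * g x) = 0" and boxi: "integrable lebesgue (\<lambda>x. indicator (box a b) x * g x)" for a b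
  proof -
    have "bounded (box a b)" by simp
    then obtain R where R: "\<And>x. x\<in>box a b \<Longrightarrow> norm x \<le> R" by (auto simp: bounded_iff)
    have "(indicator (box a b) :: real^'n \<Rightarrow> real) \<in> borel_measurable lebesgue"
      by (intro borel_measurable_indicator) simp
    then have "integrable lebesgue (\<lambda>x. g x * indicator (box a b) x)"
      by (rule integrable_mult_bounded_support[OF g, where B=1 and R=R])
        (use R in \<open>auto simp: indicator_def split: if_splits\<close>)
    then show int: "integrable lebesgue (\<lambda>x. indicator (box a b) x * g x)" by (simp add: mult.commute)
    have meas: "box_bump a b n \<in> borel_measurable lebesgue" for n
      by (rule measurable_completion) (simp add: test_function_measurable test_function_box_bump)
    have "(\<lambda>n. LINT x|lebesgue. g x * box_bump a b n x) \<longlonglongrightarrow> (LINT x|lebesgue. indicator (box a b) x * g x)"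
    proof (rule integral_dominated_convergence[where w="\<lambda>x. \<bar>indicator (box a b) x * g x\<bar>"])
      show "AE x in lebesgue. (\<lambda>n. g x * box_bump a b n x) \<longlonglongrightarrow> indicator (box a b) x * g x"
        by (subst mult.commute) (intro AE_I2 tendsto_mult tendsto_const box_bump_tendsto)
      show "AE x in lebesgue. norm (g x * box_bump a b n x) \<le> \<bar>indicator (box a b) x * g x\<bar>" for n
      proof (rule AE_I2)
        fix x
        show "norm (g x * box_bump a b n x) \<le> \<bar>indicator (box a b) x * g x\<bar>"
          using box_bump_bounds[of a b n x] box_bump_outside[of x a b n]
          by (cases "x \<in> box a b") (auto simp: abs_mult intro!: mult_left_le)
      qed
    qed (use meas int in \<open>auto intro!: borel_measurable_times\<close>)
    then show "(LINT x|lebesgue. indicator (box a b) x * g x) = 0"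
      using zero[OF test_function_box_bump] by (simp add: LIMSEQ_const_iff)
  qed
  have local: "AE x in lebesgue. x \<in> box a b \<longrightarrow> g x = 0" for a b
  proof -
    define G where "G x = indicator (box a b) x * g x" for x
    have Gi: "integrable lebesgue G" unfolding G_def by (rule boxi)
    then obtain u where u: "u \<in> borel_measurable lborel" "AE x in lborel. G x = u x"
      using completion_ex_borel_measurable_real[of G lborel] by auto
    note [measurable] = u(1)
    have ae: "AE x in lebesgue. G x = u x" using u(2) by (rule AE_completion)
    have um: "u \<in> borel_measurable lebesgue" using u(1) by (rule measurable_completion)
    have Gm: "G \<in> borel_measurable lebesgue" using Gi by (rule borel_measurable_integrable)
    have I: "(LINT x|lborel. indicator A x * u x) = (LINT x|lebesgue. indicator A x * G x)" if [measurable]: "A \<in> sets borel" for A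
    proof -
      have "(LINT x|lborel. indicator A x * u x) = (LINT x|lebesgue. indicator A x * u x)"
        by (rule integral_completion[symmetric]) measurable
      also have "\<dots> = (LINT x|lebesgue. indicator A x * G x)"
        using ae um Gm that by (intro integral_cong_AE borel_measurable_times borel_measurable_indicator) auto
      finally show ?thesis .
    qed
    have "AE x in lborel. u x = 0"
    proof (rule AE_zero_of_integral_boxes)
      have "integrable lebesgue u"
        using Gi integrable_cong_AE[OF Gm um ae] by simp
      then show "integrable lborel u" using integrable_completion[OF u(1)] by simp
      show "(LINT x|lborel. indicator (box l r) x * u x) = 0" for l r
      proof -
        have "indicator (box l r) x * G x = indicator (box l r \<inter> box a b) x * g x" for x
          by (auto simp: G_def indicator_def)
        then show ?thesis unfolding I[OF borel_open[OF open_box]] using box0 by (simp add: box_Int_box)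
      qed
      show "(LINT x|lborel. u x) = 0"
        using I[of UNIV] box0[of a b] by (simp add: G_def)
    qed
    then have "AE x in lebesgue. u x = 0" by (rule AE_completion)
    with ae show ?thesis by eventually_elim (auto simp: G_def indicator_def)
  qed
  have "AE x in lebesgue. \<forall>n::nat. x \<in> box (\<chi> i. - real n) (\<chi> i. real n) \<longrightarrow> g x = 0"
    by (subst AE_all_countable) (intro allI local)
  then show ?thesis
  proof eventually_elim
    case (elim x)
    obtain n where n: "norm x < real n" using reals_Archimedean2 by blast
    have "\<bar>x $ i\<bar> < real n" for i using component_le_norm_cart[of x i] n by linarith
    then have "x \<in> box (\<chi> i. - real n) (\<chi> i. real n)" by (auto simp: mem_box_cart abs_less_iff minus_less_iff)
    with elim show ?case by blast
  qed
qed

section \<open>Translation along a direction\<close>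

lemma iterated_partial_sum:
  assumes "finite I" "\<And>i. i \<in> I \<Longrightarrow> smooth (u i)"
  shows "iterated_partial \<alpha> (\<lambda>x. \<Sum>i\<in>I. c i * u i x) = (\<lambda>x. \<Sum>i\<in>I. c i * iterated_partial \<alpha> (u i) x)"
proof (induction \<alpha>)
  case (Cons k \<alpha>)
  have "((\<lambda>x. \<Sum>i\<in>I. c i * iterated_partial \<alpha> (u i) x) has_derivative
     (\<lambda>v. \<Sum>i\<in>I. c i * (\<Sum>l\<in>UNIV. v $ l * partial_deriv l (iterated_partial \<alpha> (u i)) x))) (at x)" for x
    by (intro has_derivative_sum has_derivative_mult_right has_derivative_partial smooth_imp_differentiable
        smooth_iterated_partial assms)
  from partial_derivI[OF this, of k] show ?case
    by (simp add: Cons fun_eq_iff axis_def if_distrib[where f="\<lambda>x. x * _"] cong: if_cong)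
qed simp

lemma smooth_sum:
  assumes "finite I" "\<And>i. i \<in> I \<Longrightarrow> smooth (u i)"
  shows "smooth (\<lambda>x. \<Sum>i\<in>I. c i * u i x)"
proof -
  have d: "(\<lambda>x. \<Sum>i\<in>I. c i * iterated_partial \<alpha> (u i) x) differentiable (at x)" for \<alpha> x
    by (intro differentiable_sum assms ballI differentiable_mult differentiable_const
        smooth_imp_differentiable smooth_iterated_partial)
  have "iterated_partial \<alpha> (\<lambda>x. \<Sum>i\<in>I. c i * u i x) = (\<lambda>x. \<Sum>i\<in>I. c i * iterated_partial \<alpha> (u i) x)" for \<alpha>
    by (rule iterated_partial_sum) (use assms in auto)
  then show ?thesis unfolding smooth_def using d by simp
qed

definition dir_deriv :: "real^'n \<Rightarrow> (real^'n \<Rightarrow> real) \<Rightarrow> real^'n \<Rightarrow> real" where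
  "dir_deriv v \<phi> x = (\<Sum>i\<in>UNIV. v $ i * partial_deriv i \<phi> x)"

lemma test_function_dir_deriv:
  assumes "test_function \<phi>"
  shows "test_function (dir_deriv v \<phi>)"
proof -
  obtain R where R: "\<forall>x. \<phi> x \<noteq> 0 \<longrightarrow> norm x \<le> R" "smooth \<phi>"
    using assms unfolding test_function_iff by blast
  have "\<forall>x. dir_deriv v \<phi> x \<noteq> 0 \<longrightarrow> norm x \<le> R"
  proof (intro allI impI, rule ccontr)
    fix x assume "dir_deriv v \<phi> x \<noteq> 0" "\<not> norm x \<le> R"
    then show False using partial_deriv_eq_0_outside[OF R(1), of x] by (simp add: dir_deriv_def)
  qed
  moreover have "smooth (dir_deriv v \<phi>)"
    unfolding dir_deriv_def[abs_def] by (intro smooth_sum smooth_partial_deriv R(2)) auto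
  ultimately show ?thesis unfolding test_function_iff by blast
qed

lemma test_function_dir_deriv_funpow: "test_function \<phi> \<Longrightarrow> test_function ((dir_deriv v ^^ k) \<phi>)"
  by (induction k) (auto intro: test_function_dir_deriv)

lemma dir_deriv_funpow:
  assumes "smooth \<psi>"
  shows "(dir_deriv v ^^ k) \<psi> = (\<lambda>x. \<Sum>\<alpha> | length \<alpha> = k. (\<Prod>j<k. v $ (\<alpha> ! j)) * iterated_partial \<alpha> \<psi> x)"
proof (induction k)
  case (Suc k)
  show ?case
  proof
    fix x
    have "(dir_deriv v ^^ Suc k) \<psi> x = (\<Sum>i\<in>UNIV. v $ i * iterated_partial [i] (\<lambda>x. \<Sum>\<alpha> | length \<alpha> = k. (\<Prod>j<k. v $ (\<alpha> ! j)) * iterated_partial \<alpha> \<psi> x) x)"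
      by (simp add: Suc dir_deriv_def)
    also have "\<dots> = (\<Sum>i\<in>UNIV. \<Sum>\<alpha> | length \<alpha> = k. v $ i * (\<Prod>j<k. v $ (\<alpha> ! j)) * iterated_partial (i # \<alpha>) \<psi> x)"
      by (subst iterated_partial_sum) (auto simp: smooth_iterated_partial assms sum_distrib_left mult.assoc)
    also have "\<dots> = (\<Sum>\<alpha> | length \<alpha> = Suc k. (\<Prod>j<Suc k. v $ (\<alpha> ! j)) * iterated_partial \<alpha> \<psi> x)"
      by (simp add: lists_length_Suc_sum prod.lessThan_Suc_shift del: prod.lessThan_Suc)
    finally show "(dir_deriv v ^^ Suc k) \<psi> x = \<dots>" .
  qed
qed simp

lemma dir_deriv_translation:
  assumes "smooth \<psi>"
  shows "dir_deriv v (\<lambda>x. \<psi> (x - c)) = (\<lambda>x. dir_deriv v \<psi> (x - c))"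
  using iterated_partial_translation[OF assms, of "[_]"] by (simp add: dir_deriv_def fun_eq_iff)

lemma dir_deriv_funpow_translation:
  assumes "test_function \<psi>"
  shows "(dir_deriv v ^^ k) (\<lambda>x. \<psi> (x - c)) = (\<lambda>x. (dir_deriv v ^^ k) \<psi> (x - c))"
proof (induction k)
  case (Suc k)
  have "smooth ((dir_deriv v ^^ k) \<psi>)"
    using test_function_dir_deriv_funpow[OF assms] unfolding test_function_iff by blast
  from dir_deriv_translation[OF this] show ?case by (simp add: Suc)
qed simp

lemma has_real_derivative_along_line:
  assumes "smooth \<psi>"
  shows "((\<lambda>t. \<psi> (y - t *\<^sub>R v)) has_real_derivative - dir_deriv v \<psi> (y - t *\<^sub>R v)) (at t)"
proof -
  have "((\<lambda>t. y - t *\<^sub>R v) has_derivative (\<lambda>s. - (s *\<^sub>R v))) (at t)"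
    by (auto intro!: derivative_eq_intros)
  from has_derivative_compose[OF this has_derivative_partial[OF smooth_imp_differentiable[OF assms]]]
  have "((\<lambda>t. \<psi> (y - t *\<^sub>R v)) has_derivative (\<lambda>s. s * - dir_deriv v \<psi> (y - t *\<^sub>R v))) (at t)"
    by (simp add: dir_deriv_def sum_distrib_left sum_negf mult.assoc)
  then show ?thesis
    unfolding has_field_derivative_def by (rule has_derivative_eq_rhs) auto
qed

text \<open>All the smoothness sits in \<open>\<psi>\<close>. The difference quotients are bounded by the supremum of the
  directional derivative and vanish off a fixed ball, so dominated convergence applies although
  \<open>f\<close> is only locally integrable.\<close>

lemma integral_translate_has_derivative:
  assumes f: "locally_integrable f" and \<psi>: "test_function \<psi>"
  shows "((\<lambda>t. LINT y|lebesgue. f y * \<psi> (y - t *\<^sub>R v)) has_real_derivative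
    - (LINT y|lebesgue. f y * dir_deriv v \<psi> (y - t *\<^sub>R v))) (at t)"
proof -
  have sm: "smooth \<psi>" using \<psi> unfolding test_function_iff by blast
  obtain R where R: "\<And>x. \<psi> x \<noteq> 0 \<Longrightarrow> norm x \<le> R"
    using \<psi> unfolding test_function_iff by blast
  obtain B where B: "B \<ge> 0" "\<And>x. \<bar>dir_deriv v \<psi> x\<bar> \<le> B"
    using test_function_bounded[OF test_function_dir_deriv[OF \<psi>]] by metis
  have fm [measurable]: "f \<in> borel_measurable lebesgue" by (rule locally_integrable_imp_measurable[OF f])
  have ti: "integrable lebesgue (\<lambda>y. f y * \<psi> (y - c))" for c
    using integrable_mult_test_function[OF f test_function_translation[OF \<psi>]] .
  have ti': "integrable lebesgue (\<lambda>y. f y * dir_deriv v \<psi> (y - c))" for c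
    using integrable_mult_test_function[OF f test_function_translation[OF test_function_dir_deriv[OF \<psi>]]] .
  let ?F = "\<lambda>t. LINT y|lebesgue. f y * \<psi> (y - t *\<^sub>R v)"
  have "((\<lambda>s. (?F s - ?F t) / (s - t)) \<longlongrightarrow> - (LINT y|lebesgue. f y * dir_deriv v \<psi> (y - t *\<^sub>R v))) (at t)"
    unfolding tendsto_at_iff_sequentially
  proof (intro allI impI)
    fix X :: "nat \<Rightarrow> real" assume X: "\<forall>i. X i \<in> UNIV - {t}" "X \<longlonglongrightarrow> t"
    obtain M0 where M0: "\<And>n. \<bar>X n\<bar> \<le> M0"
      using convergent_imp_bounded[OF X(2)] by (auto simp: bounded_iff)
    define M where "M = max M0 \<bar>t\<bar>"
    have M: "\<bar>X n\<bar> \<le> M" "\<bar>t\<bar> \<le> M" for n using M0[of n] by (auto simp: M_def)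
    define R' where "R' = R + M * norm v"
    have supp: "norm y \<le> R'" if "\<psi> (y - s *\<^sub>R v) \<noteq> 0" "\<bar>s\<bar> \<le> M" for y s
    proof -
      have "norm y \<le> norm (y - s *\<^sub>R v) + norm (s *\<^sub>R v)" using norm_triangle_ineq[of "y - s *\<^sub>R v" "s *\<^sub>R v"] by simp
      also have "\<dots> \<le> R + M * norm v" using R[OF that(1)] that(2) by (auto intro!: add_mono mult_right_mono)
      finally show ?thesis by (simp add: R'_def)
    qed
    define q where "q n y = f y * ((\<psi> (y - X n *\<^sub>R v) - \<psi> (y - t *\<^sub>R v)) / (X n - t))" for n y
    have quot: "(?F (X n) - ?F t) / (X n - t) = (LINT y|lebesgue. q n y)" for n
    proof -
      have "?F (X n) - ?F t = (LINT y|lebesgue. f y * \<psi> (y - X n *\<^sub>R v) - f y * \<psi> (y - t *\<^sub>R v))"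
        by (rule Bochner_Integration.integral_diff[symmetric]) (rule ti)+
      then show ?thesis by (simp add: q_def right_diff_distrib flip: Bochner_Integration.integral_divide_zero)
    qed
    have "(\<lambda>n. LINT y|lebesgue. q n y) \<longlonglongrightarrow> (LINT y|lebesgue. f y * - dir_deriv v \<psi> (y - t *\<^sub>R v))"
    proof (rule integral_dominated_convergence[where w="\<lambda>y. B * \<bar>indicator (cball 0 R') y * f y\<bar>"])
      show "(\<lambda>y. f y * - dir_deriv v \<psi> (y - t *\<^sub>R v)) \<in> borel_measurable lebesgue"
        using borel_measurable_integrable[OF ti'[of "t *\<^sub>R v"]] by simp
      show "q n \<in> borel_measurable lebesgue" for n
      proof -
        have "(\<lambda>y. (f y * \<psi> (y - X n *\<^sub>R v) - f y * \<psi> (y - t *\<^sub>R v)) / (X n - t)) \<in> borel_measurable lebesgue"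
          by (intro borel_measurable_divide borel_measurable_diff borel_measurable_integrable ti borel_measurable_const)
        then show ?thesis by (simp add: q_def[abs_def] right_diff_distrib)
      qed
      show "integrable lebesgue (\<lambda>y. B * \<bar>indicator (cball 0 R') y * f y\<bar>)"
        by (intro integrable_mult_right integrable_abs locally_integrable_cball f)
      show "AE y in lebesgue. (\<lambda>n. q n y) \<longlonglongrightarrow> f y * - dir_deriv v \<psi> (y - t *\<^sub>R v)"
      proof (rule AE_I2)
        fix y
        have "((\<lambda>s. (\<psi> (y - s *\<^sub>R v) - \<psi> (y - t *\<^sub>R v)) / (s - t)) \<longlongrightarrow> - dir_deriv v \<psi> (y - t *\<^sub>R v)) (at t)"
          using has_real_derivative_along_line[OF sm, of y v t] by (simp add: has_field_derivative_iff)
        then have "((\<lambda>s. (\<psi> (y - s *\<^sub>R v) - \<psi> (y - t *\<^sub>R v)) / (s - t)) \<circ> X) \<longlonglongrightarrow> - dir_deriv v \<psi> (y - t *\<^sub>R v)"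
          using X unfolding tendsto_at_iff_sequentially by blast
        then show "(\<lambda>n. q n y) \<longlonglongrightarrow> f y * - dir_deriv v \<psi> (y - t *\<^sub>R v)"
          unfolding q_def o_def by (intro tendsto_mult tendsto_const)
      qed
      show "AE y in lebesgue. norm (q n y) \<le> B * \<bar>indicator (cball 0 R') y * f y\<bar>" for n
      proof (rule AE_I2)
        fix y
        have lip: "\<bar>\<psi> (y - X n *\<^sub>R v) - \<psi> (y - t *\<^sub>R v)\<bar> \<le> B * \<bar>X n - t\<bar>"
          using field_differentiable_bound[of UNIV "\<lambda>s. \<psi> (y - s *\<^sub>R v)" "\<lambda>s. - dir_deriv v \<psi> (y - s *\<^sub>R v)" B "X n" t]
            has_real_derivative_along_line[OF sm] B(2) by simp
        show "norm (q n y) \<le> B * \<bar>indicator (cball 0 R') y * f y\<bar>"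
        proof (cases "y \<in> cball 0 R'")
          case True
          have "\<bar>(\<psi> (y - X n *\<^sub>R v) - \<psi> (y - t *\<^sub>R v)) / (X n - t)\<bar> \<le> B"
            using lip X(1) by (simp add: abs_divide divide_le_eq)
          then have "\<bar>f y\<bar> * \<bar>(\<psi> (y - X n *\<^sub>R v) - \<psi> (y - t *\<^sub>R v)) / (X n - t)\<bar> \<le> \<bar>f y\<bar> * B"
            by (intro mult_left_mono) auto
          then show ?thesis using True by (simp add: q_def abs_mult mult.commute)
        next
          case False
          then have "\<psi> (y - X n *\<^sub>R v) = 0" "\<psi> (y - t *\<^sub>R v) = 0"
            using supp M by (auto simp: mem_cball_0 simp del: mem_cball)
          then show ?thesis using B by (simp add: q_def)
        qed
      qed
    qed
    then show "((\<lambda>s. (?F s - ?F t) / (s - t)) \<circ> X) \<longlonglongrightarrow> - (LINT y|lebesgue. f y * dir_deriv v \<psi> (y - t *\<^sub>R v))"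
      by (simp add: o_def quot)
  qed
  then show ?thesis by (simp add: has_field_derivative_iff)
qed

text \<open>Up to signs \<open>u j\<close> is the \<open>j\<close>-th derivative of \<open>u 0\<close>. As the \<open>k\<close>-th derivative vanishes, Taylor's
  formula shows that \<open>u 0\<close> is a polynomial, and a polynomial with limit \<open>0\<close> along the natural
  numbers is \<open>0\<close>.\<close>

lemma vanishing_if_polynomial_and_decaying:
  fixes u :: "nat \<Rightarrow> real \<Rightarrow> real"
  assumes deriv: "\<And>j t. (u j has_real_derivative - u (Suc j) t) (at t)"
    and zero: "\<And>t. u k t = 0" and lim: "(\<lambda>n. u 0 (real n)) \<longlonglongrightarrow> 0"
  shows "u 0 t = 0"
proof -
  \<comment> \<open>the signs turn \<open>w (Suc j)\<close> into the derivative of \<open>w j\<close>\<close>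
  define w where "w j t = (-1) ^ j * u j t" for j t
  have w: "DERIV (w j) t :> w (Suc j) t" for j t
    unfolding w_def using DERIV_cmult[OF deriv, of "(-1) ^ j" j t] by simp
  define q where "q = (\<Sum>m<k. monom (w m 0 / fact m) m)"
  have u0: "u 0 t = poly q t" for t
  proof -
    obtain \<xi> where "w 0 t = (\<Sum>m<k. (w m 0 / fact m) * t ^ m) + (w k \<xi> / fact k) * t ^ k"
      using Maclaurin_all_le[of w "w 0" t k] w by auto
    then show ?thesis by (simp add: w_def zero q_def poly_sum poly_monom)
  qed
  have "q = 0"
  proof (cases "degree q = 0")
    case True
    then obtain c where c: "q = [:c:]" by (rule degree_eq_zeroE)
    then have "(\<lambda>n::nat. c) \<longlonglongrightarrow> 0" using lim by (simp add: u0)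
    then show ?thesis using c by (simp add: LIMSEQ_const_iff)
  next
    case False
    have "filterlim (\<lambda>n. poly q (real n)) at_infinity sequentially"
      using False by (intro filterlim_compose[OF filterlim_poly_at_infinity]
        filterlim_mono[OF filterlim_real_sequentially at_top_le_at_infinity order_refl]) auto
    then show ?thesis using lim not_tendsto_and_filterlim_at_infinity[of sequentially] by (auto simp: u0)
  qed
  then show ?thesis by (simp add: u0)
qed

text \<open>Does the work of the Hoelder inequality without a conjugate exponent, so that \<open>p = 1\<close> is no
  special case: values up to \<open>e\<close> are absorbed
  by the first term, and larger ones are at most \<open>(\<bar>z\<bar> / e)\<close> to the power \<open>p - 1\<close> times themselves.\<close>

lemma abs_le_add_powr:
  fixes z e p :: real
  assumes "e > 0" "p \<ge> 1"
  shows "\<bar>z\<bar> \<le> e + e powr (1 - p) * \<bar>z\<bar> powr p"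
proof (cases "\<bar>z\<bar> \<le> e")
  case True
  then show ?thesis by (smt (verit) mult_nonneg_nonneg powr_ge_zero)
next
  case False
  have "\<bar>z\<bar> = \<bar>z\<bar> powr (1 - p) * \<bar>z\<bar> powr p"
    using False assms by (simp flip: powr_add)
  also have "\<dots> \<le> e powr (1 - p) * \<bar>z\<bar> powr p"
    using False assms by (intro mult_right_mono powr_mono2') auto
  finally show ?thesis using assms by simp
qed

text \<open>The support of the translated test function leaves every ball. On it \<open>\<bar>g\<bar>\<close> is split into a part
  bounded by \<open>e\<close>, living on a ball of fixed volume, and a multiple of \<open>\<bar>g\<bar>\<close> to the power \<open>p\<close>, whose
  integral far away is small.\<close>

lemma integral_translate_tendsto_0:
  fixes g :: "real^'n \<Rightarrow> real"
  assumes g: "locally_integrable g" and p: "p \<ge> 1"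
    and fin: "(\<integral>\<^sup>+x. ennreal (\<bar>g x\<bar> powr p) \<partial>lebesgue) < \<infinity>"
    and \<phi>: "test_function \<phi>" and v: "v \<noteq> 0"
  shows "(\<lambda>n. LINT y|lebesgue. g y * \<phi> (y - real n *\<^sub>R v)) \<longlonglongrightarrow> 0"
proof -
  obtain B R0 where B: "B \<ge> 0" "\<And>x. \<bar>\<phi> x\<bar> \<le> B" and R0: "\<And>x. \<phi> x \<noteq> 0 \<Longrightarrow> norm x \<le> R0"
    using test_function_bounded[OF \<phi>] by metis
  define R where "R = max R0 0"
  have R: "R \<ge> 0" "\<And>x. \<phi> x \<noteq> 0 \<Longrightarrow> norm x \<le> R"
    unfolding R_def using R0 by (auto intro: order_trans[OF _ max.cobounded1])
  have gm [measurable]: "g \<in> borel_measurable lebesgue" by (rule locally_integrable_imp_measurable[OF g])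
  define V where "V = measure lebesgue (cball (0::real^'n) R)"
  define tail where "tail r = (\<integral>\<^sup>+x. ennreal (\<bar>g x\<bar> powr p) * indicator (- cball 0 r) x \<partial>lebesgue)" for r
  have tail_lim: "(\<lambda>n. tail (real n)) \<longlonglongrightarrow> 0"
    unfolding tail_def by (rule nn_integral_outside_cball_tendsto_0[OF _ fin]) measurable
  have gi: "integrable lebesgue (\<lambda>y. g y * \<phi> (y - c))" for c
    by (rule integrable_mult_test_function[OF g test_function_translation[OF \<phi>]])
  have main: "ennreal \<bar>LINT y|lebesgue. g y * \<phi> (y - c)\<bar>
      \<le> ennreal B * (ennreal (e * V) + ennreal (e powr (1 - p)) * tail r)"
    if e: "e > 0" and c: "norm c > R + r" for e c r
  proof -
    have "ennreal \<bar>LINT y|lebesgue. g y * \<phi> (y - c)\<bar> \<le> (\<integral>\<^sup>+y. ennreal (norm (g y * \<phi> (y - c))) \<partial>lebesgue)"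
      using integral_norm_bound_ennreal[OF gi[of c]] by simp
    also have "\<dots> \<le> (\<integral>\<^sup>+y. ennreal B * (ennreal e * indicator (cball c R) y + ennreal (e powr (1 - p)) * (ennreal (\<bar>g y\<bar> powr p) * indicator (- cball 0 r) y)) \<partial>lebesgue)"
    proof (rule nn_integral_mono)
      fix y
      show "ennreal (norm (g y * \<phi> (y - c))) \<le> ennreal B * (ennreal e * indicator (cball c R) y + ennreal (e powr (1 - p)) * (ennreal (\<bar>g y\<bar> powr p) * indicator (- cball 0 r) y))"
      proof (cases "\<phi> (y - c) = 0")
        case False
        have yc: "norm (y - c) \<le> R" using R(2) False by blast
        then have in1: "y \<in> cball c R" by (simp add: dist_norm norm_minus_commute)
        have "norm c \<le> norm (y - c) + norm y"
          using norm_triangle_ineq4[of y "y - c"] by simp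
        then have in2: "y \<notin> cball 0 r" using yc c by (simp add: mem_cball_0 del: mem_cball)
        have "norm (g y * \<phi> (y - c)) \<le> (e + e powr (1 - p) * \<bar>g y\<bar> powr p) * B"
          unfolding real_norm_def abs_mult
          using abs_le_add_powr[OF e p, of "g y"] B(2)[of "y - c"] e by (intro mult_mono) auto
        also have "\<dots> = B * (e + e powr (1 - p) * \<bar>g y\<bar> powr p)" by simp
        finally have "ennreal (norm (g y * \<phi> (y - c))) \<le> ennreal (B * (e + e powr (1 - p) * \<bar>g y\<bar> powr p))"
          by (rule ennreal_leI)
        also have "\<dots> = ennreal B * (ennreal e + ennreal (e powr (1 - p)) * ennreal (\<bar>g y\<bar> powr p))"
          using e B(1) by (simp add: ennreal_mult)
        finally show ?thesis using in1 in2 by simp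
      qed simp
    qed
    also have "\<dots> = ennreal B * ((\<integral>\<^sup>+y. ennreal e * indicator (cball c R) y \<partial>lebesgue) + ennreal (e powr (1 - p)) * tail r)"
    proof -
      have [measurable]: "cball c R \<in> sets lebesgue" "cball 0 r \<in> sets lebesgue" for c :: "real^'n" by auto
      have m2: "(\<lambda>y. ennreal (\<bar>g y\<bar> powr p) * indicator (- cball 0 r) y) \<in> borel_measurable lebesgue"
        by (intro borel_measurable_times_ennreal borel_measurable_indicator) auto
      have m1: "(\<lambda>y. ennreal e * indicator (cball c R) y) \<in> borel_measurable lebesgue"
        by (intro borel_measurable_times_ennreal borel_measurable_indicator) auto
      show ?thesis unfolding tail_def
        using m1 m2 by (simp add: nn_integral_cmult nn_integral_add borel_measurable_times_ennreal)
    qed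
    also have "(\<integral>\<^sup>+y. ennreal e * indicator (cball c R) y \<partial>lebesgue) = ennreal e * emeasure lebesgue (cball c R)"
      by (rule nn_integral_cmult_indicator) simp
    also have "\<dots> = ennreal (e * V)"
    proof -
      have "emeasure lebesgue (cball c R) = emeasure lebesgue (cball (0::real^'n) R)"
        using R(1) by (simp add: emeasure_cball)
      then show ?thesis
        using e by (simp add: V_def emeasure_eq_measure2 ennreal_mult)
    qed
    finally show ?thesis .
  qed
  have V0: "V \<ge> 0" by (simp add: V_def)
  show ?thesis
  proof (rule LIMSEQ_I)
    fix d :: real assume d: "d > 0"
    \<comment> \<open>\<open>e\<close> and \<open>\<eta>\<close> each account for half of \<open>d\<close>; the summands \<open>1\<close> keep the denominators positive\<close>
    define e where "e = d / (2 * (B * V + 1))"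
    have BV: "B * V + 1 > 0" using B(1) V0 by (intro add_nonneg_pos mult_nonneg_nonneg) auto
    have e0: "e > 0" using d BV by (simp add: e_def)
    define \<eta> where "\<eta> = d / (2 * (B * e powr (1 - p) + 1))"
    have Be: "B * e powr (1 - p) + 1 > 0" using B(1) by (intro add_nonneg_pos mult_nonneg_nonneg) auto
    have \<eta>0: "\<eta> > 0" using d Be by (simp add: \<eta>_def)
    have "eventually (\<lambda>n. tail (real n) < ennreal \<eta>) sequentially"
      using \<eta>0 by (intro order_tendstoD(2)[OF tail_lim]) auto
    then obtain m where m: "tail (real m) < ennreal \<eta>" by (auto simp: eventually_sequentially)
    obtain n0 where n0: "R + real m < real n0 * norm v"
      using reals_Archimedean3[of "norm v"] v by auto
    show "\<exists>n0. \<forall>n\<ge>n0. norm ((LINT y|lebesgue. g y * \<phi> (y - real n *\<^sub>R v)) - 0) < d"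
    proof (intro exI[of _ n0] allI impI)
      fix n assume "n \<ge> n0"
      then have "R + real m < norm (real n *\<^sub>R v)"
        using n0 mult_right_mono[of "real n0" "real n" "norm v"] by simp
      from main[OF e0 this]
      have "ennreal \<bar>LINT y|lebesgue. g y * \<phi> (y - real n *\<^sub>R v)\<bar>
          \<le> ennreal B * (ennreal (e * V) + ennreal (e powr (1 - p)) * tail (real m))" .
      also have "\<dots> \<le> ennreal B * (ennreal (e * V) + ennreal (e powr (1 - p)) * ennreal \<eta>)"
        using m by (intro mult_left_mono add_left_mono) auto
      also have "\<dots> = ennreal (B * V * e + B * e powr (1 - p) * \<eta>)"
        using B(1) V0 e0 \<eta>0 by (simp add: ennreal_mult[symmetric] ennreal_plus[symmetric] algebra_simps del: ennreal_plus)
      finally have "\<bar>LINT y|lebesgue. g y * \<phi> (y - real n *\<^sub>R v)\<bar> \<le> B * V * e + B * e powr (1 - p) * \<eta>"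
        using B(1) V0 e0 \<eta>0 by (subst (asm) ennreal_le_iff) auto
      also have "\<dots> < (B * V + 1) * e + (B * e powr (1 - p) + 1) * \<eta>"
        using e0 \<eta>0 by (simp add: algebra_simps)
      also have "\<dots> = d"
      proof -
        have half: "q * (d / (2 * q)) = d / 2" if "q > 0" for q :: real using that by simp
        have "(B * V + 1) * e = d / 2" unfolding e_def by (rule half[OF BV])
        moreover have "(B * e powr (1 - p) + 1) * \<eta> = d / 2" unfolding \<eta>_def by (rule half[OF Be])
        ultimately show ?thesis by linarith
      qed
      finally show "norm ((LINT y|lebesgue. g y * \<phi> (y - real n *\<^sub>R v)) - 0) < d" by simp
    qed
  qed
qed

section \<open>Weak derivatives under linear substitutions\<close>

lemma locally_integrable_sum:
  fixes g :: "'i \<Rightarrow> real^'n \<Rightarrow> real"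
  assumes "finite I" "\<And>i. i \<in> I \<Longrightarrow> locally_integrable (g i)"
  shows "locally_integrable (\<lambda>x. \<Sum>i\<in>I. c i * g i x)"
  unfolding locally_integrable_def
proof (intro allI impI)
  fix K :: "(real^'n) set" assume K: "compact K"
  have "integrable lebesgue (\<lambda>x. \<Sum>i\<in>I. c i * (indicator K x * g i x))"
    by (intro Bochner_Integration.integrable_sum integrable_mult_right)
      (use assms(2) K in \<open>auto simp: locally_integrable_def set_integrable_def\<close>)
  moreover have "indicator K x *\<^sub>R (\<Sum>i\<in>I. c i * g i x) = (\<Sum>i\<in>I. c i * (indicator K x * g i x))" for x
    by (simp add: sum_distrib_left mult_ac)
  ultimately show "(\<lambda>x. \<Sum>i\<in>I. c i * g i x) absolutely_integrable_on K"
    by (simp add: set_integrable_def)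
qed

lemma integral_lebesgue_linear:
  fixes F :: "real^'n \<Rightarrow> real"
  assumes "T \<in> SL" "F \<in> borel_measurable lebesgue"
  shows "(LINT x|lebesgue. F (T *v x)) = (LINT x|lebesgue. F x)"
  using integral_distr[OF lebesgue_measurable_linear[OF assms(1)] assms(2)] distr_lebesgue_linear[OF assms(1)]
  by simp

lemma locally_integrable_linear:
  fixes f :: "real^'n \<Rightarrow> real"
  assumes f: "locally_integrable f" and T: "T \<in> SL"
  shows "locally_integrable (\<lambda>x. f (T *v x))"
  unfolding locally_integrable_def
proof (intro allI impI)
  fix K :: "(real^'n) set" assume K: "compact K"
  let ?F = "\<lambda>x. indicator ((*v) T ` K) x *\<^sub>R f x"
  have "compact ((*v) T ` K)"
    by (intro compact_continuous_image linear_continuous_on matrix_vector_mul_bounded_linear K)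
  then have F: "integrable lebesgue ?F"
    using f unfolding locally_integrable_def set_integrable_def by blast
  then have "integrable (distr lebesgue lebesgue ((*v) T)) ?F"
    unfolding distr_lebesgue_linear[OF T] .
  then have "integrable lebesgue (\<lambda>x. ?F (T *v x))"
    by (subst (asm) integrable_distr_eq) (use lebesgue_measurable_linear[OF T] F in auto)
  moreover have "indicator ((*v) T ` K) (T *v x) = (indicator K x :: real)" for x
    using SL_matrix_inv(2)[OF T] by (auto simp: indicator_def image_iff) metis
  ultimately show "(\<lambda>x. f (T *v x)) absolutely_integrable_on K"
    by (simp add: set_integrable_def)
qed

lemma has_weak_deriv_unique:
  assumes "has_weak_deriv f \<alpha> g" "has_weak_deriv f \<alpha> g'"
  shows "AE x in lebesgue. g x = g' x"
proof -
  have l: "locally_integrable g" "locally_integrable g'" using assms by (auto simp: has_weak_deriv_def)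
  have "locally_integrable (\<lambda>x. \<Sum>b\<in>UNIV. (if b then 1 else - 1) * (if b then g else g') x)"
    by (rule locally_integrable_sum) (use l in auto)
  then have ld: "locally_integrable (\<lambda>x. g x - g' x)" by (simp add: UNIV_bool)
  have "AE x in lebesgue. g x - g' x = 0"
  proof (rule AE_zero_of_test_functions[OF ld])
    fix \<phi> :: "real^'a \<Rightarrow> real" assume \<phi>: "test_function \<phi>"
    have "(LINT x|lebesgue. (g x - g' x) * \<phi> x) = (LINT x|lebesgue. g x * \<phi> x) - (LINT x|lebesgue. g' x * \<phi> x)"
      unfolding left_diff_distrib
      by (intro Bochner_Integration.integral_diff integrable_mult_test_function l \<phi>)
    also have "\<dots> = 0"
    proof -
      have "(-1) ^ length \<alpha> * (LINT x|lebesgue. g x * \<phi> x) = (-1) ^ length \<alpha> * (LINT x|lebesgue. g' x * \<phi> x)"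
        using assms \<phi> by (simp add: has_weak_deriv_def)
      then show ?thesis by simp
    qed
    finally show "(LINT x|lebesgue. (g x - g' x) * \<phi> x) = 0" .
  qed
  then show ?thesis by eventually_elim simp
qed

lemma has_weak_deriv_weak_deriv:
  assumes "f \<in> sobolev_loc k" "length \<alpha> \<le> k"
  shows "has_weak_deriv f \<alpha> (weak_deriv \<alpha> f)"
proof -
  have "\<exists>g. has_weak_deriv f \<alpha> g" using assms by (simp add: sobolev_loc_def)
  then show ?thesis unfolding weak_deriv_def by (rule someI_ex)
qed

text \<open>Every test function is \<open>\<psi> \<circ> T\<close> with a test function \<open>\<psi>\<close>. The chain rule for \<open>\<psi> \<circ> T\<close> and the
  substitution \<open>x \<mapsto> T *v x\<close>, which preserves the measure, transfer the defining identity of the weak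
  derivatives of \<open>f\<close>.\<close>

lemma has_weak_deriv_linear:
  fixes f :: "real^'n \<Rightarrow> real"
  assumes f: "f \<in> sobolev_loc k" and k: "length \<alpha> \<le> k" and T: "T \<in> SL"
  shows "has_weak_deriv (f \<circ> (*v) T) \<alpha> (\<lambda>x. \<Sum>\<beta> | length \<beta> = length \<alpha>.
    (\<Prod>j<length \<alpha>. T $ (\<beta> ! j) $ (\<alpha> ! j)) * weak_deriv \<beta> f (T *v x))"
proof -
  let ?c = "\<lambda>\<beta>. \<Prod>j<length \<alpha>. T $ (\<beta> ! j) $ (\<alpha> ! j)"
  let ?L = "{\<beta>::'n list. length \<beta> = length \<alpha>}"
  have fl: "locally_integrable f" using f by (simp add: sobolev_loc_def)
  have wd: "has_weak_deriv f \<beta> (weak_deriv \<beta> f)" if "\<beta> \<in> ?L" for \<beta>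
    using that k by (intro has_weak_deriv_weak_deriv[OF f]) auto
  then have gl: "locally_integrable (weak_deriv \<beta> f)" if "\<beta> \<in> ?L" for \<beta>
    using that by (simp add: has_weak_deriv_def)
  show ?thesis
    unfolding has_weak_deriv_def
  proof (intro conjI allI impI)
    show "locally_integrable (\<lambda>x. \<Sum>\<beta>\<in>?L. ?c \<beta> * weak_deriv \<beta> f (T *v x))"
      by (intro locally_integrable_sum locally_integrable_linear gl T) auto
    fix \<phi> :: "real^'n \<Rightarrow> real" assume \<phi>: "test_function \<phi>"
    define \<psi> where "\<psi> = \<phi> \<circ> (*v) (matrix_inv T)"
    have \<psi>: "test_function \<psi>" unfolding \<psi>_def by (intro test_function_linear_comp \<phi> SL_matrix_inv(1) T)
    have sm: "smooth \<psi>" using \<psi> unfolding test_function_iff by blast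
    have \<phi>\<psi>: "\<phi> x = \<psi> (T *v x)" for x by (simp add: \<psi>_def SL_matrix_inv(2)[OF T])
    have i\<phi>: "iterated_partial \<alpha> \<phi> x = (\<Sum>\<beta>\<in>?L. ?c \<beta> * iterated_partial \<beta> \<psi> (T *v x))" for x
    proof -
      have "\<phi> = (\<lambda>x. \<psi> (T *v x + 0))" using \<phi>\<psi> by auto
      then show ?thesis using iterated_partial_affine_comp[OF sm, of \<alpha> T 0] by simp
    qed
    have int1: "integrable lebesgue (\<lambda>x. f x * iterated_partial \<beta> \<psi> x)" for \<beta>
      by (intro integrable_mult_test_function fl test_function_iterated_partial \<psi>)
    have int2: "integrable lebesgue (\<lambda>x. weak_deriv \<beta> f x * \<psi> x)" if "\<beta> \<in> ?L" for \<beta>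
      by (intro integrable_mult_test_function gl that \<psi>)
    have int3: "integrable lebesgue (\<lambda>x. \<Sum>\<beta>\<in>?L. ?c \<beta> * (f x * iterated_partial \<beta> \<psi> x))"
      by (intro Bochner_Integration.integrable_sum integrable_mult_right int1)
    have int4: "integrable lebesgue (\<lambda>x. \<Sum>\<beta>\<in>?L. ?c \<beta> * (weak_deriv \<beta> f x * \<psi> x))"
      by (intro Bochner_Integration.integrable_sum integrable_mult_right int2)
    have "(LINT x|lebesgue. (f \<circ> (*v) T) x * iterated_partial \<alpha> \<phi> x)
        = (LINT x|lebesgue. (\<Sum>\<beta>\<in>?L. ?c \<beta> * (f (T *v x) * iterated_partial \<beta> \<psi> (T *v x))))"
      unfolding i\<phi> by (simp add: sum_distrib_left mult_ac)
    also have "\<dots> = (LINT x|lebesgue. (\<Sum>\<beta>\<in>?L. ?c \<beta> * (f x * iterated_partial \<beta> \<psi> x)))"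
      by (rule integral_lebesgue_linear[OF T borel_measurable_integrable[OF int3]])
    also have "\<dots> = (\<Sum>\<beta>\<in>?L. ?c \<beta> * (LINT x|lebesgue. f x * iterated_partial \<beta> \<psi> x))"
      by (subst Bochner_Integration.integral_sum) (auto intro!: int1)
    also have "\<dots> = (\<Sum>\<beta>\<in>?L. ?c \<beta> * ((-1) ^ length \<alpha> * (LINT x|lebesgue. weak_deriv \<beta> f x * \<psi> x)))"
      using wd \<psi> by (intro sum.cong refl) (auto simp: has_weak_deriv_def)
    also have "\<dots> = (-1) ^ length \<alpha> * (\<Sum>\<beta>\<in>?L. ?c \<beta> * (LINT x|lebesgue. weak_deriv \<beta> f x * \<psi> x))"
      by (simp add: sum_distrib_left mult_ac)
    also have "(\<Sum>\<beta>\<in>?L. ?c \<beta> * (LINT x|lebesgue. weak_deriv \<beta> f x * \<psi> x))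
        = (LINT x|lebesgue. (\<Sum>\<beta>\<in>?L. ?c \<beta> * (weak_deriv \<beta> f x * \<psi> x)))"
      by (subst Bochner_Integration.integral_sum) (auto intro!: int2)
    also have "\<dots> = (LINT x|lebesgue. (\<Sum>\<beta>\<in>?L. ?c \<beta> * (weak_deriv \<beta> f (T *v x) * \<psi> (T *v x))))"
      by (rule integral_lebesgue_linear[OF T borel_measurable_integrable[OF int4], symmetric])
    also have "\<dots> = (LINT x|lebesgue. (\<Sum>\<beta>\<in>?L. ?c \<beta> * weak_deriv \<beta> f (T *v x)) * \<phi> x)"
      by (simp add: \<phi>\<psi> sum_distrib_right mult.assoc)
    finally show "(LINT x|lebesgue. (f \<circ> (*v) T) x * iterated_partial \<alpha> \<phi> x)
      = (-1) ^ length \<alpha> * (LINT x|lebesgue. (\<Sum>\<beta>\<in>?L. ?c \<beta> * weak_deriv \<beta> f (T *v x)) * \<phi> x)" .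
  qed
qed

lemma sobolev_loc_linear:
  assumes "f \<in> sobolev_loc k" "T \<in> SL"
  shows "f \<circ> (*v) T \<in> sobolev_loc k"
  using assms locally_integrable_linear[of f T] has_weak_deriv_linear[OF assms(1) _ assms(2)]
  unfolding sobolev_loc_def by (fastforce simp: o_def)

lemma weak_deriv_linear:
  fixes f :: "real^'n \<Rightarrow> real"
  assumes f: "f \<in> sobolev_loc k" and T: "T \<in> SL"
  shows "AE x in lebesgue. \<forall>\<alpha>. length \<alpha> = k \<longrightarrow> weak_deriv \<alpha> (f \<circ> (*v) T) x =
    (\<Sum>\<beta> | length \<beta> = k. (\<Prod>j<k. T $ (\<beta> ! j) $ (\<alpha> ! j)) * weak_deriv \<beta> f (T *v x))"
proof -
  have "AE x in lebesgue. \<forall>\<alpha>\<in>{\<alpha>. length \<alpha> = k}. weak_deriv \<alpha> (f \<circ> (*v) T) x =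
    (\<Sum>\<beta> | length \<beta> = k. (\<Prod>j<k. T $ (\<beta> ! j) $ (\<alpha> ! j)) * weak_deriv \<beta> f (T *v x))"
  proof (rule AE_ball_countable')
    fix \<alpha> :: "'n list" assume "\<alpha> \<in> {\<alpha>. length \<alpha> = k}"
    then have \<alpha>: "length \<alpha> = k" by simp
    show "AE x in lebesgue. weak_deriv \<alpha> (f \<circ> (*v) T) x =
      (\<Sum>\<beta> | length \<beta> = k. (\<Prod>j<k. T $ (\<beta> ! j) $ (\<alpha> ! j)) * weak_deriv \<beta> f (T *v x))"
      using has_weak_deriv_unique[OF has_weak_deriv_weak_deriv[OF sobolev_loc_linear[OF f T], of \<alpha>]
          has_weak_deriv_linear[OF f, of \<alpha> T]] \<alpha> T by simp
  qed (auto intro: countable_finite)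
  then show ?thesis by eventually_elim simp
qed

section \<open>The norm of the pulled back derivative form\<close>

definition multilinear :: "nat \<Rightarrow> ('n list \<Rightarrow> real) \<Rightarrow> (real^'n) list \<Rightarrow> real" where
  "multilinear k w vs = (\<Sum>\<alpha> | length \<alpha> = k. w \<alpha> * (\<Prod>j<k. (vs ! j) $ (\<alpha> ! j)))"

lemma weak_derivative_form_eq: "weak_derivative_form k f x = multilinear k (\<lambda>\<alpha>. weak_deriv \<alpha> f x)"
  by (simp add: weak_derivative_form_def multilinear_def fun_eq_iff)

lemma prod_sum_lists:
  fixes F :: "nat \<Rightarrow> 'n::finite \<Rightarrow> real"
  shows "(\<Prod>j<k. \<Sum>l\<in>UNIV. F j l) = (\<Sum>\<alpha> | length \<alpha> = k. \<Prod>j<k. F j (\<alpha> ! j))"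
proof (induction k arbitrary: F)
  case (Suc k)
  have "(\<Prod>j<Suc k. \<Sum>l\<in>UNIV. F j l) = (\<Sum>l\<in>UNIV. F 0 l) * (\<Prod>j<k. \<Sum>l\<in>UNIV. F (Suc j) l)"
    by (rule prod.lessThan_Suc_shift)
  also have "\<dots> = (\<Sum>l\<in>UNIV. \<Sum>\<alpha> | length \<alpha> = k. F 0 l * (\<Prod>j<k. F (Suc j) (\<alpha> ! j)))"
    by (simp add: Suc[of "\<lambda>j. F (Suc j)"] sum_product)
  also have "\<dots> = (\<Sum>\<alpha> | length \<alpha> = Suc k. \<Prod>j<Suc k. F j (\<alpha> ! j))"
    by (simp add: lists_length_Suc_sum prod.lessThan_Suc_shift del: prod.lessThan_Suc)
  finally show ?case .
qed simp

text \<open>Distributing the product of the sums \<open>T *v (vs ! j)\<close> over all words matches the transformation rule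
  of the coefficients with the substitution in the arguments.\<close>

lemma multilinear_linear:
  fixes w :: "'n::finite list \<Rightarrow> real"
  assumes "\<And>\<alpha>. length \<alpha> = k \<Longrightarrow> w' \<alpha> = (\<Sum>\<beta> | length \<beta> = k. (\<Prod>j<k. T $ (\<beta> ! j) $ (\<alpha> ! j)) * w \<beta>)"
    and "length vs = k"
  shows "multilinear k w' vs = multilinear k w (map ((*v) T) vs)"
proof -
  have "multilinear k w' vs = (\<Sum>\<alpha> | length \<alpha> = k. \<Sum>\<beta> | length \<beta> = k. w \<beta> * (\<Prod>j<k. T $ (\<beta> ! j) $ (\<alpha> ! j) * (vs ! j) $ (\<alpha> ! j)))"
    unfolding multilinear_def
    by (intro sum.cong refl)
      (simp add: assms(1) sum_distrib_right prod.distrib, intro sum.cong refl, simp only: mult_ac)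
  also have "\<dots> = (\<Sum>\<beta> | length \<beta> = k. w \<beta> * (\<Sum>\<alpha> | length \<alpha> = k. (\<Prod>j<k. T $ (\<beta> ! j) $ (\<alpha> ! j) * (vs ! j) $ (\<alpha> ! j))))"
    by (subst sum.swap) (simp add: sum_distrib_left)
  also have "\<dots> = multilinear k w (map ((*v) T) vs)"
    unfolding multilinear_def
  proof (intro sum.cong refl arg_cong2[where f="(*)"])
    fix \<beta> :: "'n list"
    show "(\<Sum>\<alpha> | length \<alpha> = k. \<Prod>j<k. T $ (\<beta> ! j) $ (\<alpha> ! j) * (vs ! j) $ (\<alpha> ! j)) = (\<Prod>j<k. (map ((*v) T) vs ! j) $ (\<beta> ! j))"
      using prod_sum_lists[of "\<lambda>j l. T $ (\<beta> ! j) $ l * (vs ! j) $ l" k] assms(2)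
      by (simp add: matrix_vector_mult_def)
  qed
  finally show ?thesis .
qed

text \<open>The norm of the pullback under \<open>A\<close> of the form with coefficients \<open>w\<close>. It is considered for all
  matrices and not only on \<open>SL\<close>, since the limit directions of an unbounded sequence in \<open>SL\<close> are
  singular.\<close>

definition pullback_norm :: "nat \<Rightarrow> ('n list \<Rightarrow> real) \<Rightarrow> real^'n^'n \<Rightarrow> real" where
  "pullback_norm k w A = form_norm k (\<lambda>vs. multilinear k w (map ((*v) A) vs))"

abbreviation unit_lists :: "nat \<Rightarrow> (real^'n) list set" where
  "unit_lists k \<equiv> {vs. length vs = k \<and> (\<forall>v \<in> set vs. norm v \<le> 1)}"

lemma pullback_norm_bdd:
  fixes w :: "'n::finite list \<Rightarrow> real"
  shows "bdd_above ((\<lambda>vs. \<bar>multilinear k w (map ((*v) A) vs)\<bar>) ` unit_lists k)"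
proof -
  obtain K where K: "\<And>x. norm (A *v x) \<le> norm x * K" "K \<ge> 0"
    using bounded_linear.nonneg_bounded[OF matrix_vector_mul_bounded_linear[of A]] by blast
  have "\<bar>multilinear k w (map ((*v) A) vs)\<bar> \<le> (\<Sum>\<alpha> | length \<alpha> = k. \<bar>w \<alpha>\<bar> * K ^ k)" if "vs \<in> unit_lists k" for vs
  proof -
    have "\<bar>(A *v (vs ! j)) $ i\<bar> \<le> K" if "j < k" for i j
    proof -
      have "norm (vs ! j) \<le> 1" using \<open>vs \<in> unit_lists k\<close> that by auto
      then have "norm (vs ! j) * K \<le> 1 * K" using K(2) by (rule mult_right_mono)
      then show ?thesis using component_le_norm_cart[of "A *v (vs ! j)" i] K(1)[of "vs ! j"] by linarith
    qed
    then have "(\<Prod>j<k. \<bar>(A *v (vs ! j)) $ (\<alpha> ! j)\<bar>) \<le> (\<Prod>j<k. K)" for \<alpha>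
      by (intro prod_mono) auto
    then have "\<bar>w \<alpha> * (\<Prod>j<k. (map ((*v) A) vs ! j) $ (\<alpha> ! j))\<bar> \<le> \<bar>w \<alpha>\<bar> * K ^ k" for \<alpha>
      unfolding abs_mult abs_prod using \<open>vs \<in> unit_lists k\<close> by (intro mult_left_mono) auto
    then show ?thesis unfolding multilinear_def
      by (intro order_trans[OF sum_abs sum_mono])
  qed
  then show ?thesis by (rule bdd_aboveI2)
qed

lemma pullback_norm_ge:
  "vs \<in> unit_lists k \<Longrightarrow> \<bar>multilinear k w (map ((*v) A) vs)\<bar> \<le> pullback_norm k w A"
  unfolding pullback_norm_def form_norm_def using pullback_norm_bdd by (rule cSUP_upper2[OF _ _ order_refl])

lemma unit_lists_nonempty: "replicate k 0 \<in> unit_lists k"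
  by simp

lemma pullback_norm_nonneg: "0 \<le> pullback_norm k w A"
  using pullback_norm_ge[OF unit_lists_nonempty] abs_ge_zero order_trans by blast

lemma pullback_norm_le:
  "(\<And>vs. vs \<in> unit_lists k \<Longrightarrow> \<bar>multilinear k w (map ((*v) A) vs)\<bar> \<le> M) \<Longrightarrow> pullback_norm k w A \<le> M"
  unfolding pullback_norm_def form_norm_def
  by (rule cSUP_least) (use unit_lists_nonempty[of k] in blast)+

lemma tendsto_multilinear:
  assumes "\<And>n. length (X n) = k" "length vs = k" "\<And>j. j < k \<Longrightarrow> (\<lambda>n. X n ! j) \<longlonglongrightarrow> vs ! j"
  shows "(\<lambda>n. multilinear k w (X n)) \<longlonglongrightarrow> multilinear k w vs"
  unfolding multilinear_def
  by (intro tendsto_sum tendsto_mult tendsto_const tendsto_prod tendsto_vec_nth assms(3)) auto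

lemma pullback_norm_scale_le:
  assumes "c \<ge> 0"
  shows "pullback_norm k w (c *\<^sub>R A) \<le> c ^ k * pullback_norm k w A"
proof (rule pullback_norm_le)
  fix vs :: "(real^'a) list" assume vs: "vs \<in> unit_lists k"
  have "multilinear k w (map ((*v) (c *\<^sub>R A)) vs) = c ^ k * multilinear k w (map ((*v) A) vs)"
    unfolding multilinear_def sum_distrib_left
  proof (intro sum.cong refl)
    fix \<alpha> :: "'a list"
    have "(\<Prod>j<k. (map ((*v) (c *\<^sub>R A)) vs ! j) $ (\<alpha> ! j)) = (\<Prod>j<k. c * (map ((*v) A) vs ! j) $ (\<alpha> ! j))"
      using vs by (intro prod.cong refl) (simp add: scaleR_matrix_vector_assoc[symmetric])
    then show "w \<alpha> * (\<Prod>j<k. (map ((*v) (c *\<^sub>R A)) vs ! j) $ (\<alpha> ! j))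
        = c ^ k * (w \<alpha> * (\<Prod>j<k. (map ((*v) A) vs ! j) $ (\<alpha> ! j)))"
      by (simp add: prod.distrib mult_ac)
  qed
  then show "\<bar>multilinear k w (map ((*v) (c *\<^sub>R A)) vs)\<bar> \<le> c ^ k * pullback_norm k w A"
    using pullback_norm_ge[OF vs, of w A] assms by (simp add: abs_mult mult_left_mono)
qed

text \<open>For fixed arguments the form depends continuously on the matrix, and a supremum of continuous
  functions is lower semicontinuous.\<close>

lemma pullback_norm_powr_lsc:
  assumes X: "X \<longlonglongrightarrow> A" and p: "p > 0"
  shows "ennreal (pullback_norm k w A powr p) \<le> liminf (\<lambda>n. ennreal (pullback_norm k w (X n) powr p))"
    (is "_ \<le> ?l")
proof (cases ?l)
  case (real l)
  have "pullback_norm k w A \<le> l powr (1 / p)"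
  proof (rule pullback_norm_le)
    fix vs :: "(real^'a) list" assume vs: "vs \<in> unit_lists k"
    have "(\<lambda>n. multilinear k w (map ((*v) (X n)) vs)) \<longlonglongrightarrow> multilinear k w (map ((*v) A) vs)"
      using vs by (intro tendsto_multilinear) (auto intro: tendsto_matrix_vector_mult X)
    then have lim: "(\<lambda>n. ennreal (\<bar>multilinear k w (map ((*v) (X n)) vs)\<bar> powr p)) \<longlonglongrightarrow> ennreal (\<bar>multilinear k w (map ((*v) A) vs)\<bar> powr p)"
      using p by (intro tendsto_ennrealI tendsto_powr' tendsto_rabs tendsto_const) auto
    have "ennreal (\<bar>multilinear k w (map ((*v) A) vs)\<bar> powr p) = liminf (\<lambda>n. ennreal (\<bar>multilinear k w (map ((*v) (X n)) vs)\<bar> powr p))"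
      by (rule lim_imp_Liminf[OF sequentially_bot lim, symmetric])
    also have "\<dots> \<le> ?l"
      using p pullback_norm_ge[OF vs] by (intro Liminf_mono always_eventually allI ennreal_leI powr_mono2) auto
    finally have "\<bar>multilinear k w (map ((*v) A) vs)\<bar> powr p \<le> l"
      using real by simp
    then have "(\<bar>multilinear k w (map ((*v) A) vs)\<bar> powr p) powr (1 / p) \<le> l powr (1 / p)"
      using p by (intro powr_mono2) auto
    then show "\<bar>multilinear k w (map ((*v) A) vs)\<bar> \<le> l powr (1 / p)"
      using p by (simp add: powr_powr)
  qed
  then have "pullback_norm k w A powr p \<le> (l powr (1 / p)) powr p"
    using p pullback_norm_nonneg by (intro powr_mono2) auto
  then show ?thesis using real p by (simp add: powr_powr ennreal_leI)
qed simp

text \<open>The form is continuous in its arguments, so the supremum may be taken over arguments from a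
  countable dense subset of the unit ball.\<close>

lemma pullback_norm_measurable:
  fixes w :: "real^'n \<Rightarrow> 'n list \<Rightarrow> real"
  assumes w: "\<And>\<alpha>. length \<alpha> = k \<Longrightarrow> (\<lambda>x. w x \<alpha>) \<in> borel_measurable M"
  shows "(\<lambda>x. pullback_norm k (w x) A) \<in> borel_measurable M"
proof -
  obtain D :: "(real^'n) set" where D: "countable D" "D \<subseteq> cball 0 1" "cball 0 1 \<subseteq> closure D"
    by (rule separable)
  define V where "V = {vs. length vs = k \<and> set vs \<subseteq> D}"
  have "V \<subseteq> lists D" unfolding V_def by auto
  then have cV: "countable V" using countable_lists[OF D(1)] countable_subset by blast
  have VU: "V \<subseteq> unit_lists k" using D(2) by (auto simp: V_def)
  have "D \<noteq> {}" using D(3) by auto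
  then obtain d where "d \<in> D" by blast
  then have V0: "V \<noteq> {}" unfolding V_def by (auto intro!: exI[of _ "replicate k d"])
  have bdd: "bdd_above ((\<lambda>vs. \<bar>multilinear k u (map ((*v) A) vs)\<bar>) ` V)" for u
    by (rule bdd_above_mono[OF pullback_norm_bdd image_mono[OF VU]])
  have eq: "pullback_norm k u A = (SUP vs\<in>V. \<bar>multilinear k u (map ((*v) A) vs)\<bar>)" for u
  proof (rule antisym)
    show "(SUP vs\<in>V. \<bar>multilinear k u (map ((*v) A) vs)\<bar>) \<le> pullback_norm k u A"
      using V0 VU by (intro cSUP_least pullback_norm_ge) auto
    show "pullback_norm k u A \<le> (SUP vs\<in>V. \<bar>multilinear k u (map ((*v) A) vs)\<bar>)"
    proof (rule pullback_norm_le)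
      fix vs :: "(real^'n) list" assume vs: "vs \<in> unit_lists k"
      have "\<exists>X. (\<forall>n. X n \<in> D) \<and> X \<longlonglongrightarrow> vs ! j" if "j < k" for j
      proof -
        have "vs ! j \<in> cball 0 1" using vs that by auto
        then show ?thesis using D(3) closure_sequential[of "vs ! j" D] by blast
      qed
      then obtain X where X: "\<And>j n. j < k \<Longrightarrow> X j n \<in> D" "\<And>j. j < k \<Longrightarrow> X j \<longlonglongrightarrow> vs ! j"
        by metis
      define Y where "Y n = map (\<lambda>j. X j n) [0..<k]" for n
      have YV: "Y n \<in> V" for n using X(1) by (auto simp: V_def Y_def)
      have "(\<lambda>n. multilinear k u (map ((*v) A) (Y n))) \<longlonglongrightarrow> multilinear k u (map ((*v) A) vs)"
      proof (rule tendsto_multilinear)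
        fix j assume "j < k"
        then have "(\<lambda>n. A *v X j n) \<longlonglongrightarrow> A *v (vs ! j)"
          by (intro bounded_linear.tendsto[OF matrix_vector_mul_bounded_linear] X(2))
        then show "(\<lambda>n. map ((*v) A) (Y n) ! j) \<longlonglongrightarrow> map ((*v) A) vs ! j"
          using \<open>j < k\<close> vs by (simp add: Y_def)
      qed (use vs in \<open>auto simp: Y_def\<close>)
      then have "(\<lambda>n. \<bar>multilinear k u (map ((*v) A) (Y n))\<bar>) \<longlonglongrightarrow> \<bar>multilinear k u (map ((*v) A) vs)\<bar>"
        by (rule tendsto_rabs)
      then show "\<bar>multilinear k u (map ((*v) A) vs)\<bar> \<le> (SUP vs\<in>V. \<bar>multilinear k u (map ((*v) A) vs)\<bar>)"
        by (rule LIMSEQ_le_const2) (auto intro!: cSUP_upper YV bdd)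
    qed
  qed
  show ?thesis
    unfolding eq
  proof (rule borel_measurable_cSUP[OF cV])
    show "(\<lambda>x. \<bar>multilinear k (w x) (map ((*v) A) vs)\<bar>) \<in> borel_measurable M" for vs
      unfolding multilinear_def
      by (intro borel_measurable_abs borel_measurable_sum borel_measurable_times borel_measurable_const w) simp
  qed (rule bdd)
qed

text \<open>Let \<open>g\<close> be the weak derivative along \<open>\<beta>\<close>, and for a test function \<open>\<phi>\<close> let \<open>u t\<close> be the integral of
  \<open>g\<close> against the translate of \<open>\<phi>\<close> by \<open>t *\<^sub>R v\<close>. Integration by parts turns \<open>u\<close> into an integral of \<open>f\<close>
  against translated derivatives of \<open>\<phi>\<close>. Its \<open>k\<close>-th derivative pairs \<open>f\<close> with the \<open>k\<close>-th derivative of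
  a test function in direction \<open>v\<close>, hence is \<open>0\<close> by \<open>dir\<close>. So \<open>u\<close> is a polynomial; it tends to \<open>0\<close>
  because \<open>g\<close> belongs to \<open>L\<^sup>p\<close>, hence it vanishes, and \<open>u 0\<close> is the pairing of \<open>g\<close> with \<open>\<phi>\<close>.\<close>

lemma top_order_weak_deriv_vanishes:
  fixes f :: "real^'n \<Rightarrow> real"
  assumes f: "f \<in> sobolev_loc k" and p: "p \<ge> 1" and v: "v \<noteq> 0"
    and dir: "AE x in lebesgue. (\<Sum>\<alpha> | length \<alpha> = k. (\<Prod>j<k. v $ (\<alpha> ! j)) * weak_deriv \<alpha> f x) = 0"
    and \<beta>: "length \<beta> = k" and fin: "(\<integral>\<^sup>+x. ennreal (\<bar>weak_deriv \<beta> f x\<bar> powr p) \<partial>lebesgue) < \<infinity>"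
  shows "AE x in lebesgue. weak_deriv \<beta> f x = 0"
proof -
  let ?g = "\<lambda>\<alpha>. weak_deriv \<alpha> f"
  have fl: "locally_integrable f" using f by (simp add: sobolev_loc_def)
  have wd: "has_weak_deriv f \<alpha> (?g \<alpha>)" if "length \<alpha> = k" for \<alpha>
    using that by (intro has_weak_deriv_weak_deriv[OF f]) auto
  then have gl: "locally_integrable (?g \<alpha>)" if "length \<alpha> = k" for \<alpha>
    using that by (simp add: has_weak_deriv_def)
  have wdi: "(LINT x|lebesgue. f x * iterated_partial \<alpha> \<psi> x) = (-1) ^ k * (LINT x|lebesgue. ?g \<alpha> x * \<psi> x)"
    if "length \<alpha> = k" "test_function \<psi>" for \<alpha> \<psi>
    using wd[OF that(1)] that by (simp add: has_weak_deriv_def)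
  have dir0: "(LINT x|lebesgue. f x * (dir_deriv v ^^ k) \<psi> x) = 0" if \<psi>: "test_function \<psi>" for \<psi>
  proof -
    have sm: "smooth \<psi>" using \<psi> unfolding test_function_iff by blast
    have "(LINT x|lebesgue. f x * (dir_deriv v ^^ k) \<psi> x)
        = (LINT x|lebesgue. (\<Sum>\<alpha> | length \<alpha> = k. (\<Prod>j<k. v $ (\<alpha> ! j)) * (f x * iterated_partial \<alpha> \<psi> x)))"
      unfolding dir_deriv_funpow[OF sm] by (simp add: sum_distrib_left mult_ac)
    also have "\<dots> = (\<Sum>\<alpha> | length \<alpha> = k. (\<Prod>j<k. v $ (\<alpha> ! j)) * (LINT x|lebesgue. f x * iterated_partial \<alpha> \<psi> x))"
      by (subst Bochner_Integration.integral_sum)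
        (auto intro!: integrable_mult_right integrable_mult_test_function fl test_function_iterated_partial \<psi>)
    also have "\<dots> = (\<Sum>\<alpha> | length \<alpha> = k. (\<Prod>j<k. v $ (\<alpha> ! j)) * ((-1) ^ k * (LINT x|lebesgue. ?g \<alpha> x * \<psi> x)))"
      by (intro sum.cong refl) (simp add: wdi \<psi>)
    also have "\<dots> = (-1) ^ k * (\<Sum>\<alpha> | length \<alpha> = k. (\<Prod>j<k. v $ (\<alpha> ! j)) * (LINT x|lebesgue. ?g \<alpha> x * \<psi> x))"
      by (simp add: sum_distrib_left mult_ac)
    also have "(\<Sum>\<alpha> | length \<alpha> = k. (\<Prod>j<k. v $ (\<alpha> ! j)) * (LINT x|lebesgue. ?g \<alpha> x * \<psi> x))
        = (LINT x|lebesgue. (\<Sum>\<alpha> | length \<alpha> = k. (\<Prod>j<k. v $ (\<alpha> ! j)) * (?g \<alpha> x * \<psi> x)))"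
      by (subst Bochner_Integration.integral_sum)
        (auto intro!: integrable_mult_right integrable_mult_test_function gl \<psi>)
    also have "\<dots> = (LINT x|lebesgue. (\<Sum>\<alpha> | length \<alpha> = k. (\<Prod>j<k. v $ (\<alpha> ! j)) * ?g \<alpha> x) * \<psi> x)"
      by (simp add: sum_distrib_right mult.assoc)
    also have "\<dots> = 0"
      by (rule integral_eq_zero_AE) (use dir in \<open>auto elim: eventually_mono\<close>)
    finally show ?thesis by simp
  qed
  show ?thesis
  proof (rule AE_zero_of_test_functions[OF gl[OF \<beta>]])
    fix \<phi> :: "real^'n \<Rightarrow> real" assume \<phi>: "test_function \<phi>"
    define \<psi> where "\<psi> = iterated_partial \<beta> \<phi>"
    have \<psi>: "test_function \<psi>" unfolding \<psi>_def by (rule test_function_iterated_partial[OF \<phi>])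
    have \<psi>t: "(\<lambda>y. \<psi> (y - c)) = iterated_partial \<beta> (\<lambda>y. \<phi> (y - c))" for c
      using iterated_partial_translation[of \<phi> \<beta> c] \<phi> unfolding test_function_iff \<psi>_def by simp
    define u where "u j t = (LINT y|lebesgue. f y * (dir_deriv v ^^ j) \<psi> (y - t *\<^sub>R v))" for j t
    have u0: "u 0 t = (-1) ^ k * (LINT y|lebesgue. ?g \<beta> y * \<phi> (y - t *\<^sub>R v))" for t
    proof -
      have "\<psi> (y - t *\<^sub>R v) = iterated_partial \<beta> (\<lambda>y. \<phi> (y - t *\<^sub>R v)) y" for y
        by (rule fun_cong[OF \<psi>t])
      then show ?thesis unfolding u_def using wdi[OF \<beta> test_function_translation[OF \<phi>]] by simp
    qed
    have "u 0 0 = 0"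
    proof (rule vanishing_if_polynomial_and_decaying[where u=u and k=k])
      show "(u j has_real_derivative - u (Suc j) t) (at t)" for j t
        unfolding u_def
        using integral_translate_has_derivative[OF fl test_function_dir_deriv_funpow[OF \<psi>], where v=v and t=t] by simp
      show "u k t = 0" for t
        unfolding u_def using dir0[OF test_function_translation[OF \<psi>]] dir_deriv_funpow_translation[OF \<psi>] by simp
      have "(\<lambda>n. (-1) ^ k * (LINT y|lebesgue. ?g \<beta> y * \<phi> (y - real n *\<^sub>R v))) \<longlonglongrightarrow> (-1) ^ k * 0"
        by (intro tendsto_mult tendsto_const integral_translate_tendsto_0[OF gl[OF \<beta>] p fin \<phi> v])
      then show "(\<lambda>n. u 0 (real n)) \<longlonglongrightarrow> 0" by (simp add: u0)
    qed
    then show "(LINT x|lebesgue. ?g \<beta> x * \<phi> x) = 0" by (simp add: u0)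
  qed
qed

section \<open>The energy of integer order\<close>

text \<open>For \<open>A\<close> in \<open>SL\<close> this is the energy of \<open>f \<circ> A\<close> for integer exponent \<open>k\<close>.\<close>

definition derivative_energy :: "nat \<Rightarrow> real \<Rightarrow> (real^'n \<Rightarrow> real) \<Rightarrow> real^'n^'n \<Rightarrow> ennreal" where
  "derivative_energy k p f A = (\<integral>\<^sup>+x. ennreal (pullback_norm k (\<lambda>\<alpha>. weak_deriv \<alpha> f x) A powr p) \<partial>lebesgue)"

lemma derivative_energy_measurable:
  assumes f: "f \<in> sobolev_loc k"
  shows "(\<lambda>x. ennreal (pullback_norm k (\<lambda>\<alpha>. weak_deriv \<alpha> f x) A powr p)) \<in> borel_measurable lebesgue"
proof -
  have "(\<lambda>x. weak_deriv \<alpha> f x) \<in> borel_measurable lebesgue" if "length \<alpha> = k" for \<alpha>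
    using has_weak_deriv_weak_deriv[OF f, of \<alpha>] that by (intro locally_integrable_imp_measurable) (simp add: has_weak_deriv_def)
  then have [measurable]: "(\<lambda>x. pullback_norm k (\<lambda>\<alpha>. weak_deriv \<alpha> f x) A) \<in> borel_measurable lebesgue"
    by (rule pullback_norm_measurable)
  show ?thesis by measurable
qed

lemma sobolev_energy_integer:
  fixes f :: "real^'n \<Rightarrow> real"
  assumes s: "s \<in> \<int>" and f: "f \<in> sobolev_loc (nat \<lfloor>s\<rfloor>)" and T: "T \<in> SL"
  shows "sobolev_energy s p (f \<circ> (*v) T) = derivative_energy (nat \<lfloor>s\<rfloor>) p f T"
proof -
  define k where "k = nat \<lfloor>s\<rfloor>"
  have f: "f \<in> sobolev_loc k" using f by (simp add: k_def)
  let ?N = "\<lambda>x. ennreal (pullback_norm k (\<lambda>\<alpha>. weak_deriv \<alpha> f x) T powr p)"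
  have "AE x in lebesgue. form_norm k (weak_derivative_form k (f \<circ> (*v) T) x) = pullback_norm k (\<lambda>\<alpha>. weak_deriv \<alpha> f (T *v x)) T"
    using weak_deriv_linear[OF f T]
  proof eventually_elim
    case (elim x)
    have "weak_derivative_form k (f \<circ> (*v) T) x vs = multilinear k (\<lambda>\<alpha>. weak_deriv \<alpha> f (T *v x)) (map ((*v) T) vs)"
      if "length vs = k" for vs
      unfolding weak_derivative_form_eq by (rule multilinear_linear[OF _ that]) (use elim in auto)
    then show ?case
      unfolding pullback_norm_def form_norm_def by (intro SUP_cong refl) auto
  qed
  then have "(\<integral>\<^sup>+x. ennreal (form_norm k (weak_derivative_form k (f \<circ> (*v) T) x) powr p) \<partial>lebesgue) = (\<integral>\<^sup>+x. ?N (T *v x) \<partial>lebesgue)"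
    by (intro nn_integral_cong_AE) (auto elim: eventually_mono)
  also have "\<dots> = (\<integral>\<^sup>+x. ?N x \<partial>distr lebesgue lebesgue ((*v) T))"
    by (rule nn_integral_distr[symmetric])
      (use lebesgue_measurable_linear[OF T] derivative_energy_measurable[OF f] in auto)
  also have "\<dots> = derivative_energy k p f T"
    unfolding distr_lebesgue_linear[OF T] derivative_energy_def ..
  finally show ?thesis
    unfolding sobolev_energy_def using s sobolev_loc_linear[OF f T] by (simp add: k_def)
qed

lemma derivative_energy_lsc:
  assumes f: "f \<in> sobolev_loc k" and p: "p > 0" and X: "X \<longlonglongrightarrow> A"
  shows "derivative_energy k p f A \<le> liminf (\<lambda>n. derivative_energy k p f (X n))"
proof -
  have "derivative_energy k p f A \<le> (\<integral>\<^sup>+x. liminf (\<lambda>n. ennreal (pullback_norm k (\<lambda>\<alpha>. weak_deriv \<alpha> f x) (X n) powr p)) \<partial>lebesgue)"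
    unfolding derivative_energy_def by (intro nn_integral_mono pullback_norm_powr_lsc X p)
  also have "\<dots> \<le> liminf (\<lambda>n. derivative_energy k p f (X n))"
    unfolding derivative_energy_def by (intro nn_integral_liminf derivative_energy_measurable f)
  finally show ?thesis .
qed

lemma derivative_energy_scale_le:
  assumes f: "f \<in> sobolev_loc k" and c: "c \<ge> 0" and p: "p > 0"
  shows "derivative_energy k p f (c *\<^sub>R A) \<le> ennreal ((c ^ k) powr p) * derivative_energy k p f A"
proof -
  have "derivative_energy k p f (c *\<^sub>R A) \<le> (\<integral>\<^sup>+x. ennreal ((c ^ k) powr p) * ennreal (pullback_norm k (\<lambda>\<alpha>. weak_deriv \<alpha> f x) A powr p) \<partial>lebesgue)"
    unfolding derivative_energy_def
  proof (rule nn_integral_mono)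
    fix x
    let ?w = "\<lambda>\<alpha>. weak_deriv \<alpha> f x"
    have "pullback_norm k ?w (c *\<^sub>R A) powr p \<le> (c ^ k * pullback_norm k ?w A) powr p"
      using p by (intro powr_mono2 pullback_norm_scale_le pullback_norm_nonneg c) auto
    also have "\<dots> = (c ^ k) powr p * pullback_norm k ?w A powr p"
      by (rule powr_mult)
    finally show "ennreal (pullback_norm k ?w (c *\<^sub>R A) powr p) \<le> ennreal ((c ^ k) powr p) * ennreal (pullback_norm k ?w A powr p)"
      by (simp add: ennreal_mult[symmetric] ennreal_leI)
  qed
  also have "\<dots> = ennreal ((c ^ k) powr p) * derivative_energy k p f A"
    unfolding derivative_energy_def by (intro nn_integral_cmult derivative_energy_measurable f)
  finally show ?thesis .
qed

text \<open>Evaluating the vanishing pullback at \<open>k\<close> copies of a basis vector shows that the derivative of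
  order \<open>k\<close> in the direction of a nonzero column \<open>v\<close> of \<open>L\<close> vanishes. As the derivatives of order \<open>k\<close>
  are in \<open>L\<^sup>p\<close>, all of them vanish.\<close>

lemma derivative_energy_degenerate:
  fixes f :: "real^'n \<Rightarrow> real"
  assumes f: "f \<in> sobolev_loc k" and p: "p \<ge> 1" and L: "L \<noteq> 0"
    and zero: "derivative_energy k p f L = 0" and fin: "derivative_energy k p f (mat 1) < \<infinity>"
  shows "derivative_energy k p f (mat 1) = 0"
proof -
  let ?g = "\<lambda>\<alpha>. weak_deriv \<alpha> f"
  obtain i where i: "L *v axis i 1 \<noteq> 0"
  proof -
    have "\<exists>i. column i L \<noteq> 0" using L by (auto simp: vec_eq_iff column_def)
    then show thesis using that by (auto simp: matrix_vector_mult_basis)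
  qed
  define v where "v = L *v axis i 1"
  have "AE x in lebesgue. ennreal (pullback_norm k (\<lambda>\<alpha>. ?g \<alpha> x) L powr p) = 0"
    by (rule iffD1[OF nn_integral_0_iff_AE[OF derivative_energy_measurable[OF f]] zero[unfolded derivative_energy_def]])
  then have dir: "AE x in lebesgue. (\<Sum>\<alpha> | length \<alpha> = k. (\<Prod>j<k. v $ (\<alpha> ! j)) * ?g \<alpha> x) = 0"
  proof eventually_elim
    case (elim x)
    then have "pullback_norm k (\<lambda>\<alpha>. ?g \<alpha> x) L = 0" by simp
    moreover have "replicate k (axis i 1) \<in> unit_lists k" by (auto simp: norm_axis_1)
    ultimately have "multilinear k (\<lambda>\<alpha>. ?g \<alpha> x) (map ((*v) L) (replicate k (axis i 1))) = 0"
      using pullback_norm_ge[of "replicate k (axis i 1)" k "\<lambda>\<alpha>. ?g \<alpha> x" L] by simp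
    moreover have "multilinear k (\<lambda>\<alpha>. ?g \<alpha> x) (map ((*v) L) (replicate k (axis i 1))) = (\<Sum>\<alpha> | length \<alpha> = k. (\<Prod>j<k. v $ (\<alpha> ! j)) * ?g \<alpha> x)"
      unfolding multilinear_def by (intro sum.cong refl) (simp add: v_def mult.commute)
    ultimately show ?case by simp
  qed
  have g0: "AE x in lebesgue. ?g \<beta> x = 0" if \<beta>: "length \<beta> = k" for \<beta>
  proof (rule top_order_weak_deriv_vanishes[OF f p _ dir \<beta>])
    show "v \<noteq> 0" using i by (simp add: v_def)
    have "\<bar>?g \<beta> x\<bar> \<le> pullback_norm k (\<lambda>\<alpha>. ?g \<alpha> x) (mat 1)" for x
    proof -
      let ?vs = "map (\<lambda>l. axis l 1) \<beta> :: (real^'n) list"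
      have "(\<Prod>j<k. (map ((*v) (mat 1)) ?vs ! j) $ (\<alpha> ! j)) = (if \<alpha> = \<beta> then 1 else 0)" if len: "length \<alpha> = k" for \<alpha>
      proof (cases "\<alpha> = \<beta>")
        case False
        then obtain j where "j < k" "\<alpha> ! j \<noteq> \<beta> ! j" using len \<beta> by (auto simp: list_eq_iff_nth_eq)
        then show ?thesis using False \<beta> by (auto intro!: bexI[of _ j] simp: axis_def)
      qed (use \<beta> in \<open>simp add: axis_def\<close>)
      then have "multilinear k (\<lambda>\<alpha>. ?g \<alpha> x) (map ((*v) (mat 1)) ?vs) = (\<Sum>\<alpha> | length \<alpha> = k. if \<alpha> = \<beta> then ?g \<beta> x else 0)"
        unfolding multilinear_def by (intro sum.cong refl) auto
      also have "\<dots> = ?g \<beta> x" using \<beta> by simp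
      finally have "multilinear k (\<lambda>\<alpha>. ?g \<alpha> x) (map ((*v) (mat 1)) ?vs) = ?g \<beta> x" .
      moreover have "?vs \<in> unit_lists k" using \<beta> by (auto simp: norm_axis_1)
      ultimately show ?thesis using pullback_norm_ge[of ?vs k "\<lambda>\<alpha>. ?g \<alpha> x" "mat 1"] by simp
    qed
    then have "(\<integral>\<^sup>+x. ennreal (\<bar>?g \<beta> x\<bar> powr p) \<partial>lebesgue) \<le> derivative_energy k p f (mat 1)"
      unfolding derivative_energy_def using p by (intro nn_integral_mono ennreal_leI powr_mono2) auto
    then show "(\<integral>\<^sup>+x. ennreal (\<bar>?g \<beta> x\<bar> powr p) \<partial>lebesgue) < \<infinity>" using fin by (rule le_less_trans)
  qed
  have "AE x in lebesgue. \<forall>\<beta>\<in>{\<beta>. length \<beta> = k}. ?g \<beta> x = 0"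
    using g0 by (intro AE_ball_countable') (auto intro: countable_finite)
  then have "AE x in lebesgue. ennreal (pullback_norm k (\<lambda>\<alpha>. ?g \<alpha> x) (mat 1) powr p) = 0"
  proof eventually_elim
    case (elim x)
    then have "multilinear k (\<lambda>\<alpha>. ?g \<alpha> x) vs = 0" for vs
      unfolding multilinear_def by (intro sum.neutral) auto
    then have "pullback_norm k (\<lambda>\<alpha>. ?g \<alpha> x) (mat 1) \<le> 0" by (intro pullback_norm_le) simp
    then have "pullback_norm k (\<lambda>\<alpha>. ?g \<alpha> x) (mat 1) = 0" using pullback_norm_nonneg by (intro antisym)
    then show ?case by simp
  qed
  then show ?thesis unfolding derivative_energy_def
    by (rule iffD2[OF nn_integral_0_iff_AE[OF derivative_energy_measurable[OF f]]])
qed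

text \<open>The energy is homogeneous of degree \<open>k * p\<close> in the matrix. If it stays bounded along \<open>X\<close>, it tends
  to \<open>0\<close> along the normalized matrices, hence vanishes at the limit \<open>L\<close> by semicontinuity.\<close>

lemma derivative_energy_coercive:
  fixes f :: "real^'n \<Rightarrow> real"
  assumes f: "f \<in> sobolev_loc k" and k: "k \<ge> 1" and p: "p \<ge> 1"
    and top: "filterlim (\<lambda>n. norm (X n)) at_top sequentially"
    and L: "(\<lambda>n. X n /\<^sub>R norm (X n)) \<longlonglongrightarrow> L" "norm L = 1"
    and bdd: "\<And>n. derivative_energy k p f (X n) \<le> C" "C < \<infinity>"
    and fin: "derivative_energy k p f (mat 1) < \<infinity>"
  shows "derivative_energy k p f (mat 1) = 0"
proof (rule derivative_energy_degenerate[OF f p _ _ fin])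
  show "L \<noteq> 0" using L(2) by auto
  let ?c = "\<lambda>n. inverse (norm (X n))"
  have "derivative_energy k p f L \<le> liminf (\<lambda>n. derivative_energy k p f (X n /\<^sub>R norm (X n)))"
    using p by (intro derivative_energy_lsc f L) auto
  also have "\<dots> \<le> liminf (\<lambda>n. ennreal ((?c n ^ k) powr p) * C)"
  proof (intro Liminf_mono always_eventually allI)
    fix n
    have "derivative_energy k p f (?c n *\<^sub>R X n) \<le> ennreal ((?c n ^ k) powr p) * derivative_energy k p f (X n)"
      using p by (intro derivative_energy_scale_le f) auto
    also have "\<dots> \<le> ennreal ((?c n ^ k) powr p) * C" by (intro mult_left_mono bdd) auto
    finally show "derivative_energy k p f (X n /\<^sub>R norm (X n)) \<le> ennreal ((?c n ^ k) powr p) * C" .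
  qed
  also have "\<dots> = 0"
  proof (rule lim_imp_Liminf)
    have "?c \<longlonglongrightarrow> 0" by (rule tendsto_inverse_0_at_top[OF top])
    then have "(\<lambda>n. ?c n ^ k) \<longlonglongrightarrow> 0" using k tendsto_power[of ?c 0 sequentially k] by (simp add: power_0_left)
    then have "(\<lambda>n. (?c n ^ k) powr p) \<longlonglongrightarrow> 0 powr p"
      using p by (intro tendsto_powr' tendsto_const) auto
    then have "(\<lambda>n. ennreal ((?c n ^ k) powr p)) \<longlonglongrightarrow> ennreal 0"
      by (intro tendsto_ennrealI) simp
    then have "(\<lambda>n. C * ennreal ((?c n ^ k) powr p)) \<longlonglongrightarrow> C * ennreal 0"
      using bdd(2) by (intro ennreal_tendsto_cmult) auto
    then show "(\<lambda>n. ennreal ((?c n ^ k) powr p) * C) \<longlonglongrightarrow> 0" by (simp add: mult.commute)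
  qed simp
  finally show "derivative_energy k p f L = 0" by simp
qed

lemma sobolev_energy_minimizer_integer:
  fixes f :: "real^'n \<Rightarrow> real"
  assumes s: "s > 0" "s \<in> \<int>" and p: "p \<ge> 1" and f: "f \<in> sobolev_loc (nat \<lfloor>s\<rfloor>)" and fin: "sobolev_energy s p f < \<infinity>"
  shows "\<exists>T\<in>SL. \<forall>S\<in>SL. sobolev_energy s p (f \<circ> (*v) T) \<le> sobolev_energy s p (f \<circ> (*v) S)"
proof -
  let ?E = "derivative_energy (nat \<lfloor>s\<rfloor>) p f"
  have E: "sobolev_energy s p (f \<circ> (*v) T) = ?E T" if "T \<in> SL" for T
    by (rule sobolev_energy_integer[OF s(2) f that])
  have one: "mat 1 \<in> (SL :: (real^'n^'n) set)" by (simp add: SL_def)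
  have "f \<circ> (*v) (mat 1) = f" by auto
  then have fin1: "?E (mat 1) < \<infinity>" using E[OF one] fin by simp
  have k: "nat \<lfloor>s\<rfloor> \<ge> 1" using s by (auto elim!: Ints_cases)
  have "\<exists>T\<in>SL. \<forall>S\<in>SL. ?E T \<le> ?E S"
  proof (rule SL_has_minimizer)
    show "?E T \<le> liminf (\<lambda>k. ?E (X k))" if "X \<longlonglongrightarrow> T" for X T
      using that p by (intro derivative_energy_lsc f) auto
    show "?E (mat 1) = 0"
      if "filterlim (\<lambda>k. norm (X k)) at_top sequentially" "(\<lambda>k. X k /\<^sub>R norm (X k)) \<longlonglongrightarrow> L"
        "norm L = 1" "\<And>k. ?E (X k) \<le> C" "C < \<infinity>" for X L C
      using derivative_energy_coercive[OF f k p that fin1] .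
  qed (rule fin1)
  then show ?thesis using E by auto
qed

section \<open>Existence of a minimizer\<close>

lemma sobolev_seminorm_mono:
  assumes "sobolev_energy s p f \<le> sobolev_energy s p g" and "p > 0"
  shows "sobolev_seminorm s p f \<le> sobolev_seminorm s p g"
proof (cases "sobolev_energy s p g = \<infinity>")
  case False
  then have "sobolev_energy s p f \<noteq> \<infinity>" using assms(1) by (auto simp: top_unique)
  moreover have "enn2real (sobolev_energy s p f) \<le> enn2real (sobolev_energy s p g)"
    using assms(1) False by (intro enn2real_mono) (auto simp: less_top)
  ultimately show ?thesis
    using False assms(2) by (auto simp: sobolev_seminorm_def intro!: ennreal_leI powr_mono2)
qed (simp add: sobolev_seminorm_def)

theorem theorem1p3:
  fixes s p :: real and f :: "real^'n \<Rightarrow> real"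
  assumes "CARD('n) \<ge> 2"
    and "s > 0" and "p \<ge> 1"
    and "f \<in> homogeneous_sobolev s p"
  shows "\<exists>T\<^sub>f \<in> SL. \<forall>T \<in> SL.
    sobolev_seminorm s p (f \<circ> (*v) T\<^sub>f) \<le> sobolev_seminorm s p (f \<circ> (*v) T)"
proof -
  have "sobolev_seminorm s p f < \<infinity>" using assms(4) by (simp add: homogeneous_sobolev_def)
  then have fin: "sobolev_energy s p f < \<infinity>"
    by (auto simp: sobolev_seminorm_def less_top split: if_splits)
  have "\<exists>T\<in>SL. \<forall>S\<in>SL. sobolev_energy s p (f \<circ> (*v) T) \<le> sobolev_energy s p (f \<circ> (*v) S)"
  proof (cases "s \<in> \<int>")
    case True
    then show ?thesis
      using assms fin by (intro sobolev_energy_minimizer_integer) (auto simp: homogeneous_sobolev_def)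
  next
    case False
    then show ?thesis
      using assms fin by (intro sobolev_energy_minimizer_fractional) (auto simp: homogeneous_sobolev_def)
  qed
  then show ?thesis using assms(3) by (meson sobolev_seminorm_mono less_le_trans zero_less_one)
qed

end
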